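(* Let $\Gamma\in\mathcal S$ have $n$ vertices and let $\varphi$ be an embedding into $\mathbb Z^n$ such that exactly one index is of type (9) and every other index is of type (4) or (7). Then $\Gamma\in\mathcal W\cup\mathcal N\cup\mathcal M\cup\mathcal A\cup\mathcal B$.
   Context: A plumbing tree is a finite tree $\Gamma$ each of whose vertices $v$ carries an integer decoration $d(v)$. $\Gamma$ is minimal if no vertex has decoration $-1$. For $n\ge 1$ let $(\mathbb Z^n,Q_n)$ be the lattice with basis $E_1,\dots,E_n$ and $Q_n(E_i,E_j)=-\delta_{ij}$, and let $K=\sum_{i=1}^n E_i$. A plumbing tree $\Gamma$ on $n$ vertices is a symplectic plumbing tree if there is a map $\varphi$ (an embedding) from its vertex set to $\mathbb Z^n$ such that: for distinct vertices $v_1,v_2$, $Q_n(\varphi(v_1),\varphi(v_2))$ is $1$ if they are adjacent and $0$ otherwise; $Q_n(\varphi(v),\varphi(v))=d(v)$ for every $v$; and $Q_n(\varphi(v),K)+Q_n(\varphi(v),\varphi(v))=-2$ for every $v$. $\mathcal S$ is the set of minimal, connected symplectic plumbing trees. Index types: write $\varphi(v)=\sum_i a_{v,i}E_i$; for an index $i$ consider the multiset of nonzero coefficients $a_{v,i}$ as $v$ ranges over all vertices. Index $i$ is of type (1) if this multiset is $\{1\}$, (2) if $\{-1\}$, (3) if $\{-2\}$, (4) if $\{1,-1\}$, (5) if $\{1,-2\}$, (6) if $\{-1,-1\}$, (7) if $\{1,-1,-1\}$, (9) if $\{1,-1,-1,-1\}$, and (10) if it is empty. (W) For $p,q,r\ge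 0$, $\Gamma_{p,q,r}$ is the tree with a central vertex of decoration $-4$ and three legs (chains starting at a vertex adjacent to the center): $q$ vertices of decoration $-2$ followed by an end vertex $-(p+3)$; $r$ vertices $-2$ followed by an end vertex $-(q+3)$; $p$ vertices $-2$ followed by an end vertex $-(r+3)$. $\mathcal W=\{\Gamma_{p,q,r}:p,q,r\ge0\}$. (N) For $p\ge1$, $q,r\ge 0$, $\Delta_{p,q,r}$ has a central vertex $-3$ with three legs: a single vertex $-(p+2)$; $r$ vertices $-2$ followed by an end vertex $-(q+4)$; and (from the center) $q$ vertices $-2$, one vertex $-3$, $p-1$ vertices $-2$, and an end vertex $-(r+3)$. For $q,r\ge0$, $\Delta_{0,q,r}$ has a central vertex $-3$ with legs: a single vertex $-2$; $q$ vertices $-2$ followed by an end vertex $-(r+4)$; $r$ vertices $-2$ followed by an end vertex $-(q+4)$. $\mathcal N=\{\Delta_{p,q,r}:p,q,r\ge 0\}$. (M) For $p,r\ge1$, $q\ge0$, $\Lambda_{p,q,r}$ has a central vertex $-2$ with legs: a single vertex $-(p+2)$; a single vertex $-(r+3)$; and (from the center) $q$ vertices $-2$, one vertex $-3$, $r-1$ vertices $-2$, one vertex $-3$, $p-1$ vertices $-2$, and an end vertex $-(q+4)$. For $q\ge0,r\ge1$, $\Lambda_{0,q,r}$ has a central vertex $-2$ with legs: a single vertex $-2$; a single vertex $-(r+3)$; and $q$ vertices $-2$, one vertex $-3$, $r-1$ vertices $-2$, an end vertex $-(q+5)$. For $p\ge1,q\ge0$, $\Lambda_{p,q,0}$ has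 a central vertex $-2$ with legs: a single vertex $-(p+2)$; a single vertex $-3$; and $q$ vertices $-2$, one vertex $-4$, $p-1$ vertices $-2$, an end vertex $-(q+4)$. $\mathcal M=\{\Lambda_{p,q,r}: p,q,r\ge0,\ (p,r)\neq(0,0)\}$. (A,B) If $u$ is a vertex of decoration $-1$, blowing up $u$ means adding a new vertex of decoration $-1$ adjacent only to $u$ and decreasing $d(u)$ by $1$; blowing up an edge $uw$ means deleting that edge, adding a new vertex of decoration $-1$ adjacent exactly to $u$ and $w$, and decreasing $d(u)$ and $d(w)$ by $1$. Let $T_a,T_b$ be the trees with a central vertex of decoration $-1$ and three leaves of decorations $(-3,-3,-3)$, $(-4,-4,-2)$ respectively. $\mathcal A$ is the set of trees obtained from $T_a$ by a finite (possibly empty) sequence of blow-ups, each of which blows up the current unique $(-1)$-vertex or an edge emanating from it, followed by changing the decoration of the unique $(-1)$-vertex to $-4$; $\mathcal B$ is defined in the same way starting from $T_b$ with final decoration $-3$. *)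

theory Defs
  imports Main "HOL-Library.Multiset"
begin

definition plumb_graph :: "'v set \<Rightarrow> ('v \<Rightarrow> 'v \<Rightarrow> bool) \<Rightarrow> bool" where
  "plumb_graph V E \<longleftrightarrow> finite V \<and>
     (\<forall>a b. E a b \<longrightarrow> a \<in> V \<and> b \<in> V) \<and>
     (\<forall>a b. E a b \<longrightarrow> E b a) \<and> (\<forall>a. \<not> E a a)"

definition graph_edges :: "'v set \<Rightarrow> ('v \<Rightarrow> 'v \<Rightarrow> bool) \<Rightarrow> 'v set set" where
  "graph_edges V E = {{a, b} | a b. a \<in> V \<and> b \<in> V \<and> E a b}"

definition graph_connected :: "'v set \<Rightarrow> ('v \<Rightarrow> 'v \<Rightarrow> bool) \<Rightarrow> bool" where
  "graph_connected V E \<longleftrightarrow> (\<forall>x\<in>V. \<forall>y\<in>V. E\<^sup>*\<^sup>* x y)"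

definition is_tree :: "'v set \<Rightarrow> ('v \<Rightarrow> 'v \<Rightarrow> bool) \<Rightarrow> bool" where
  "is_tree V E \<longleftrightarrow> plumb_graph V E \<and> V \<noteq> {} \<and> graph_connected V E \<and>
     card (graph_edges V E) = card V - 1"

definition minimal_plumbing :: "'v set \<Rightarrow> ('v \<Rightarrow> int) \<Rightarrow> bool" where
  "minimal_plumbing V d \<longleftrightarrow> (\<forall>v\<in>V. d v \<noteq> -1)"

text \<open>The lattice (Z^n, Q_n): vectors are functions nat \<Rightarrow> int supported on {0..<n}.\<close>
definition Qn :: "nat \<Rightarrow> (nat \<Rightarrow> int) \<Rightarrow> (nat \<Rightarrow> int) \<Rightarrow> int" where
  "Qn n x y = - (\<Sum>i<n. x i * y i)"

definition Kn :: "nat \<Rightarrow> nat \<Rightarrow> int" where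
  "Kn n = (\<lambda>i. if i < n then 1 else 0)"

definition symplectic_embedding ::
  "'v set \<Rightarrow> ('v \<Rightarrow> 'v \<Rightarrow> bool) \<Rightarrow> ('v \<Rightarrow> int) \<Rightarrow> ('v \<Rightarrow> nat \<Rightarrow> int) \<Rightarrow> bool" where
  "symplectic_embedding V E d \<phi> \<longleftrightarrow>
     (let n = card V in
       (\<forall>v\<in>V. \<forall>i. n \<le> i \<longrightarrow> \<phi> v i = 0) \<and>
       (\<forall>v1\<in>V. \<forall>v2\<in>V. v1 \<noteq> v2 \<longrightarrow>
           Qn n (\<phi> v1) (\<phi> v2) = (if E v1 v2 then 1 else 0)) \<and>
       (\<forall>v\<in>V. Qn n (\<phi> v) (\<phi> v) = d v) \<and>
       (\<forall>v\<in>V. Qn n (\<phi> v) (Kn n) + Qn n (\<phi> v) (\<phi> v) = -2))"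

definition in_S :: "'v set \<Rightarrow> ('v \<Rightarrow> 'v \<Rightarrow> bool) \<Rightarrow> ('v \<Rightarrow> int) \<Rightarrow> bool" where
  "in_S V E d \<longleftrightarrow> is_tree V E \<and> minimal_plumbing V d \<and>
     (\<exists>\<phi>. symplectic_embedding V E d \<phi>)"

definition index_coeffs :: "'v set \<Rightarrow> ('v \<Rightarrow> nat \<Rightarrow> int) \<Rightarrow> nat \<Rightarrow> int multiset" where
  "index_coeffs V \<phi> i = filter_mset (\<lambda>a. a \<noteq> 0) (image_mset (\<lambda>v. \<phi> v i) (mset_set V))"

definition index_type4 where "index_type4 V \<phi> i \<longleftrightarrow> index_coeffs V \<phi> i = {#1, -1#}"
definition index_type7 where "index_type7 V \<phi> i \<longleftrightarrow> index_coeffs V \<phi> i = {#1, -1, -1#}"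
definition index_type9 where "index_type9 V \<phi> i \<longleftrightarrow> index_coeffs V \<phi> i = {#1, -1, -1, -1#}"

definition plumb_iso ::
  "'v set \<Rightarrow> ('v \<Rightarrow> 'v \<Rightarrow> bool) \<Rightarrow> ('v \<Rightarrow> int) \<Rightarrow>
   'w set \<Rightarrow> ('w \<Rightarrow> 'w \<Rightarrow> bool) \<Rightarrow> ('w \<Rightarrow> int) \<Rightarrow> bool" where
  "plumb_iso V1 E1 d1 V2 E2 d2 \<longleftrightarrow> (\<exists>f. bij_betw f V1 V2 \<and>
     (\<forall>x\<in>V1. \<forall>y\<in>V1. E2 (f x) (f y) = E1 x y) \<and> (\<forall>x\<in>V1. d2 (f x) = d1 x))"

text \<open>Center is (0,0); the j-th vertex (counted from the center, starting at 0)
of leg i (1-based) is (i,j). A leg is given by its list of decorations,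
listed from the center outwards.\<close>

definition star_V :: "int list list \<Rightarrow> (nat \<times> nat) set" where
  "star_V legs = insert (0,0)
     {(i,j). 1 \<le> i \<and> i \<le> length legs \<and> j < length (legs ! (i - 1))}"

definition star_E :: "int list list \<Rightarrow> nat \<times> nat \<Rightarrow> nat \<times> nat \<Rightarrow> bool" where
  "star_E legs a b \<longleftrightarrow> a \<in> star_V legs \<and> b \<in> star_V legs \<and>
     ((a = (0,0) \<and> 1 \<le> fst b \<and> snd b = 0) \<or>
      (b = (0,0) \<and> 1 \<le> fst a \<and> snd a = 0) \<or>
      (1 \<le> fst a \<and> fst a = fst b \<and> (snd b = snd a + 1 \<or> snd a = snd b + 1)))"

definition star_d :: "int \<Rightarrow> int list list \<Rightarrow> nat \<times> nat \<Rightarrow> int" where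
  "star_d c legs v = (if fst v = 0 then c else legs ! (fst v - 1) ! snd v)"

definition iso_star :: "'v set \<Rightarrow> ('v \<Rightarrow> 'v \<Rightarrow> bool) \<Rightarrow> ('v \<Rightarrow> int) \<Rightarrow> int \<Rightarrow> int list list \<Rightarrow> bool" where
  "iso_star V E d c legs \<longleftrightarrow> plumb_iso V E d (star_V legs) (star_E legs) (star_d c legs)"

abbreviation twos :: "nat \<Rightarrow> int list" where "twos k \<equiv> replicate k (-2)"

definition Gamma_legs :: "nat \<Rightarrow> nat \<Rightarrow> nat \<Rightarrow> int list list" where
  "Gamma_legs p q r =
     [twos q @ [- (int p + 3)], twos r @ [- (int q + 3)], twos p @ [- (int r + 3)]]"

definition in_W :: "'v set \<Rightarrow> ('v \<Rightarrow> 'v \<Rightarrow> bool) \<Rightarrow> ('v \<Rightarrow> int) \<Rightarrow> bool" where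
  "in_W V E d \<longleftrightarrow> (\<exists>p q r. iso_star V E d (-4) (Gamma_legs p q r))"

definition Delta_legs :: "nat \<Rightarrow> nat \<Rightarrow> nat \<Rightarrow> int list list" where
  "Delta_legs p q r =
     (if p \<ge> 1 then
        [[- (int p + 2)], twos r @ [- (int q + 4)],
         twos q @ [-3] @ twos (p - 1) @ [- (int r + 3)]]
      else
        [[-2], twos q @ [- (int r + 4)], twos r @ [- (int q + 4)]])"

definition in_N :: "'v set \<Rightarrow> ('v \<Rightarrow> 'v \<Rightarrow> bool) \<Rightarrow> ('v \<Rightarrow> int) \<Rightarrow> bool" where
  "in_N V E d \<longleftrightarrow> (\<exists>p q r. iso_star V E d (-3) (Delta_legs p q r))"

definition Lambda_legs :: "nat \<Rightarrow> nat \<Rightarrow> nat \<Rightarrow> int list list" where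
  "Lambda_legs p q r =
     (if p \<ge> 1 \<and> r \<ge> 1 then
        [[- (int p + 2)], [- (int r + 3)],
         twos q @ [-3] @ twos (r - 1) @ [-3] @ twos (p - 1) @ [- (int q + 4)]]
      else if p = 0 then
        [[-2], [- (int r + 3)],
         twos q @ [-3] @ twos (r - 1) @ [- (int q + 5)]]
      else
        [[- (int p + 2)], [-3],
         twos q @ [-4] @ twos (p - 1) @ [- (int q + 4)]])"

definition in_M :: "'v set \<Rightarrow> ('v \<Rightarrow> 'v \<Rightarrow> bool) \<Rightarrow> ('v \<Rightarrow> int) \<Rightarrow> bool" where
  "in_M V E d \<longleftrightarrow> (\<exists>p q r. (p, r) \<noteq> (0, 0) \<and> iso_star V E d (-2) (Lambda_legs p q r))"

type_synonym bstate = "nat set \<times> (nat \<Rightarrow> nat \<Rightarrow> bool) \<times> (nat \<Rightarrow> int) \<times> nat"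

text \<open>A state (V,E,d,u) records the current tree and its unique (-1)-vertex u.
Each step blows up u or an edge u x emanating from u; the new (-1)-vertex w
becomes the tracked vertex.\<close>
inductive blowup_seq :: "bstate \<Rightarrow> bstate \<Rightarrow> bool" where
  refl: "blowup_seq S S"
| vtx: "blowup_seq S (V, E, d, u) \<Longrightarrow> w \<notin> V \<Longrightarrow>
     blowup_seq S (insert w V,
                   \<lambda>a b. E a b \<or> (a = u \<and> b = w) \<or> (a = w \<and> b = u),
                   (d(u := d u - 1))(w := -1), w)"
| edge: "blowup_seq S (V, E, d, u) \<Longrightarrow> E u x \<Longrightarrow> w \<notin> V \<Longrightarrow>
     blowup_seq S (insert w V,
                   \<lambda>a b. (E a b \<and> \<not> ((a = u \<and> b = x) \<or> (a = x \<and> b = u)))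
                         \<or> (a = u \<and> b = w) \<or> (a = w \<and> b = u)
                         \<or> (a = x \<and> b = w) \<or> (a = w \<and> b = x),
                   (d(u := d u - 1, x := d x - 1))(w := -1), w)"

definition T3_E :: "nat \<Rightarrow> nat \<Rightarrow> bool" where
  "T3_E a b \<longleftrightarrow> (a = 0 \<and> b \<in> {1,2,3}) \<or> (b = 0 \<and> a \<in> {1,2,3})"

definition T_a :: bstate where
  "T_a = ({0,1,2,3}, T3_E, (\<lambda>v. if v = 0 then -1 else -3), 0)"

definition T_b :: bstate where
  "T_b = ({0,1,2,3}, T3_E,
          (\<lambda>v. if v = 0 then -1 else if v = 3 then -2 else -4), 0)"

definition in_A :: "'v set \<Rightarrow> ('v \<Rightarrow> 'v \<Rightarrow> bool) \<Rightarrow> ('v \<Rightarrow> int) \<Rightarrow> bool" where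
  "in_A V E d \<longleftrightarrow> (\<exists>V' E' d' u. blowup_seq T_a (V', E', d', u) \<and>
      plumb_iso V E d V' E' (d'(u := -4)))"

definition in_B :: "'v set \<Rightarrow> ('v \<Rightarrow> 'v \<Rightarrow> bool) \<Rightarrow> ('v \<Rightarrow> int) \<Rightarrow> bool" where
  "in_B V E d \<longleftrightarrow> (\<exists>V' E' d' u. blowup_seq T_b (V', E', d', u) \<and>
      plumb_iso V E d V' E' (d'(u := -3)))"

end

theory Submission
  imports Defs
begin

text \<open>
By adjunction every vertex has the form \<open>E\<^sub>v - \<Sum> E\<^sub>z\<close>, the sum ranging over the out-neighbours
\<open>z\<close> of \<open>v\<close> in a digraph \<open>R\<close> on the vertices; the index types say that all in-degrees are 1 or 2,
except for one vertex \<open>h\<close> of in-degree 3. The tree has an edge between \<open>u\<close> and \<open>v\<close> iff the number of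
arcs between them exceeds their number of common out-neighbours.

Adjunction for the sum of a nonempty set \<open>U\<close> of vertices, together with the fact that subgraphs of a
tree are forests, shows that \<open>U\<close> contains a vertex without in-neighbour in \<open>U\<close>, or one with three,
or that some vertex outside \<open>U\<close> has two in-neighbours in \<open>U\<close>. Hence \<open>R\<close> is acyclic away from the
set \<open>A\<close> of in-neighbours of \<open>h\<close>, and everything outside \<open>A\<close> descends from \<open>h\<close>. The set \<open>A\<close> is a directed
triangle \<open>a0 \<rightarrow> a1 \<rightarrow> a2 \<rightarrow> a0\<close>, or \<open>a0 \<leftrightarrow> a1\<close> with arcs from both to \<open>a2\<close>; if all
arcs within \<open>A\<close> were present, some vertex would have no out-neighbour. A further
in-neighbour \<open>b\<close> of a member \<open>a\<close> of \<open>A\<close> ends a chain of out-neighbours of the in-neighbour \<open>a'\<close> of \<open>a\<close>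
in \<open>A\<close>; this chain starts at \<open>h\<close> or at the further in-neighbour of \<open>a'\<close>. If some chain starts at \<open>h\<close>, the chains exhaust the tree
and the graph lies in \<open>W\<close>, \<open>N\<close> or \<open>M\<close>. Otherwise a single vertex \<open>w\<close> hits
\<open>A\<close>; deleting its arcs to \<open>A\<close> turns \<open>w\<close> into the (-1)-vertex of a tree that blows down to \<open>T\<^sub>a\<close> or \<open>T\<^sub>b\<close>.
\<close>

section \<open>Edge counts in trees and the recognition of trees with three legs\<close>

section \<open>Trees and stars\<close>

text \<open>Edges are counted as ordered pairs. Connectedness yields an edge that leaves
  \<open>U\<close>, and absorbing its far end gains at least two pairs; this is the induction step
  on \<open>card (V - U)\<close>. A singleton \<open>U\<close> bounds the edges of a connected graph
  from below, a general \<open>U\<close> leads to the forest bound for trees.\<close>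

lemma connected_pairs_card:
  fixes E :: "'v \<Rightarrow> 'v \<Rightarrow> bool"
  assumes g: "plumb_graph V E" and c: "graph_connected V E"
    and "U \<subseteq> V" and "U \<noteq> {}"
  shows "card {(x,y). x \<in> U \<and> y \<in> U \<and> E x y} + 2 * card (V - U) \<le> card {(x,y). E x y}"
  using assms(3,4)
proof (induction "card (V - U)" arbitrary: U)
  case 0
  have fin: "finite V" using g by (simp add: plumb_graph_def)
  have "V - U = {}" using 0 fin by (metis card_0_eq finite_Diff)
  then have "U = V" using 0 by blast
  moreover have "{(x,y). x \<in> V \<and> y \<in> V \<and> E x y} = {(x,y). E x y}"
    using g by (auto simp: plumb_graph_def)
  ultimately show ?case by simp
next
  case (Suc k)
  have fin: "finite V" using g by (simp add: plumb_graph_def)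
  have "V - U \<noteq> {}" using Suc.hyps(2) by (metis card.empty nat.distinct(1))
  then obtain z where z: "z \<in> V" "z \<notin> U" by blast
  obtain w where w: "w \<in> U" using Suc.prems by blast
  have "E\<^sup>*\<^sup>* w z" using c z w Suc.prems by (auto simp: graph_connected_def)
  then have "\<exists>x\<in>U. \<exists>y. y \<notin> U \<and> E x y" using z(2) w
    by (induction rule: rtranclp_induct) auto
  then obtain x y where xy: "x \<in> U" "y \<notin> U" "E x y" by blast
  have yV: "y \<in> V" and yx: "E y x" using g xy(3) by (auto simp: plumb_graph_def)
  let ?P = "\<lambda>U. {(x,y). x \<in> U \<and> y \<in> U \<and> E x y}"
  have finP: "finite (?P (insert y U))"
    by (rule finite_subset[of _ "V \<times> V"]) (use Suc.prems yV fin in auto)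
  have "?P U \<union> {(x,y), (y,x)} \<subseteq> ?P (insert y U)" using xy yx by auto
  then have "card (?P U \<union> {(x,y), (y,x)}) \<le> card (?P (insert y U))"
    using card_mono[OF finP] by blast
  moreover have "card (?P U \<union> {(x,y), (y,x)}) = card (?P U) + card {(x,y), (y,x)}"
    by (rule card_Un_disjoint) (use xy finP in \<open>auto intro: finite_subset[OF _ finP]\<close>)
  moreover have "card {(x,y), (y,x)} = 2" using xy(1,2) by (subst card_2_iff) blast
  ultimately have 1: "card (?P U) + 2 \<le> card (?P (insert y U))" by simp
  have "V - insert y U = (V - U) - {y}" by auto
  then have k: "k = card (V - insert y U)" using Suc.hyps(2) yV xy(2) fin by simp
  have "card (?P (insert y U)) + 2 * card (V - insert y U) \<le> card {(x,y). E x y}"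
    using Suc.hyps(1)[OF k] Suc.prems yV by simp
  then show ?case using 1 k Suc.hyps(2) by linarith
qed

lemma pairs_card_le:
  assumes g: "plumb_graph V E"
  shows "card {(x,y). E x y} \<le> 2 * card (graph_edges V E)"
proof -
  have fin: "finite V" using g by (simp add: plumb_graph_def)
  have finE: "finite (graph_edges V E)"
    by (rule finite_subset[of _ "Pow V"]) (use fin in \<open>auto simp: graph_edges_def\<close>)
  let ?f = "\<lambda>e. {(x,y). {x,y} = e} :: ('a \<times> 'a) set"
  have sub: "?f e \<subseteq> {(a,b),(b,a)}" if "e = {a,b}" for e a b
    using that by (auto simp: doubleton_eq_iff)
  have fe: "finite (?f e) \<and> card (?f e) \<le> 2" if eE: "e \<in> graph_edges V E" for e
  proof -
    obtain a b where e: "e = {a,b}" using eE by (auto simp: graph_edges_def)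
    have "card (?f e) \<le> card {(a,b),(b,a)}" by (rule card_mono[OF _ sub[OF e]]) simp
    also have "\<dots> \<le> 2" using card_length[of "[(a,b),(b,a)]"] by simp
    finally show ?thesis using finite_subset[OF sub[OF e]] by simp
  qed
  have "{(x,y). E x y} \<subseteq> (\<Union>e\<in>graph_edges V E. ?f e)"
  proof clarify
    fix x y assume "E x y"
    then have "{x,y} \<in> graph_edges V E"
      using g unfolding graph_edges_def plumb_graph_def by blast
    then show "(x,y) \<in> (\<Union>e\<in>graph_edges V E. ?f e)" by blast
  qed
  then have "card {(x,y). E x y} \<le> card (\<Union>e\<in>graph_edges V E. ?f e)"
    by (rule card_mono[rotated]) (use fe finE in auto)
  also have "\<dots> \<le> (\<Sum>e\<in>graph_edges V E. card (?f e))" by (rule card_UN_le[OF finE])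
  also have "\<dots> \<le> (\<Sum>e\<in>graph_edges V E. 2)" by (rule sum_mono) (use fe in auto)
  finally show ?thesis by simp
qed

text \<open>A tree has only \<open>card V - 1\<close> edges, and each vertex outside
  \<open>U\<close> accounts for at least one edge that is not inside \<open>U\<close>. This is the
  forest bound for induced subgraphs.\<close>

lemma tree_pairs_card:
  assumes "is_tree V E" and "U \<subseteq> V" and "U \<noteq> {}"
  shows "card {(x,y). x \<in> U \<and> y \<in> U \<and> E x y} + 2 \<le> 2 * card U"
proof -
  have g: "plumb_graph V E" and c: "graph_connected V E"
    and e: "card (graph_edges V E) = card V - 1" and fin: "finite V"
    using assms(1) by (auto simp: is_tree_def plumb_graph_def)
  have "card V \<ge> 1" using assms fin by (metis One_nat_def Suc_leI card_gt_0_iff subset_empty)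
  moreover have "card (V - U) = card V - card U" "card U \<le> card V"
    using assms fin by (auto simp: card_Diff_subset finite_subset card_mono)
  moreover have "card U \<ge> 1"
    using assms fin by (metis One_nat_def Suc_leI card_gt_0_iff finite_subset)
  ultimately show ?thesis
    using connected_pairs_card[OF g c assms(2,3)] pairs_card_le[OF g] e by linarith
qed

text \<open>It suffices to know the adjacencies along the legs. The star is connected, hence has at
  least as many edges as the tree \<open>E\<close> on equally many vertices; the vertex bijection
  therefore carries its edges onto all edges of \<open>E\<close>, which settles the
  non-edges.\<close>

lemma iso_star_of_legs:
  fixes V :: "'v set"
  assumes tree: "is_tree V E"
    and dist: "distinct (c # L1 @ L2 @ L3)" and V: "set (c # L1 @ L2 @ L3) = V"
    and L: "successively E (c # L1)" "successively E (c # L2)" "successively E (c # L3)"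
  shows "iso_star V E d (d c) [map d L1, map d L2, map d L3]"
proof -
  let ?legs = "[map d L1, map d L2, map d L3]"
  let ?W = "star_V ?legs"
  have g: "plumb_graph V E" and e: "card (graph_edges V E) = card V - 1" and fin: "finite V"
    using tree by (auto simp: is_tree_def plumb_graph_def)
  define L where "L i = [L1, L2, L3] ! (i - 1)" for i :: nat
  define f where "f p = (if fst p = 0 then c else L (fst p) ! snd p)" for p :: "nat \<times> nat"
  have three: "i = 1 \<or> i = 2 \<or> i = 3" if "1 \<le> i" "i \<le> 3" for i :: nat using that by linarith
  have len: "length (?legs ! (i - 1)) = length (L i)" if "1 \<le> i" "i \<le> 3" for i
    using three[OF that] by (auto simp: L_def)
  have W: "?W = insert (0,0) {(i,j). 1 \<le> i \<and> i \<le> 3 \<and> j < length (L i)}"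
    unfolding star_V_def using len by auto
  have Wcases: "p = (0,0) \<or> (\<exists>i j. p = (i,j) \<and> (i = 1 \<or> i = 2 \<or> i = 3) \<and> j < length (L i))"
    if p: "p \<in> ?W" for p
  proof -
    obtain i j where [simp]: "p = (i,j)" by fastforce
    from p have "(i = 0 \<and> j = 0) \<or> (1 \<le> i \<and> i \<le> 3 \<and> j < length (L i))"
      unfolding W by simp
    then show ?thesis using three[of i] by auto
  qed
  have Lsimps: "L 1 = L1" "L (Suc 0) = L1" "L 2 = L2" "L 3 = L3" by (auto simp: L_def)
  have cL: "c \<notin> set (L i)" and distL: "distinct (L i)" if "i \<in> {1,2,3}" for i
    using that dist by (auto simp: L_def)
  have disjL: "set (L i) \<inter> set (L k) = {}" if "i \<in> {1,2,3}" "k \<in> {1,2,3}" "i \<noteq> k" for i k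
    using that dist by (auto simp: L_def)
  have inj: "inj_on f ?W"
  proof (rule inj_onI)
    fix p q assume pq: "p \<in> ?W" "q \<in> ?W" "f p = f q"
    show "p = q"
    proof (cases "p = (0,0) \<or> q = (0,0)")
      case True
      moreover have "f r \<noteq> c" if rW: "r \<in> ?W" and r0: "r \<noteq> (0,0)" for r
      proof -
        obtain i j where r: "r = (i,j)" "i \<in> {1,2,3}" "j < length (L i)"
          using Wcases[OF rW] r0 by blast
        then have "f r = L i ! j" by (auto simp: f_def)
        then show ?thesis using cL[OF r(2)] nth_mem[OF r(3)] by auto
      qed
      moreover have "f (0,0) = c" by (simp add: f_def)
      ultimately show ?thesis using pq by metis
    next
      case False
      then obtain i j k l where ij: "p = (i,j)" "i \<in> {1,2,3}" "j < length (L i)"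
        and kl: "q = (k,l)" "k \<in> {1,2,3}" "l < length (L k)"
        using Wcases[OF pq(1)] Wcases[OF pq(2)] by blast
      have eq: "L i ! j = L k ! l" using pq(3) ij kl by (auto simp: f_def)
      then have "L i ! j \<in> set (L i) \<inter> set (L k)" using ij kl nth_mem by (metis IntI)
      then have "i = k" using disjL ij(2) kl(2) by blast
      then show ?thesis using eq ij kl distL by (auto simp: nth_eq_iff_index_eq)
    qed
  qed
  have img: "f ` ?W = V"
  proof
    show "f ` ?W \<subseteq> V"
    proof
      fix x assume "x \<in> f ` ?W"
      then obtain p where p: "p \<in> ?W" "x = f p" by blast
      from Wcases[OF p(1)] p(2) show "x \<in> V" unfolding V[symmetric] f_def
        by (auto simp: Lsimps)
    qed
    show "V \<subseteq> f ` ?W"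
    proof
      fix x assume "x \<in> V"
      then have "x = c \<or> x \<in> set L1 \<or> x \<in> set L2 \<or> x \<in> set L3" using V by auto
      then have "x = f (0,0) \<or> (\<exists>j<length L1. x = f (1,j)) \<or> (\<exists>j<length L2. x = f (2,j))
          \<or> (\<exists>j<length L3. x = f (3,j))"
        by (auto simp: f_def Lsimps in_set_conv_nth)
      then show "x \<in> f ` ?W" unfolding W by (auto simp: Lsimps)
    qed
  qed
  have step: "successively E (c # xs) \<Longrightarrow> j < length xs \<Longrightarrow> E ((c # xs) ! j) (xs ! j)" for xs j
    by (auto simp: successively_conv_nth)
  have step': "E (xs ! j) (xs ! Suc j)" if "successively E (c # xs)" "Suc j < length xs" for xs j
    using step[OF that] by simp
  have step0: "E c (xs ! 0)" if "successively E (c # xs)" "0 < length xs" for xs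
    using step[OF that] by simp
  have Ls: "successively E (c # L i)" if "1 \<le> i" "i \<le> 3" for i
    using three[OF that] L by (auto simp: Lsimps)
  have sym: "E y x" if "E x y" for x y using g that by (auto simp: plumb_graph_def)
  have e0: "E c (L i ! 0)" if "1 \<le> i" "i \<le> 3" "0 < length (L i)" for i
    using step0[OF Ls] that by blast
  have e1: "E (L i ! j) (L i ! Suc j)" if "1 \<le> i" "i \<le> 3" "Suc j < length (L i)" for i j
    using step'[OF Ls] that by blast
  have hom: "E (f a) (f b)" if "star_E ?legs a b" for a b
  proof -
    have ab: "a \<in> ?W" "b \<in> ?W" using that by (auto simp: star_E_def)
    obtain i j k l where [simp]: "a = (i,j)" "b = (k,l)" by fastforce
    from that have "(i = 0 \<and> j = 0 \<and> 1 \<le> k \<and> l = 0) \<or> (k = 0 \<and> l = 0 \<and> 1 \<le> i \<and> j = 0)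
        \<or> (1 \<le> i \<and> i = k \<and> (l = Suc j \<or> j = Suc l))" by (auto simp: star_E_def)
    then show ?thesis
    proof (elim disjE conjE)
      assume "i = 0" "j = 0" "1 \<le> k" "l = 0"
      then show ?thesis using ab(2) e0[of k] by (simp add: W f_def)
    next
      assume "k = 0" "l = 0" "1 \<le> i" "j = 0"
      then show ?thesis using ab(1) e0[of i, THEN sym] by (simp add: W f_def)
    next
      assume "1 \<le> i" "i = k" "l = Suc j"
      then show ?thesis using ab(2) e1[of i j] by (simp add: W f_def)
    next
      assume "1 \<le> i" "i = k" "j = Suc l"
      then show ?thesis using ab(1) e1[of i l, THEN sym] by (simp add: W f_def)
    qed
  qed
  have sg: "plumb_graph ?W (star_E ?legs)"
  proof -
    have "finite ?W" using inj img fin by (metis finite_imageD)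
    then show ?thesis unfolding plumb_graph_def by (auto simp: star_E_def)
  qed
  have conn0: "(star_E ?legs)\<^sup>*\<^sup>* (0,0) (i,j)" if "1 \<le> i" "i \<le> 3" "j < length (L i)" for i j
    using that(3)
  proof (induction j)
    case 0
    then have "star_E ?legs (0,0) (i,0)" unfolding star_E_def W using that by auto
    then show ?case by blast
  next
    case (Suc j)
    then have "star_E ?legs (i,j) (i,Suc j)" unfolding star_E_def W using that by auto
    moreover have "(star_E ?legs)\<^sup>*\<^sup>* (0,0) (i,j)" using Suc by simp
    ultimately show ?case by (rule rtranclp.rtrancl_into_rtrancl[rotated])
  qed
  have conn1: "(star_E ?legs)\<^sup>*\<^sup>* (0,0) p" if "p \<in> ?W" for p
    using that conn0 unfolding W by auto
  have symp: "symp (star_E ?legs)" using sg by (auto simp: plumb_graph_def symp_def)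
  have sc: "graph_connected ?W (star_E ?legs)"
    unfolding graph_connected_def
    using conn1 symp by (meson rtranclp_trans symp_rtranclp sympD)
  let ?P = "{(a,b). star_E ?legs a b}" and ?Q = "{(x,y). E x y}"
  have cW: "card ?W = card V" using card_image[OF inj] img by simp
  have z: "(0,0) \<in> ?W" by (simp add: W)
  have finW: "finite ?W" using sg by (simp add: plumb_graph_def)
  have "card (?W - {(0,0)}) = card V - 1" using z finW cW by simp
  then have "2 * (card V - 1) \<le> card ?P"
    using connected_pairs_card[OF sg sc, of "{(0,0)}"] z by auto
  then have PQ: "card ?Q \<le> card ?P" using pairs_card_le[OF g] e by simp
  have injP: "inj_on (map_prod f f) ?P"
    by (rule inj_on_subset[OF map_prod_inj_on[OF inj inj]]) (auto simp: star_E_def)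
  have finQ: "finite ?Q"
    by (rule finite_subset[of _ "V \<times> V"]) (use g fin in \<open>auto simp: plumb_graph_def\<close>)
  \<comment> \<open>An injection into a finite set that is no larger is onto.\<close>
  have "map_prod f f ` ?P = ?Q"
    by (rule card_seteq[OF finQ]) (use hom PQ in \<open>auto simp: card_image[OF injP]\<close>)
  then have hom': "star_E ?legs a b" if "E (f a) (f b)" "a \<in> ?W" "b \<in> ?W" for a b
  proof -
    have "(f a, f b) \<in> map_prod f f ` ?P" using \<open>map_prod f f ` ?P = ?Q\<close> that(1) by simp
    then obtain a' b' where ab: "star_E ?legs a' b'" "f a = f a'" "f b = f b'" by auto
    then have "a' \<in> ?W" "b' \<in> ?W" by (auto simp: star_E_def)
    then show ?thesis using ab that inj by (metis inj_onD)
  qed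
  have dd: "star_d (d c) ?legs p = d (f p)" if "p \<in> ?W" for p
    using Wcases[OF that] by (auto simp: star_d_def f_def Lsimps)
  let ?g = "inv_into ?W f"
  have bij: "bij_betw f ?W V" using inj img by (simp add: bij_betw_def)
  have gW: "?g x \<in> ?W" "f (?g x) = x" if "x \<in> V" for x
    using that img by (auto intro: inv_into_into f_inv_into_f)
  show ?thesis unfolding iso_star_def plumb_iso_def
  proof (intro exI[of _ ?g] conjI ballI)
    show "bij_betw ?g V ?W" using bij by (rule bij_betw_inv_into)
    fix x assume x: "x \<in> V"
    show "star_d (d c) ?legs (?g x) = d x" using dd gW x by simp
    fix y assume y: "y \<in> V"
    show "star_E ?legs (?g x) (?g y) = E x y"
      using hom[of "?g x" "?g y"] hom'[of "?g x" "?g y"] gW x y by auto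
  qed
qed

section \<open>From the coefficients of an embedding to a digraph on the vertices\<close>

section \<open>The digraph of an embedding\<close>

text \<open>Each index is named after the one vertex with coefficient 1 there; \<open>R u z\<close>
  means that \<open>u\<close> has coefficient -1 at the index of \<open>z\<close>, and
  \<open>h\<close> names the index of type (9). \<open>adj\<close> and \<open>dec\<close> are the
  values of \<open>Qn\<close>, the former with its terms moved so that no subtraction occurs;
  \<open>out\<close> is minimality, and \<open>key\<close> is the consequence of adjunction for sums
  of vertices.\<close>

locale arc_digraph =
  fixes V :: "'v set" and E :: "'v \<Rightarrow> 'v \<Rightarrow> bool" and d :: "'v \<Rightarrow> int"
    and R :: "'v \<Rightarrow> 'v \<Rightarrow> bool" and h :: 'v
  assumes tree: "is_tree V E"
    and R_V: "R u v \<Longrightarrow> u \<in> V \<and> v \<in> V"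
    and irr: "\<not> R u u"
    and out: "u \<in> V \<Longrightarrow> \<exists>v. R u v"
    and hV: "h \<in> V" and h3: "card {u. R u h} = 3"
    and deg_in: "z \<in> V \<Longrightarrow> z \<noteq> h \<Longrightarrow> card {u. R u z} = 1 \<or> card {u. R u z} = 2"
    and adj: "u \<in> V \<Longrightarrow> v \<in> V \<Longrightarrow> u \<noteq> v \<Longrightarrow>
      of_bool (E u v) + card {z. R u z \<and> R v z} = (of_bool (R u v) + of_bool (R v u) :: nat)"
    and dec: "v \<in> V \<Longrightarrow> d v = - 1 - int (card {z. R v z})"
    and key: "U \<subseteq> V \<Longrightarrow> U \<noteq> {} \<Longrightarrow> \<exists>z\<in>V. (z \<in> U \<and> (\<forall>u\<in>U. \<not> R u z)) \<or>
      (z \<in> U \<and> card {u\<in>U. R u z} \<ge> 3) \<or> (z \<notin> U \<and> card {u\<in>U. R u z} \<ge> 2)"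

lemma count_index_coeffs:
  assumes "finite V" "x \<noteq> 0"
  shows "count (index_coeffs V \<phi> i) x = card {v \<in> V. \<phi> v i = x}"
proof -
  have "count (index_coeffs V \<phi> i) x = (\<Sum>v | v \<in> V \<and> x = \<phi> v i. 1)"
    using assms by (simp add: index_coeffs_def count_image_mset')
  also have "{v. v \<in> V \<and> x = \<phi> v i} = {v \<in> V. \<phi> v i = x}" by auto
  finally show ?thesis by simp
qed

lemma sum_of_bool_eq_card:
  "finite A \<Longrightarrow> (\<Sum>x\<in>A. of_bool (P x)) = (of_nat (card {x \<in> A. P x}) :: 'a :: semiring_1)"
  by (simp add: sum.If_cases of_bool_def Int_def)

text \<open>The types allow only the coefficients 0, 1 and -1 and put exactly one 1 in every column;
  adjunction puts exactly one 1 in every row. So the positions of the 1s match vertices with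
  indices, and the positions of the -1s become arcs.\<close>

lemma ex_arc_digraph:
  assumes S: "in_S V E d"
    and emb: "symplectic_embedding V E d \<phi>"
    and nine: "\<exists>!i. i < card V \<and> index_type9 V \<phi> i"
    and others: "\<forall>i < card V. \<not> index_type9 V \<phi> i \<longrightarrow>
                   index_type4 V \<phi> i \<or> index_type7 V \<phi> i"
  shows "\<exists>R h. arc_digraph V E d R h"
proof -
  define n where "n = card V"
  have tree: "is_tree V E" and mini: "\<And>v. v \<in> V \<Longrightarrow> d v \<noteq> -1"
    using S by (auto simp: in_S_def minimal_plumbing_def)
  have fin: "finite V" and Eirr: "\<And>v. \<not> E v v" using tree by (auto simp: is_tree_def plumb_graph_def)
  note emb' = emb[unfolded symplectic_embedding_def Let_def, folded n_def]
  have Q1: "Qn n (\<phi> v1) (\<phi> v2) = (if E v1 v2 then 1 else 0)"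
    if "v1 \<in> V" "v2 \<in> V" "v1 \<noteq> v2" for v1 v2
    using emb'[THEN conjunct2, THEN conjunct1] that by simp
  have Q2: "Qn n (\<phi> v) (\<phi> v) = d v" if "v \<in> V" for v
    using emb'[THEN conjunct2, THEN conjunct2, THEN conjunct1] that by simp
  have Q3: "Qn n (\<phi> v) (Kn n) + Qn n (\<phi> v) (\<phi> v) = -2" if "v \<in> V" for v
    using emb'[THEN conjunct2, THEN conjunct2, THEN conjunct2] that by simp
  obtain i9 where i9: "i9 < n" "index_type9 V \<phi> i9" "\<And>i. i < n \<Longrightarrow> index_type9 V \<phi> i \<Longrightarrow> i = i9"
    using nine unfolding n_def by blast
  have types: "index_coeffs V \<phi> i = {#1,-1#} \<or> index_coeffs V \<phi> i = {#1,-1,-1#}"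
    if "i < n" "i \<noteq> i9" for i
    using others i9(3)[OF that(1)] that unfolding n_def index_type4_def index_type7_def by blast
  have type9: "index_coeffs V \<phi> i9 = {#1,-1,-1,-1#}" using i9(2) by (simp add: index_type9_def)
  have alltypes: "index_coeffs V \<phi> i \<in> {{#1,-1#}, {#1,-1,-1#}, {#1,-1,-1,-1#}}" if "i < n" for i
    using types[OF that] type9 by (cases "i = i9") blast+
  note cnt = count_index_coeffs[OF fin, symmetric]
  have one: "card {v \<in> V. \<phi> v i = 1} = 1" if "i < n" for i
    using alltypes[OF that] by (auto simp: cnt)
  have neg9: "card {v \<in> V. \<phi> v i9 = -1} = 3"
    using type9 by (auto simp: cnt)
  have neg: "card {v \<in> V. \<phi> v i = -1} = 1 \<or> card {v \<in> V. \<phi> v i = -1} = 2"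
    if "i < n" "i \<noteq> i9" for i
    using types[OF that] by (auto simp: cnt)
  have val: "\<phi> v i = 0 \<or> \<phi> v i = 1 \<or> \<phi> v i = -1" if "i < n" "v \<in> V" for i v
  proof (rule ccontr)
    assume a: "\<not> ?thesis"
    have "card {w \<in> V. \<phi> w i = \<phi> v i} = 0"
      using alltypes[OF that(1)] a by (auto simp: cnt)
    then show False using that fin by auto
  qed
  have adjn: "(\<Sum>i<n. \<phi> v i * \<phi> v i) + (\<Sum>i<n. \<phi> v i) = 2" if "v \<in> V" for v
  proof -
    have "Qn n (\<phi> v) (Kn n) = - (\<Sum>i<n. \<phi> v i)"
      unfolding Qn_def Kn_def by simp
    then show ?thesis using Q3[OF that] by (simp add: Qn_def)
  qed
  \<comment> \<open>\<open>x * x + x\<close> is 2 for \<open>x = 1\<close> and 0 for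
    \<open>x = 0\<close> or \<open>x = -1\<close>, so adjunction counts the coefficients equal to
    1.\<close>
  have row: "card {i \<in> {..<n}. \<phi> v i = 1} = 1" if "v \<in> V" for v
  proof -
    have "2 = (\<Sum>i<n. \<phi> v i * \<phi> v i + \<phi> v i)" using adjn[OF that] by (simp add: sum.distrib)
    also have "\<dots> = (\<Sum>i<n. 2 * of_bool (\<phi> v i = 1))"
      by (rule sum.cong) (use val[OF _ that] in force)+
    also have "\<dots> = 2 * int (card {i \<in> {..<n}. \<phi> v i = 1})"
      by (simp add: sum_distrib_left[symmetric] sum_of_bool_eq_card del: sum_of_bool_eq)
    finally show ?thesis by simp
  qed
  have "\<exists>i. \<forall>j. j < n \<and> \<phi> v j = 1 \<longleftrightarrow> j = i" if vV: "v \<in> V" for v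
  proof -
    obtain i where "{i \<in> {..<n}. \<phi> v i = 1} = {i}" using row[OF vV] by (auto simp: card_1_singleton_iff)
    then have "\<forall>j. j < n \<and> \<phi> v j = 1 \<longleftrightarrow> j = i" by (auto simp: set_eq_iff)
    then show ?thesis by blast
  qed
  then obtain idx where idx: "\<And>v j. v \<in> V \<Longrightarrow> j < n \<and> \<phi> v j = 1 \<longleftrightarrow> j = idx v"
    by metis
  have idxn: "idx v < n" and idx1: "\<phi> v (idx v) = 1" if "v \<in> V" for v using idx[OF that] by blast+
  have col: "\<phi> u (idx v) = 1 \<longleftrightarrow> u = v" if uV: "u \<in> V" and vV: "v \<in> V" for u v
  proof
    assume a: "\<phi> u (idx v) = 1"
    obtain w where "{x \<in> V. \<phi> x (idx v) = 1} = {w}"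
      using one[OF idxn[OF vV]] by (auto simp: card_1_singleton_iff)
    then show "u = v" using a idx1[OF vV] uV vV by (metis (mono_tags, lifting) mem_Collect_eq singletonD)
  qed (use idx1 uV vV in simp)
  have injidx: "inj_on idx V" by (rule inj_onI) (metis col idx1)
  \<comment> \<open>Injectivity comes from \<open>col\<close>; surjectivity, because there are as
    many indices as vertices.\<close>
  have bij: "bij_betw idx V {..<n}"
    by (rule bij_betw_imageI[OF injidx], rule card_seteq)
       (use idxn injidx in \<open>auto simp: card_image n_def\<close>)
  have re: "(\<Sum>i<n. g i) = (\<Sum>z\<in>V. g (idx z))" for g :: "nat \<Rightarrow> int"
    using sum.reindex_bij_betw[OF bij, of g] by simp
  define R where "R u z \<longleftrightarrow> u \<in> V \<and> z \<in> V \<and> \<phi> u (idx z) = -1" for u z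
  have psi: "\<phi> u (idx z) = of_bool (u = z) - of_bool (R u z)" if "u \<in> V" "z \<in> V" for u z
    using val[OF idxn[OF that(2)] that(1)] col[OF that] that by (auto simp: R_def)
  have inR: "{u. R u z} = {u \<in> V. \<phi> u (idx z) = -1}" if "z \<in> V" for z
    using that by (auto simp: R_def)
  have RV: "R u z \<Longrightarrow> u \<in> V \<and> z \<in> V" for u z by (simp add: R_def)
  have Rirr: "\<not> R u u" for u using idx1 by (auto simp: R_def)
  obtain h where h: "h \<in> V" "idx h = i9" using bij i9(1) unfolding bij_betw_def by (metis imageE lessThan_iff)
  have dec: "d v = - 1 - int (card {z. R v z})" if v: "v \<in> V" for v
  proof -
    have "- d v = (\<Sum>z\<in>V. \<phi> v (idx z) * \<phi> v (idx z))" using Q2[OF v] re[of "\<lambda>i. \<phi> v i * \<phi> v i"]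
      by (simp add: Qn_def)
    also have "\<dots> = (\<Sum>z\<in>V. of_bool (z = v) + of_bool (R v z))"
      by (rule sum.cong[OF HOL.refl]) (use psi[OF v] Rirr in auto)
    also have "\<dots> = 1 + int (card {z \<in> V. R v z})"
      using v fin by (simp add: sum.distrib sum_of_bool_eq_card del: sum_of_bool_eq)
         (simp add: Collect_conv_if Int_def conj_commute cong: conj_cong)
    also have "{z \<in> V. R v z} = {z. R v z}" using RV by auto
    finally show ?thesis by simp
  qed
  have adj: "of_bool (E u v) + card {z. R u z \<and> R v z} = (of_bool (R u v) + of_bool (R v u) :: nat)"
    if u: "u \<in> V" and v: "v \<in> V" and uv: "u \<noteq> v" for u v
  proof -
    have "- of_bool (E u v) = (\<Sum>z\<in>V. \<phi> u (idx z) * \<phi> v (idx z))"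
      using Q1[OF u v uv] re[of "\<lambda>i. \<phi> u i * \<phi> v i"] by (auto simp: Qn_def split: if_splits)
    also have "\<dots> = (\<Sum>z\<in>V. of_bool (R u z \<and> R v z) - of_bool (z = v \<and> R u z) - of_bool (z = u \<and> R v z))"
      by (rule sum.cong[OF HOL.refl]) (use psi[OF v] psi[OF u] Rirr uv in auto)
    also have "\<dots> = int (card {z \<in> V. R u z \<and> R v z}) - int (card {z \<in> V. z = v \<and> R u z})
        - int (card {z \<in> V. z = u \<and> R v z})"
      using fin by (simp add: sum_subtractf sum_of_bool_eq_card del: sum_of_bool_eq)
    also have "{z \<in> V. R u z \<and> R v z} = {z. R u z \<and> R v z}" using RV by auto
    also have "{z \<in> V. z = v \<and> R u z} = (if R u v then {v} else {})" using v by auto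
    also have "{z \<in> V. z = u \<and> R v z} = (if R v u then {u} else {})" using u by auto
    finally show ?thesis by (auto split: if_splits)
  qed
  \<comment> \<open>If all three alternatives fail, the sum \<open>X\<close> of the vertices in
    \<open>U\<close> has only the coefficients 0 and -1: inside \<open>U\<close> one gets 1 minus 1
    or 2, outside minus 0 or 1. Then the sum of \<open>X i * (X i + 1)\<close> vanishes, while
    expanding it over pairs of vertices gives \<open>2 * card U\<close> minus the number of adjacent
    ordered pairs in \<open>U\<close>, which is at least 2 by the forest bound.\<close>
  have key: "\<exists>z\<in>V. (z \<in> U \<and> (\<forall>u\<in>U. \<not> R u z)) \<or>
      (z \<in> U \<and> card {u\<in>U. R u z} \<ge> 3) \<or> (z \<notin> U \<and> card {u\<in>U. R u z} \<ge> 2)"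
    if U: "U \<subseteq> V" "U \<noteq> {}" for U
  proof (rule ccontr)
    assume none: "\<not> ?thesis"
    have finU: "finite U" using U fin finite_subset by blast
    define X where "X i = (\<Sum>u\<in>U. \<phi> u i)" for i
    have Xz: "X (idx z) * (X (idx z) + 1) = 0" if z: "z \<in> V" for z
    proof -
      have "X (idx z) = (\<Sum>u\<in>U. of_bool (u = z) - of_bool (R u z))"
        unfolding X_def by (rule sum.cong[OF HOL.refl]) (use psi[OF _ z] U in auto)
      also have "\<dots> = int (card {u \<in> U. u = z}) - int (card {u \<in> U. R u z})"
        using finU by (simp add: sum_subtractf sum_of_bool_eq_card del: sum_of_bool_eq)
      also have "{u \<in> U. u = z} = (if z \<in> U then {z} else {})" by auto
      finally have X: "X (idx z) = of_bool (z \<in> U) - int (card {u \<in> U. R u z})" by auto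
      show ?thesis
      proof (cases "z \<in> U")
        case True
        then have "{u \<in> U. R u z} \<noteq> {}" "\<not> 3 \<le> card {u \<in> U. R u z}" using none z by blast+
        moreover have "card {u \<in> U. R u z} \<noteq> 0" using calculation(1) finU by simp
        ultimately have "card {u \<in> U. R u z} = 1 \<or> card {u \<in> U. R u z} = 2" by linarith
        then show ?thesis using X True by auto
      next
        case False
        then have "\<not> 2 \<le> card {u \<in> U. R u z}" using none z by blast
        then have "card {u \<in> U. R u z} = 0 \<or> card {u \<in> U. R u z} = 1" by linarith
        then show ?thesis using X False by auto
      qed
    qed
    \<comment> \<open>The diagonal term and the linear term of \<open>u\<close> add up to 2 by
      adjunction; the other terms count the neighbours of \<open>u\<close> in
      \<open>U\<close>.\<close>
    have EU: "(\<Sum>v\<in>U. - Qn n (\<phi> u) (\<phi> v)) + (\<Sum>i<n. \<phi> u i) = 2 - int (card {v \<in> U. E u v})"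
      if u: "u \<in> U" for u
    proof -
      have uV: "u \<in> V" using u U by blast
      have "(\<Sum>v\<in>U. - Qn n (\<phi> u) (\<phi> v)) = - Qn n (\<phi> u) (\<phi> u) + (\<Sum>v\<in>U - {u}. - Qn n (\<phi> u) (\<phi> v))"
        using finU u by (simp add: sum.remove)
      also have "(\<Sum>v\<in>U - {u}. - Qn n (\<phi> u) (\<phi> v)) = - (\<Sum>v\<in>U - {u}. of_bool (E u v))"
        unfolding sum_negf[symmetric] by (rule sum.cong[OF HOL.refl]) (use Q1[OF uV] U in auto)
      also have "(\<Sum>v\<in>U - {u}. of_bool (E u v) :: int) = int (card {v \<in> U - {u}. E u v})"
        using finU by (simp add: sum_of_bool_eq_card del: sum_of_bool_eq)
      also have "{v \<in> U - {u}. E u v} = {v \<in> U. E u v}" using Eirr by auto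
      finally show ?thesis using adjn[OF uV] by (simp add: Qn_def)
    qed
    have "0 = (\<Sum>z\<in>V. X (idx z) * (X (idx z) + 1))" by (rule sum.neutral[symmetric]) (use Xz in blast)
    also have "\<dots> = (\<Sum>i<n. X i * (X i + 1))" using re[of "\<lambda>i. X i * (X i + 1)"] by simp
    also have "\<dots> = (\<Sum>i<n. X i * X i) + (\<Sum>i<n. X i)" by (simp add: algebra_simps sum.distrib)
    also have "(\<Sum>i<n. X i * X i) = (\<Sum>i<n. \<Sum>u\<in>U. \<Sum>v\<in>U. \<phi> u i * \<phi> v i)"
      by (simp add: X_def sum_product)
    also have "\<dots> = (\<Sum>u\<in>U. \<Sum>v\<in>U. \<Sum>i<n. \<phi> u i * \<phi> v i)"
      by (subst sum.swap, rule sum.cong[OF HOL.refl], rule sum.swap)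
    also have "(\<Sum>i<n. X i) = (\<Sum>u\<in>U. \<Sum>i<n. \<phi> u i)" unfolding X_def by (rule sum.swap)
    also have "(\<Sum>u\<in>U. \<Sum>v\<in>U. \<Sum>i<n. \<phi> u i * \<phi> v i) + (\<Sum>u\<in>U. \<Sum>i<n. \<phi> u i)
        = (\<Sum>u\<in>U. 2 - int (card {v \<in> U. E u v}))"
      unfolding sum.distrib[symmetric] by (rule sum.cong[OF HOL.refl]) (use EU in \<open>simp add: Qn_def\<close>)
    also have "\<dots> = 2 * int (card U) - (\<Sum>u\<in>U. int (card {v \<in> U. E u v}))"
      by (simp add: sum_subtractf)
    also have "(\<Sum>u\<in>U. int (card {v \<in> U. E u v})) = int (card (SIGMA u:U. {v \<in> U. E u v}))"
      using finU by (simp add: card_SigmaI)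
    also have "(SIGMA u:U. {v \<in> U. E u v}) = {(x,y). x \<in> U \<and> y \<in> U \<and> E x y}" by auto
    finally show False using tree_pairs_card[OF tree U] by linarith
  qed
  have "arc_digraph V E d R h"
  proof
    show "is_tree V E" by (rule tree)
    show "R u v \<Longrightarrow> u \<in> V \<and> v \<in> V" for u v by (rule RV)
    show "\<not> R u u" for u by (rule Rirr)
    \<comment> \<open>A vertex without out-neighbours would have decoration -1.\<close>
    show "\<exists>v. R u v" if "u \<in> V" for u
      using mini[OF that] dec[OF that] by (metis Collect_empty_eq card.empty diff_zero of_nat_0)
    show "h \<in> V" by (rule h(1))
    show "card {u. R u h} = 3" using inR[OF h(1)] h(2) neg9 by simp
    show "card {u. R u z} = 1 \<or> card {u. R u z} = 2" if "z \<in> V" "z \<noteq> h" for z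
      using inR[OF that(1)] neg[OF idxn[OF that(1)]] that h injidx by (auto simp: inj_on_def)
  qed (use adj dec key in blast)+
  then show ?thesis by blast
qed

section \<open>Local rules for arcs, the in-neighbours of the hub, and what descends from it\<close>

section \<open>Descent from the hub\<close>

context arc_digraph
begin

lemma finV: "finite V" and E_sym: "E u v \<Longrightarrow> E v u"
  using tree by (auto simp: is_tree_def plumb_graph_def)

lemma fin_in: "finite {u. R u z}"
  and fin_common: "finite {z. R u z \<and> R v z}"
  using R_V finV by (auto intro: finite_subset[of _ V])

lemma common_card: "u \<noteq> v \<Longrightarrow> u \<in> V \<Longrightarrow> v \<in> V \<Longrightarrow>
    card {z. R u z \<and> R v z} \<le> of_bool (R u v) + of_bool (R v u)"
  using adj[of u v] by linarith

text \<open>The edge term in \<open>adj\<close> is nonnegative, so common out-neighbours are bounded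
  by arcs: one of them requires an arc, two require arcs in both directions (\<open>share2\<close>),
  and three cannot occur (\<open>share3\<close>).\<close>

lemma share:
  assumes "R x z" "R y z" "x \<noteq> y"
  shows "R x y \<or> R y x"
proof (rule ccontr)
  assume "\<not> ?thesis"
  then have "card {z. R x z \<and> R y z} = 0" using common_card[of x y] assms R_V by auto
  then have "{z. R x z \<and> R y z} = {}" using fin_common by simp
  then show False using assms by blast
qed

lemma share2:
  assumes "R x z" "R y z" "R x w" "R y w" "z \<noteq> w" "x \<noteq> y"
  shows "R x y \<and> R y x"
proof (rule ccontr)
  assume "\<not> ?thesis"
  then have "of_bool (R x y) + of_bool (R y x) \<le> (1::nat)" by auto
  then have "card {z. R x z \<and> R y z} \<le> 1"
    using common_card[OF assms(6)] assms(1,2) R_V by (meson order_trans)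
  moreover have "card {z, w} \<le> card {z. R x z \<and> R y z}"
    by (rule card_mono[OF fin_common]) (use assms in auto)
  ultimately show False using assms(5) by simp
qed

lemma share3:
  assumes "R x z" "R y z" "R x w" "R y w" "R x t" "R y t" "z \<noteq> w" "x \<noteq> y"
  shows "t = z \<or> t = w"
proof (rule ccontr)
  assume t: "\<not> ?thesis"
  have "of_bool (R x y) + of_bool (R y x) \<le> (2::nat)" by (cases "R x y"; cases "R y x") auto
  then have "card {z. R x z \<and> R y z} \<le> 2"
    using common_card[OF assms(8)] assms(1,2) R_V by (meson order_trans)
  moreover have "card {z, w, t} \<le> card {z. R x z \<and> R y z}"
    by (rule card_mono[OF fin_common]) (use assms in auto)
  moreover have "card {z, w, t} = 3" using assms(7) t by auto
  ultimately show False by linarith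
qed

lemma in_two:
  assumes "z \<noteq> h" "R x z" "R y z" "x \<noteq> y" "R u z"
  shows "u = x \<or> u = y"
proof (rule ccontr)
  assume t: "\<not> ?thesis"
  have "card {x, y, u} \<le> card {u. R u z}" by (rule card_mono[OF fin_in]) (use assms in auto)
  moreover have "card {x, y, u} = 3" using assms(4) t by auto
  moreover have "z \<in> V" using assms(2) R_V by blast
  ultimately show False using deg_in[of z] assms(1) by linarith
qed

lemma E_I1:
  assumes "R u v" "\<And>z. R u z \<Longrightarrow> R v z \<Longrightarrow> False"
  shows "E u v"
proof -
  have "{z. R u z \<and> R v z} = {}" using assms by blast
  then have "card {z. R u z \<and> R v z} = 0" by (simp only: card.empty)
  moreover have "u \<noteq> v" "u \<in> V" "v \<in> V" using assms(1) irr R_V by blast+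
  ultimately show ?thesis using adj[of u v] assms(1) by (cases "E u v") auto
qed

text \<open>With arcs both ways, the edge indicator and the number of common out-neighbours add up
  to 2, so a single common out-neighbour leaves room for the edge.\<close>

lemma E_I2:
  assumes "R u v" "R v u" "\<And>z. R u z \<Longrightarrow> R v z \<Longrightarrow> z = w"
  shows "E u v"
proof -
  have "{z. R u z \<and> R v z} \<subseteq> {w}" using assms by blast
  then have "card {z. R u z \<and> R v z} \<le> 1" using card_mono[of "{w}" "{z. R u z \<and> R v z}"] by simp
  moreover have "u \<noteq> v" "u \<in> V" "v \<in> V" using assms irr R_V by blast+
  ultimately show ?thesis using adj[of u v] assms(1,2) by (cases "E u v") auto
qed

text \<open>The three in-neighbours share \<open>h\<close>, so any two are joined by an arc, and a
  further common out-neighbour doubles that arc. This rules out, for instance, the transitive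
  triangle, where two vertices point to the third but are joined only one way; up to relabelling
  three patterns survive.\<close>

lemma hub_cases:
  obtains (cyc) a0 a1 a2 where "distinct [a0,a1,a2]" "{u. R u h} = {a0,a1,a2}"
      "R a0 a1" "R a1 a2" "R a2 a0" "\<not> R a1 a0" "\<not> R a2 a1" "\<not> R a0 a2"
    | (dbl) a0 a1 a2 where "distinct [a0,a1,a2]" "{u. R u h} = {a0,a1,a2}"
      "R a0 a1" "R a1 a0" "R a0 a2" "R a1 a2" "\<not> R a2 a0" "\<not> R a2 a1"
    | (full) a0 a1 a2 where "distinct [a0,a1,a2]" "{u. R u h} = {a0,a1,a2}"
      "R a0 a1" "R a1 a0" "R a0 a2" "R a2 a0" "R a1 a2" "R a2 a1"
proof -
  obtain x y z where A: "{u. R u h} = {x,y,z}" and d: "distinct [x,y,z]"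
    using h3 by (auto simp: card_3_iff)
  have dd: "x \<noteq> y" "x \<noteq> z" "y \<noteq> z" using d by auto
  have hx: "R x h" "R y h" "R z h" using A by auto
  have nh: "x \<noteq> h" "y \<noteq> h" "z \<noteq> h" using hx irr by blast+
  have xy: "R x y \<or> R y x" and xz: "R x z \<or> R z x" and yz: "R y z \<or> R z y"
    using share[OF hx(1,2)] share[OF hx(1,3)] share[OF hx(2,3)] dd by blast+
  note s = share2[OF hx(1) hx(2) _ _ nh(3)[symmetric] dd(1)]
           share2[OF hx(1) hx(3) _ _ nh(2)[symmetric] dd(2)]
           share2[OF hx(2) hx(3) _ _ nh(1)[symmetric] dd(3)]
  have A': "{u. R u h} = {x,z,y}" "{u. R u h} = {y,z,x}" using A by auto
  consider "R x y \<and> R y x \<and> R x z \<and> R z x \<and> R y z \<and> R z y"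
    | "R x y \<and> R y x \<and> R x z \<and> R y z \<and> \<not> R z x \<and> \<not> R z y"
    | "R x z \<and> R z x \<and> R x y \<and> R z y \<and> \<not> R y x \<and> \<not> R y z"
    | "R y z \<and> R z y \<and> R y x \<and> R z x \<and> \<not> R x y \<and> \<not> R x z"
    | "R x y \<and> R y z \<and> R z x \<and> \<not> R y x \<and> \<not> R z y \<and> \<not> R x z"
    | "R x z \<and> R z y \<and> R y x \<and> \<not> R z x \<and> \<not> R y z \<and> \<not> R x y"
    using xy xz yz s by argo
  then show thesis
  proof cases
    case 1 then show ?thesis using full[OF d A] by blast
  next
    case 2 then show ?thesis using dbl[OF d A] by blast
  next
    case 3 then show ?thesis using dbl[of x z y] A' dd by auto
  next
    case 4 then show ?thesis using dbl[of y z x] A' dd by auto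
  next
    case 5 then show ?thesis using cyc[OF d A] by blast
  next
    case 6 then show ?thesis using cyc[of x z y] A' dd by auto
  qed
qed

end

text \<open>The two properties of \<open>A\<close> that the descent uses. They are proved separately
  for each pattern of \<open>hub_cases\<close>, so that the descent is developed only once.\<close>

locale hub_digraph = arc_digraph V E d R h
  for V :: "'v set" and E d R h +
  fixes A :: "'v set"
  assumes A_eq: "A = {u. R u h}"
    and one_outside: "a \<in> A \<Longrightarrow> R x a \<Longrightarrow> R y a \<Longrightarrow> x \<notin> A \<Longrightarrow> y \<notin> A \<Longrightarrow> x = y"
    and common_A: "a \<in> A \<Longrightarrow> b \<in> A \<Longrightarrow> a \<noteq> b \<Longrightarrow> R a z \<Longrightarrow> R b z \<Longrightarrow> z = h \<or> z \<in> A"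
begin

definition "outer = {(u,v). R u v \<and> u \<notin> A \<and> v \<notin> A}"

lemma hA: "h \<notin> A" and AV: "A \<subseteq> V" and cardA: "card A = 3" and finA: "finite A"
  using irr h3 R_V fin_in by (auto simp: A_eq)

lemma in_h: "R u h \<longleftrightarrow> u \<in> A" by (simp add: A_eq)

lemma two_in:
  assumes "card {u\<in>U. R u z} \<ge> 2"
  obtains x y where "x \<in> U" "y \<in> U" "x \<noteq> y" "R x z" "R y z"
proof -
  obtain B where "B \<subseteq> {u\<in>U. R u z}" "card B = 2" using assms by (meson obtain_subset_with_card_n)
  then show ?thesis using that by (auto simp: card_2_iff)
qed

lemma not_three:
  assumes "z \<noteq> h" "z \<in> V" shows "\<not> card {u\<in>U. R u z} \<ge> 3"
proof -
  have "card {u\<in>U. R u z} \<le> card {u. R u z}" by (rule card_mono[OF fin_in]) auto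
  then show ?thesis using deg_in[OF assms(2,1)] by linarith
qed

text \<open>Otherwise some nonempty set outside \<open>A\<close> gives each of its members an
  in-neighbour inside the set; let \<open>U\<close> be the union of all such sets, again one of
  them. Of the alternatives in \<open>key\<close>, a member with three in-neighbours would be
  \<open>h\<close>, whose in-neighbours lie in \<open>A\<close>. A vertex outside \<open>U\<close>
  with two contradicts \<open>one_outside\<close> if it lies in \<open>A\<close>, and the maximality
  of \<open>U\<close> if not.\<close>

lemma wf_outer: "wf outer"
proof (rule ccontr)
  assume "\<not> wf outer"
  then obtain Q where "\<exists>q. q \<in> Q" "\<And>z. z \<in> Q \<Longrightarrow> \<exists>y. (y,z) \<in> outer \<and> y \<in> Q"
    unfolding wf_eq_minimal by metis
  then have Q: "Q \<noteq> {}" "\<And>z. z \<in> Q \<Longrightarrow> \<exists>y\<in>Q. (y,z) \<in> outer" by blast+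
  define F where "F = {Z. Z \<subseteq> V - A \<and> (\<forall>z\<in>Z. \<exists>y\<in>Z. R y z)}"
  define U where "U = \<Union>F"
  have "U \<subseteq> V - A" unfolding U_def F_def by blast
  moreover have "\<exists>y\<in>U. R y z" if zU: "z \<in> U" for z
  proof -
    obtain Z where "Z \<in> F" "z \<in> Z" using zU unfolding U_def by blast
    then show ?thesis unfolding U_def F_def by blast
  qed
  ultimately have UF: "U \<in> F" unfolding F_def by blast
  have "Q \<in> F" using Q(2) R_V unfolding F_def outer_def by blast
  then have "U \<noteq> {}" using Q(1) unfolding U_def by blast
  have U: "U \<subseteq> V - A" "\<And>z. z \<in> U \<Longrightarrow> \<exists>y\<in>U. R y z" using UF unfolding F_def by blast+
  have max: "Z \<subseteq> U" if "Z \<in> F" for Z using that unfolding U_def by blast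
  have "U \<subseteq> V" using U(1) by blast
  from key[OF this \<open>U \<noteq> {}\<close>] obtain z where z: "z \<in> V"
    "(z \<in> U \<and> (\<forall>u\<in>U. \<not> R u z)) \<or>
      (z \<in> U \<and> card {u\<in>U. R u z} \<ge> 3) \<or> (z \<notin> U \<and> card {u\<in>U. R u z} \<ge> 2)" by blast
  have h: "{u\<in>U. R u h} = {}" using U(1) by (auto simp: in_h)
  consider "z \<in> U" "card {u\<in>U. R u z} \<ge> 3" | "z \<notin> U" "card {u\<in>U. R u z} \<ge> 2"
    using z U(2) by blast
  then show False
  proof cases
    case 1
    then show ?thesis using not_three[of z U] z(1) h by (cases "z = h") auto
  next
    case 2
    obtain x y where xy: "x \<in> U" "y \<in> U" "x \<noteq> y" "R x z" "R y z" using two_in[OF 2(2)] .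
    show ?thesis
    proof (cases "z \<in> A")
      case True then show ?thesis using one_outside[of z x y] xy U(1) by blast
    next
      case False
      then have "insert z U \<in> F" using U z(1) xy unfolding F_def by blast
      then show ?thesis using max 2(1) by blast
    qed
  qed
qed

lemma finite_outer: "finite outer"
  by (rule finite_subset[of _ "V \<times> V"]) (use finV R_V in \<open>auto simp: outer_def\<close>)

lemma acyclic_outer: "acyclic outer" by (rule wf_acyclic[OF wf_outer])

lemma wf_outer_conv: "wf (outer\<inverse>)"
  by (rule finite_acyclic_wf_converse[OF finite_outer acyclic_outer])

definition "desc = {v. (h,v) \<in> outer\<^sup>*}"

lemma h_desc: "h \<in> desc" by (simp add: desc_def)

lemma desc_sub: "desc \<subseteq> V - A"
proof
  fix v assume "v \<in> desc"
  then have "(h,v) \<in> outer\<^sup>*" by (simp add: desc_def)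
  then show "v \<in> V - A" by (induction) (use hV hA R_V in \<open>auto simp: outer_def\<close>)
qed

lemma desc_step: "u \<in> desc \<Longrightarrow> R u v \<Longrightarrow> v \<notin> A \<Longrightarrow> v \<in> desc"
  using desc_sub unfolding desc_def by (auto simp: outer_def intro: rtrancl_into_rtrancl)

lemma desc_pred:
  assumes "v \<in> desc" "v \<noteq> h" shows "\<exists>u\<in>desc. R u v"
proof -
  have "(h,v) \<in> outer\<^sup>*" using assms by (simp add: desc_def)
  then obtain u where "(h,u) \<in> outer\<^sup>*" "(u,v) \<in> outer" using assms(2) by (metis rtranclE)
  then show ?thesis by (auto simp: desc_def outer_def)
qed

text \<open>Arcs outside \<open>A\<close> cannot be followed forever inside \<open>Q\<close>; the
  last vertex reached still has an out-neighbour, which must lie in \<open>A\<close>. For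
  \<open>Q = desc\<close> this yields a descendant of \<open>h\<close> that hits
  \<open>A\<close>.\<close>

lemma ex_sink:
  assumes "Q \<noteq> {}" "Q \<subseteq> V - A" "\<And>u v. u \<in> Q \<Longrightarrow> R u v \<Longrightarrow> v \<notin> A \<Longrightarrow> v \<in> Q"
  shows "\<exists>t\<in>Q. (\<forall>v. R t v \<longrightarrow> v \<in> A) \<and> (\<exists>a\<in>A. R t a)"
proof -
  obtain q where "q \<in> Q" using assms(1) by blast
  then obtain t where t: "t \<in> Q" "\<And>y. (y,t) \<in> outer\<inverse> \<Longrightarrow> y \<notin> Q"
    using wfE_min[OF wf_outer_conv] by metis
  then have "\<forall>v. R t v \<longrightarrow> v \<in> A" using assms unfolding outer_def by blast
  moreover have "\<exists>v. R t v" using out t(1) assms(2) by blast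
  ultimately show ?thesis using t(1) by blast
qed

text \<open>Apply \<open>key\<close> to \<open>desc \<union> B\<close>. Every member has an
  in-neighbour in this set, and none has three, since only \<open>B\<close> contributes to
  \<open>h\<close> and \<open>B\<close> is a proper part of \<open>A\<close>. So some vertex outside
  the set has two in-neighbours in it. It lies in \<open>A\<close>: descendants pass membership on
  outside \<open>A\<close>, and by \<open>common_A\<close> two members of \<open>A\<close> share
  nothing else but \<open>h\<close>. In the applications, \<open>B\<close> collects the members of
  \<open>A\<close> already known to be hit.\<close>

lemma grow:
  assumes B: "B \<subset> A" "B \<noteq> {}" and pred: "\<And>a. a \<in> B \<Longrightarrow> \<exists>x\<in>desc \<union> B. R x a"
  shows "\<exists>a\<in>A - B. \<exists>x\<in>desc \<union> B. \<exists>y\<in>desc \<union> B. x \<noteq> y \<and> R x a \<and> R y a"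
proof -
  define U where "U = desc \<union> B"
  have "U \<subseteq> V" "U \<noteq> {}" using desc_sub B AV unfolding U_def by blast+
  from key[OF this] obtain z where z: "z \<in> V"
    "(z \<in> U \<and> (\<forall>u\<in>U. \<not> R u z)) \<or>
      (z \<in> U \<and> card {u\<in>U. R u z} \<ge> 3) \<or> (z \<notin> U \<and> card {u\<in>U. R u z} \<ge> 2)" by blast
  have "\<exists>u\<in>U. R u h" using B in_h unfolding U_def by blast
  then have "\<exists>u\<in>U. R u z" if "z \<in> U"
    using that desc_pred pred unfolding U_def by blast
  moreover have "\<not> card {u\<in>U. R u z} \<ge> 3"
  proof (cases "z = h")
    case True
    have "{u\<in>U. R u h} = B" unfolding U_def in_h using B desc_sub by blast
    then show ?thesis using True psubset_card_mono[OF finA B(1)] cardA by simp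
  qed (use not_three z in blast)
  ultimately have 2: "z \<notin> U" "card {u\<in>U. R u z} \<ge> 2" using z by blast+
  obtain x y where xy: "x \<in> U" "y \<in> U" "x \<noteq> y" "R x z" "R y z" using two_in[OF 2(2)] .
  have "z \<in> A"
  proof (rule ccontr)
    assume "z \<notin> A"
    then have "x \<notin> desc" "y \<notin> desc" using desc_step xy 2(1) unfolding U_def by blast+
    then have "x \<in> A" "y \<in> A" using xy B(1) unfolding U_def by blast+
    then have "z = h" using common_A xy \<open>z \<notin> A\<close> by blast
    then show False using 2(1) h_desc unfolding U_def by blast
  qed
  then show ?thesis using xy 2(1) unfolding U_def by blast
qed

text \<open>Let \<open>v\<close> be a last vertex outside \<open>A\<close> that is no descendant. It
  does not hit \<open>A\<close>, so it points to descendants; let \<open>y\<close> be a first one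
  among these. An in-neighbour \<open>x\<close> of \<open>y\<close> in \<open>desc\<close> shares
  \<open>y\<close> with \<open>v\<close>, so the two are joined: an arc to \<open>v\<close> would
  make \<open>v\<close> a descendant, and an arc to \<open>x\<close> contradicts the choice of
  \<open>y\<close>.\<close>

lemma desc_eq:
  assumes b: "\<And>a x. a \<in> A \<Longrightarrow> R x a \<Longrightarrow> x \<notin> A \<Longrightarrow> x \<in> desc"
  shows "desc = V - A"
proof (rule ccontr)
  assume "desc \<noteq> V - A"
  then have "V - A - desc \<noteq> {}" using desc_sub by blast
  then obtain w where "w \<in> V - A - desc" by blast
  then obtain v where v: "v \<in> V - A - desc" "\<And>y. (y,v) \<in> outer\<inverse> \<Longrightarrow> y \<notin> V - A - desc"
    using wfE_min[OF wf_outer_conv] by metis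
  obtain z where z: "R v z" using out v(1) by blast
  have "z \<notin> A" using b z v(1) by blast
  then have "z \<in> desc" using v z R_V unfolding outer_def by blast
  then have "z \<in> {z \<in> desc. R v z}" using z by blast
  then obtain y where y: "y \<in> desc" "R v y" "\<And>x. (x,y) \<in> outer \<Longrightarrow> x \<notin> {z \<in> desc. R v z}"
    using wfE_min[OF wf_outer, of z "{z \<in> desc. R v z}"] by (metis (mono_tags, lifting) mem_Collect_eq)
  have "y \<noteq> h" using y(2) v(1) in_h by blast
  then obtain x where x: "x \<in> desc" "R x y" using desc_pred y(1) by blast
  have "x \<noteq> v" using x v by blast
  then have "R x v \<or> R v x" using share x(2) y(2) by blast
  moreover have "\<not> R x v" using desc_step[OF x(1)] v(1) by blast
  moreover have "(x,y) \<in> outer" using x y(1) desc_sub unfolding outer_def by blast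
  ultimately show False using y(3) x(1) by blast
qed

end

section \<open>Paths among the out-neighbours of a member of \<open>A\<close>\<close>

section \<open>Chains\<close>

text \<open>The steps of the path \<open>e # L @ [t]\<close>: zipping the list without its end
  against the list without its start pairs each vertex with its successor.\<close>

abbreviation arcs :: "'a \<Rightarrow> 'a list \<Rightarrow> 'a \<Rightarrow> ('a \<times> 'a) set" where
  "arcs e L t \<equiv> set (zip (e # L) (L @ [t]))"

lemma successively_arcs:
  "successively P (e # L @ [t]) \<longleftrightarrow> (\<forall>u v. (u,v) \<in> arcs e L t \<longrightarrow> P u v)"
  by (induction L arbitrary: e) auto

lemma arcs_fst: "(u,v) \<in> arcs e L t \<Longrightarrow> u = e \<or> u \<in> set L"
  and arcs_snd: "(u,v) \<in> arcs e L t \<Longrightarrow> v \<in> set L \<or> v = t"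
  using set_zip_leftD[of u v "e # L" "L @ [t]"] set_zip_rightD[of u v "e # L" "L @ [t]"] by auto

lemma arcs_pred: "v \<in> set L \<or> v = t \<Longrightarrow> \<exists>u. (u,v) \<in> arcs e L t"
  using in_set_impl_in_set_zip2[of "e # L" "L @ [t]" v] by auto

lemma arcs_unique: "distinct (e # L) \<Longrightarrow> (u,v) \<in> arcs e L t \<Longrightarrow> (u,w) \<in> arcs e L t \<Longrightarrow> v = w"
  by (auto simp: in_set_zip nth_eq_iff_index_eq simp del: distinct.simps)

lemma arcs_hd: "distinct (e # L) \<Longrightarrow> (e,v) \<in> arcs e L t \<longleftrightarrow> v = hd (L @ [t])"
  by (cases L) (auto dest: set_zip_leftD)

lemma arcs_last: "distinct (e # L) \<Longrightarrow> (last (e # L), v) \<in> arcs e L t \<longleftrightarrow> v = t"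
proof -
  assume d: "distinct (e # L)"
  have "(last (e # L), t) \<in> arcs e L t"
    by (induction L arbitrary: e) auto
  then show ?thesis using arcs_unique[OF d] by blast
qed

lemma distinct_if_sorted_wrt: "sorted_wrt (\<noteq>) xs \<Longrightarrow> distinct xs"
  by (induction xs) auto

context hub_digraph
begin

text \<open>To be read backwards from \<open>t\<close>: the path stays among out-neighbours of
  \<open>a\<close> until it reaches \<open>e\<close>, where it stops because \<open>e\<close> is
  \<open>h\<close> or points to \<open>a\<close> itself.\<close>

definition "chain a t L e \<longleftrightarrow> successively R (e # L @ [t]) \<and> set L \<subseteq> V - A - {h} \<and>
  (\<forall>c\<in>set L. R a c) \<and> R a t \<and> a \<in> A \<and> e \<in> V - A \<and> (e = h \<or> R e a)"

text \<open>Both \<open>s\<close> and \<open>a\<close> point to \<open>t\<close>, so they are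
  joined. If \<open>s\<close> is \<open>h\<close> or points to \<open>a\<close>, the chain ends
  there; otherwise \<open>a\<close> points to \<open>s\<close>, and the argument repeats with an
  in-neighbour of \<open>s\<close> outside \<open>A\<close>. Acyclicity outside \<open>A\<close>
  makes this stop.\<close>

lemma ex_chain:
  assumes D: "desc = V - A" and a: "a \<in> A" "R a t" "t \<noteq> h" and s: "R s t" "s \<in> V - A"
  shows "\<exists>L e. chain a t L e \<and> last (e # L) = s"
  using wf_outer a(2,3) s
proof (induction s arbitrary: t rule: wf_induct_rule)
  case (less s)
  show ?case
  proof (cases "s = h \<or> R s a")
    case True
    then have "chain a t [] s" using less.prems a(1) by (auto simp: chain_def)
    then show ?thesis by (intro exI[of _ "[]"] exI[of _ s]) simp
  next
    case False
    then have as: "R a s" using share[OF less.prems(1,3)] a(1) less.prems(4) by blast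
    obtain u where u: "u \<in> V - A" "R u s" using desc_pred[of s] less.prems(4) False D by blast
    then have "(u,s) \<in> outer" using less.prems(4) by (simp add: outer_def)
    from less.IH[OF this as _ u(2,1)] False obtain L e where "chain a s L e" by blast
    then have "successively R ((e # L @ [s]) @ [t])"
      using less.prems(3) by (subst successively_append_iff) (auto simp: chain_def)
    then have "chain a t (L @ [s]) e" using less.prems False as \<open>chain a s L e\<close>
      by (auto simp: chain_def)
    then show ?thesis by (intro exI[of _ "L @ [s]"] exI[of _ e]) simp
  qed
qed

lemma chain_arcs: assumes "chain a t L e" "(u,v) \<in> arcs e L t" shows "R u v"
  using assms successively_arcs[of R e L t] by (auto simp: chain_def)

text \<open>A vertex other than \<open>h\<close> has at most two in-neighbours, and for a vertex
  behind \<open>e\<close> these are \<open>a\<close> and its predecessor on the chain. So no other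
  arc enters the chain.\<close>

lemma chain_in:
  assumes c: "chain a t L e" and t: "t \<noteq> h" and v: "v \<in> set L \<or> v = t" and u: "R u v" "u \<notin> A"
  shows "(u,v) \<in> arcs e L t"
proof -
  obtain p where p: "(p,v) \<in> arcs e L t" using arcs_pred[OF v] by blast
  have "p \<in> V - A" using arcs_fst[OF p] c by (auto simp: chain_def)
  moreover have "R p v" by (rule chain_arcs[OF c p])
  moreover have "R a v" "a \<in> A" "v \<noteq> h" using c v t by (auto simp: chain_def)
  ultimately have "u = p" using in_two[of v a p u] u by blast
  then show ?thesis using p by simp
qed

lemma chain_successively:
  assumes c: "chain a t L e" shows "successively (\<lambda>u v. (u,v) \<in> outer) (e # L)"
proof -
  have "successively R ((e # L) @ [t])" using c by (simp add: chain_def)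
  then have "successively R (e # L)" by (subst (asm) successively_append_iff) simp
  then show ?thesis
    by (rule successively_mono) (use c in \<open>auto simp: chain_def outer_def\<close>)
qed

lemma chain_outer:
  assumes c: "chain a t L e" and x: "x \<in> set (e # L)"
  shows "(e,x) \<in> outer\<^sup>*"
proof -
  have "successively (\<lambda>u v. (u,v) \<in> outer) (e # L)" by (rule chain_successively[OF c])
  then show ?thesis using x
  proof (induction L arbitrary: e)
    case (Cons c L)
    show ?case
    proof (cases "x = e")
      case False
      then have "(c,x) \<in> outer\<^sup>*" using Cons by auto
      then show ?thesis using Cons.prems by (auto intro: converse_rtrancl_into_rtrancl)
    qed simp
  qed simp
qed

text \<open>A repetition would close a cycle outside \<open>A\<close>.\<close>

lemma chain_distinct:
  assumes c: "chain a t L e" shows "distinct (e # L)"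
proof -
  have "successively (\<lambda>u v. (u,v) \<in> outer) (e # L)" by (rule chain_successively[OF c])
  then have "sorted_wrt (\<lambda>u v. (u,v) \<in> outer\<^sup>+) (e # L)"
    by (subst successively_conv_sorted_wrt[symmetric])
       (auto intro: transpI trancl_trans successively_mono)
  then have "sorted_wrt (\<noteq>) (e # L)"
    by (rule sorted_wrt_mono_rel[rotated]) (use acyclic_outer in \<open>auto simp: acyclic_def\<close>)
  then show ?thesis by (rule distinct_if_sorted_wrt)
qed

text \<open>Every vertex outside \<open>A\<close> has an out-neighbour, and following arcs outside
  \<open>A\<close> eventually leads into \<open>A\<close>; membership in \<open>X\<close> is then
  passed back along the arcs.\<close>

lemma covered:
  assumes t: "\<And>a u. a \<in> A \<Longrightarrow> R u a \<Longrightarrow> u \<notin> A \<Longrightarrow> u \<in> X" and "X \<subseteq> V - A"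
    and X: "\<And>u v. v \<in> X \<Longrightarrow> R u v \<Longrightarrow> u \<notin> A \<Longrightarrow> u \<in> X"
  shows "X = V - A"
proof -
  have "v \<in> X" if "v \<in> V - A" for v
    using wf_outer_conv that
  proof (induction v rule: wf_induct_rule)
    case (less v)
    obtain z where z: "R v z" using out less.prems by blast
    show ?case
    proof (cases "z \<in> A")
      case True then show ?thesis using t z less.prems by blast
    next
      case False
      then have "z \<in> X" using less z R_V by (auto simp: outer_def)
      then show ?thesis using X z less.prems by blast
    qed
  qed
  then show ?thesis using assms(2) by blast
qed

lemma chains_disjoint:
  assumes "chain a t L e" "chain b t' M f" "a \<noteq> b"
  shows "set L \<inter> set M = {}"
  using assms common_A[of a b] unfolding chain_def by blast

end

text \<open>The complete list of arcs when \<open>A\<close> is a directed triangle. Each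
  \<open>Li\<close> is the chain ending at \<open>ai\<close>, and its members are also hit by the
  predecessor of \<open>ai\<close> in the triangle. A chain may start at \<open>h\<close> or inside
  another chain, so the starting points are left open.\<close>

locale three_chains = arc_digraph V E d R h
  for V :: "'v set" and E d R h +
  fixes a0 a1 a2 :: 'v and L0 L1 L2 :: "'v list" and e0 e1 e2 :: 'v
  assumes dist: "distinct (h # a0 # a1 # a2 # L0 @ L1 @ L2)"
    and V_eq: "V = set (h # a0 # a1 # a2 # L0 @ L1 @ L2)"
    and R0: "R a0 v \<longleftrightarrow> v = h \<or> v \<in> set L1 \<or> v = a1"
    and R1: "R a1 v \<longleftrightarrow> v = h \<or> v \<in> set L2 \<or> v = a2"
    and R2: "R a2 v \<longleftrightarrow> v = h \<or> v \<in> set L0 \<or> v = a0"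
    and Ro: "u \<noteq> a0 \<Longrightarrow> u \<noteq> a1 \<Longrightarrow> u \<noteq> a2 \<Longrightarrow>
      R u v \<longleftrightarrow> (u,v) \<in> arcs e0 L0 a0 \<or> (u,v) \<in> arcs e1 L1 a1 \<or> (u,v) \<in> arcs e2 L2 a2"
    and e_in: "{e0,e1,e2} \<subseteq> {h} \<union> set L0 \<union> set L1 \<union> set L2"

text \<open>The analogue for the pattern with \<open>a0\<close> and \<open>a1\<close> joined both
  ways. Both point to \<open>a2\<close>, which therefore has no chain of its own.\<close>

locale two_chains = arc_digraph V E d R h
  for V :: "'v set" and E d R h +
  fixes a0 a1 a2 :: 'v and L0 L1 :: "'v list" and e0 e1 :: 'v
  assumes dist: "distinct (h # a0 # a1 # a2 # L0 @ L1)"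
    and V_eq: "V = set (h # a0 # a1 # a2 # L0 @ L1)"
    and R0: "R a0 v \<longleftrightarrow> v = h \<or> v \<in> set L1 \<or> v = a1 \<or> v = a2"
    and R1: "R a1 v \<longleftrightarrow> v = h \<or> v \<in> set L0 \<or> v = a0 \<or> v = a2"
    and R2: "R a2 v \<longleftrightarrow> v = h"
    and Ro: "u \<noteq> a0 \<Longrightarrow> u \<noteq> a1 \<Longrightarrow> u \<noteq> a2 \<Longrightarrow>
      R u v \<longleftrightarrow> (u,v) \<in> arcs e0 L0 a0 \<or> (u,v) \<in> arcs e1 L1 a1"
    and e_in: "{e0,e1} \<subseteq> {h} \<union> set L0 \<union> set L1"

context hub_digraph
begin

lemma three_chainsI:
  assumes A: "A = {a0,a1,a2}" and dA: "distinct [a0,a1,a2]"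
    and nR: "\<not> R a1 a0" "\<not> R a2 a1" "\<not> R a0 a2"
    and c: "chain a2 a0 L0 e0" "chain a0 a1 L1 e1" "chain a1 a2 L2 e2"
    and e: "{e0,e1,e2} \<subseteq> {h} \<union> set L0 \<union> set L1 \<union> set L2"
  shows "three_chains V E d R h a0 a1 a2 L0 L1 L2 e0 e1 e2"
proof
  show "{e0,e1,e2} \<subseteq> {h} \<union> set L0 \<union> set L1 \<union> set L2" by (rule e)
  have ah: "a0 \<noteq> h" "a1 \<noteq> h" "a2 \<noteq> h" using A hA by auto
  have in0: "(u,v) \<in> arcs e0 L0 a0" if "R u v" "u \<notin> A" "v \<in> set L0 \<or> v = a0" for u v
    using chain_in[OF c(1) ah(1)] that by blast
  have in1: "(u,v) \<in> arcs e1 L1 a1" if "R u v" "u \<notin> A" "v \<in> set L1 \<or> v = a1" for u v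
    using chain_in[OF c(2) ah(2)] that by blast
  have in2: "(u,v) \<in> arcs e2 L2 a2" if "R u v" "u \<notin> A" "v \<in> set L2 \<or> v = a2" for u v
    using chain_in[OF c(3) ah(3)] that by blast
  let ?X = "{h} \<union> set L0 \<union> set L1 \<union> set L2"
  have f0: "u \<in> ?X" if "(u,v) \<in> arcs e0 L0 a0" for u v using arcs_fst[OF that] e by auto
  have f1: "u \<in> ?X" if "(u,v) \<in> arcs e1 L1 a1" for u v using arcs_fst[OF that] e by auto
  have f2: "u \<in> ?X" if "(u,v) \<in> arcs e2 L2 a2" for u v using arcs_fst[OF that] e by auto
  have X: "?X = V - A"
  \<comment> \<open>By \<open>chain_in\<close> all arcs from outside \<open>A\<close> into the
    chains or into \<open>A\<close> are chain arcs, and their sources lie in \<open>?X\<close> by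
    the hypothesis on the starting points.\<close>
  proof (rule covered)
    show "u \<in> ?X" if "a \<in> A" "R u a" "u \<notin> A" for a u
      using that in0[OF that(2,3)] in1[OF that(2,3)] in2[OF that(2,3)] f0 f1 f2 unfolding A by blast
    show "?X \<subseteq> V - A" using c hV hA by (auto simp: chain_def)
    show "u \<in> ?X" if "v \<in> ?X" "R u v" "u \<notin> A" for u v
    proof -
      have "v \<noteq> h" using that in_h by blast
      then have "v \<in> set L0 \<or> v \<in> set L1 \<or> v \<in> set L2" using that(1) by auto
      then show ?thesis using in0[OF that(2,3)] in1[OF that(2,3)] in2[OF that(2,3)] f0 f1 f2 by blast
    qed
  qed
  have neq: "a0 \<noteq> a1" "a1 \<noteq> a2" "a0 \<noteq> a2" using dA by auto
  have disj: "set L0 \<inter> set L1 = {}" "set L0 \<inter> set L2 = {}" "set L1 \<inter> set L2 = {}"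
    using chains_disjoint[OF c(1,2)] chains_disjoint[OF c(1,3)] chains_disjoint[OF c(2,3)] neq by auto
  have sub: "set L0 \<subseteq> V - A - {h}" "set L1 \<subseteq> V - A - {h}" "set L2 \<subseteq> V - A - {h}"
    using c by (auto simp: chain_def)
  have dL: "distinct L0" "distinct L1" "distinct L2" using c[THEN chain_distinct] by auto
  have L: "v \<in> set L0 \<Longrightarrow> R a2 v" "v \<in> set L1 \<Longrightarrow> R a0 v" "v \<in> set L2 \<Longrightarrow> R a1 v"
    for v
    using c unfolding chain_def by blast+
  have LA: "R a2 a0" "R a0 a1" "R a1 a2" "R a0 h" "R a1 h" "R a2 h"
    using c A in_h unfolding chain_def by blast+
  \<comment> \<open>A vertex of a chain is hit by only one member of \<open>A\<close>, which
    determines the arcs leaving \<open>A\<close>.\<close>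
  have excl: "\<not> (R a0 v \<and> R a1 v)" "\<not> (R a0 v \<and> R a2 v)" "\<not> (R a1 v \<and> R a2 v)" if "v \<in> ?X - {h}" for v
    using common_A[of _ _ v] that X A neq by blast+
  have Vc: "v = h \<or> v = a0 \<or> v = a1 \<or> v = a2 \<or> v \<in> set L0 \<or> v \<in> set L1 \<or> v \<in> set L2" if "v \<in> V" for v
    using that X A by auto
  show "distinct (h # a0 # a1 # a2 # L0 @ L1 @ L2)"
    using disj sub dL ah neq unfolding A by auto
  show "V = set (h # a0 # a1 # a2 # L0 @ L1 @ L2)" using X AV A by auto
  have nh: "v \<noteq> h" if "v \<in> set L0 \<union> set L1 \<union> set L2" for v using that sub by blast
  show "R a0 v \<longleftrightarrow> v = h \<or> v \<in> set L1 \<or> v = a1" for v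
    using Vc[of v] R_V[of a0 v] LA L[of v] excl[of v] nR irr[of a0] nh[of v] by blast
  show "R a1 v \<longleftrightarrow> v = h \<or> v \<in> set L2 \<or> v = a2" for v
    using Vc[of v] R_V[of a1 v] LA L[of v] excl[of v] nR irr[of a1] nh[of v] by blast
  show "R a2 v \<longleftrightarrow> v = h \<or> v \<in> set L0 \<or> v = a0" for v
    using Vc[of v] R_V[of a2 v] LA L[of v] excl[of v] nR irr[of a2] nh[of v] by blast
  fix u v assume "u \<noteq> a0" "u \<noteq> a1" "u \<noteq> a2"
  then have uA: "u \<notin> A" by (simp add: A)
  show "R u v \<longleftrightarrow> (u,v) \<in> arcs e0 L0 a0 \<or> (u,v) \<in> arcs e1 L1 a1 \<or> (u,v) \<in> arcs e2 L2 a2"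
  proof
    assume r: "R u v"
    have "v \<noteq> h" using r uA in_h by blast
    then show "(u,v) \<in> arcs e0 L0 a0 \<or> (u,v) \<in> arcs e1 L1 a1 \<or> (u,v) \<in> arcs e2 L2 a2"
      using Vc[of v] R_V[OF r] in0[OF r uA] in1[OF r uA] in2[OF r uA] by blast
  next
    assume "(u,v) \<in> arcs e0 L0 a0 \<or> (u,v) \<in> arcs e1 L1 a1 \<or> (u,v) \<in> arcs e2 L2 a2"
    then show "R u v" using chain_arcs[OF c(1)] chain_arcs[OF c(2)] chain_arcs[OF c(3)] by blast
  qed
qed

lemma two_chainsI:
  assumes A: "A = {a0,a1,a2}" and dA: "distinct [a0,a1,a2]"
    and Rs: "R a0 a2" "R a1 a2" "\<not> R a2 a0" "\<not> R a2 a1"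
    and c: "chain a1 a0 L0 e0" "chain a0 a1 L1 e1"
    and e: "{e0,e1} \<subseteq> {h} \<union> set L0 \<union> set L1"
  shows "two_chains V E d R h a0 a1 a2 L0 L1 e0 e1"
proof
  show "{e0,e1} \<subseteq> {h} \<union> set L0 \<union> set L1" by (rule e)
  have ah: "a0 \<noteq> h" "a1 \<noteq> h" "a2 \<noteq> h" using A hA by auto
  have neq: "a0 \<noteq> a1" "a1 \<noteq> a2" "a0 \<noteq> a2" using dA by auto
  have in0: "(u,v) \<in> arcs e0 L0 a0" if "R u v" "u \<notin> A" "v \<in> set L0 \<or> v = a0" for u v
    using chain_in[OF c(1) ah(1)] that by blast
  have in1: "(u,v) \<in> arcs e1 L1 a1" if "R u v" "u \<notin> A" "v \<in> set L1 \<or> v = a1" for u v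
    using chain_in[OF c(2) ah(2)] that by blast
  \<comment> \<open>The in-degree 2 of \<open>a2\<close> is exhausted by \<open>a0\<close> and
    \<open>a1\<close>.\<close>
  have in2: "u \<in> A" if "R u a2" for u
    using in_two[OF ah(3) Rs(1,2) neq(1) that] A by blast
  let ?X = "{h} \<union> set L0 \<union> set L1"
  have f0: "u \<in> ?X" if "(u,v) \<in> arcs e0 L0 a0" for u v using arcs_fst[OF that] e by auto
  have f1: "u \<in> ?X" if "(u,v) \<in> arcs e1 L1 a1" for u v using arcs_fst[OF that] e by auto
  have X: "?X = V - A"
  proof (rule covered)
    show "u \<in> ?X" if "a \<in> A" "R u a" "u \<notin> A" for a u
      using that in0[OF that(2,3)] in1[OF that(2,3)] in2[of u] f0 f1 unfolding A by blast
    show "?X \<subseteq> V - A" using c hV hA by (auto simp: chain_def)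
    show "u \<in> ?X" if "v \<in> ?X" "R u v" "u \<notin> A" for u v
    proof -
      have "v \<noteq> h" using that in_h by blast
      then have "v \<in> set L0 \<or> v \<in> set L1" using that(1) by auto
      then show ?thesis using in0[OF that(2,3)] in1[OF that(2,3)] f0 f1 by blast
    qed
  qed
  have disj: "set L0 \<inter> set L1 = {}" using chains_disjoint[OF c(1,2)] neq by auto
  have sub: "set L0 \<subseteq> V - A - {h}" "set L1 \<subseteq> V - A - {h}" using c by (auto simp: chain_def)
  have dL: "distinct L0" "distinct L1" using c[THEN chain_distinct] by auto
  have L: "v \<in> set L0 \<Longrightarrow> R a1 v" "v \<in> set L1 \<Longrightarrow> R a0 v"
    for v
    using c unfolding chain_def by blast+
  have LA: "R a1 a0" "R a0 a1" "R a0 h" "R a1 h" "R a2 h"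
    using c A in_h unfolding chain_def by blast+
  have excl: "\<not> (R a0 v \<and> R a1 v)" "\<not> (R a0 v \<and> R a2 v)" "\<not> (R a1 v \<and> R a2 v)" if "v \<in> ?X - {h}" for v
    using common_A[of _ _ v] that X A neq by blast+
  have Vc: "v = h \<or> v = a0 \<or> v = a1 \<or> v = a2 \<or> v \<in> set L0 \<or> v \<in> set L1" if "v \<in> V" for v
    using that X A by auto
  show "distinct (h # a0 # a1 # a2 # L0 @ L1)"
    using disj sub dL ah neq unfolding A by auto
  show "V = set (h # a0 # a1 # a2 # L0 @ L1)" using X AV A by auto
  have nh: "v \<noteq> h" if "v \<in> set L0 \<union> set L1" for v using that sub by blast
  show "R a0 v \<longleftrightarrow> v = h \<or> v \<in> set L1 \<or> v = a1 \<or> v = a2" for v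
    using Vc[of v] R_V[of a0 v] LA L[of v] excl[of v] Rs irr[of a0] nh[of v] by blast
  show "R a1 v \<longleftrightarrow> v = h \<or> v \<in> set L0 \<or> v = a0 \<or> v = a2" for v
    using Vc[of v] R_V[of a1 v] LA L[of v] excl[of v] Rs irr[of a1] nh[of v] by blast
  show "R a2 v \<longleftrightarrow> v = h" for v
    using Vc[of v] R_V[of a2 v] LA L[of v] excl[of v] Rs irr[of a2] nh[of v] by blast
  fix u v assume "u \<noteq> a0" "u \<noteq> a1" "u \<noteq> a2"
  then have uA: "u \<notin> A" by (simp add: A)
  show "R u v \<longleftrightarrow> (u,v) \<in> arcs e0 L0 a0 \<or> (u,v) \<in> arcs e1 L1 a1"
  proof
    assume r: "R u v"
    have "v \<noteq> h" "v \<noteq> a2" using r uA in_h in2 by blast+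
    then show "(u,v) \<in> arcs e0 L0 a0 \<or> (u,v) \<in> arcs e1 L1 a1"
      using Vc[of v] R_V[OF r] in0[OF r uA] in1[OF r uA] by blast
  next
    assume "(u,v) \<in> arcs e0 L0 a0 \<or> (u,v) \<in> arcs e1 L1 a1"
    then show "R u v" using chain_arcs[OF c(1)] chain_arcs[OF c(2)] by blast
  qed
qed

end

section \<open>Reading off the stars in the directed triangle pattern\<close>

section \<open>Three chains\<close>

lemma hd_snoc: "hd (L @ [t]) \<in> set L \<or> L = [] \<and> hd (L @ [t]) = t"
  by (cases L) auto

context arc_digraph
begin

text \<open>By \<open>dec\<close> these are the vertices of decoration -2. Such a vertex is adjacent
  to its out-neighbour, since a common out-neighbour would be a loop there.\<close>

definition "plain u \<longleftrightarrow> (\<exists>!v. R u v)"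

lemma plain_E: assumes "plain u" "R u v" shows "E u v"
proof (rule E_I1[OF assms(2)])
  fix z assume "R u z" "R v z"
  moreover have "z = v" using assms \<open>R u z\<close> unfolding plain_def by blast
  ultimately show False using irr by blast
qed

lemma plain_I: "R u v \<Longrightarrow> (\<And>w. R u w \<Longrightarrow> w = v) \<Longrightarrow> plain u"
  unfolding plain_def by blast

lemma plain_d: assumes "plain u" "u \<in> V" shows "d u = -2"
proof -
  obtain v where "\<And>w. R u w \<longleftrightarrow> w = v" using assms(1) unfolding plain_def by blast
  then show ?thesis using dec[OF assms(2)] by simp
qed

lemma plain_leg:
  "successively R (xs @ [t]) \<Longrightarrow> \<forall>u\<in>set xs. plain u \<Longrightarrow> successively E (xs @ [t])"
proof (induction xs)
  case (Cons x xs)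
  then show ?case using plain_E by (cases xs) auto
qed simp

lemma cons_leg: "E x (hd (ys @ [t])) \<Longrightarrow> successively E (ys @ [t]) \<Longrightarrow> successively E (x # ys @ [t])"
  by (cases ys) auto

lemma plain_map: "\<forall>u\<in>set L. plain u \<and> u \<in> V \<Longrightarrow> map d L = twos (length L)"
  using plain_d by (simp add: map_replicate_const cong: map_cong)

lemma d_eq:
  assumes "v \<in> V" "\<And>z. R v z \<longleftrightarrow> z \<in> set zs" "distinct zs"
  shows "d v = - int (length zs) - 1"
proof -
  have "{z. R v z} = set zs" using assms(2) by blast
  then show ?thesis using dec[OF assms(1)] distinct_card[OF assms(3)] by simp
qed

end

context three_chains
begin

text \<open>The configuration is invariant under rotation, so statements about the chain
  \<open>L0\<close> carry over to \<open>L1\<close> and \<open>L2\<close> through the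
  interpretations \<open>r1\<close> and \<open>r2\<close>.\<close>

lemma rot: "three_chains V E d R h a1 a2 a0 L1 L2 L0 e1 e2 e0"
proof
  show "distinct (h # a1 # a2 # a0 # L1 @ L2 @ L0)" using dist by auto
  show "V = set (h # a1 # a2 # a0 # L1 @ L2 @ L0)" unfolding V_eq by auto
  show "{e1,e2,e0} \<subseteq> {h} \<union> set L1 \<union> set L2 \<union> set L0" using e_in by auto
qed (use R0 R1 R2 Ro in blast)+

lemma sep:
  "h \<notin> {a0,a1,a2} \<union> set L0 \<union> set L1 \<union> set L2" "a0 \<noteq> a1" "a0 \<noteq> a2" "a1 \<noteq> a2"
  "{a0,a1,a2} \<inter> (set L0 \<union> set L1 \<union> set L2) = {}" "set L0 \<inter> set L1 = {}" "set L0 \<inter> set L2 = {}"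
  "set L1 \<inter> set L2 = {}" "distinct L0" "distinct L1" "distinct L2"
  using dist by auto

lemma tops_neq: "hd (L0 @ [a0]) \<noteq> hd (L1 @ [a1])"
proof -
  have "insert a0 (set L0) \<inter> insert a1 (set L1) = {}" using sep by auto
  moreover have "hd (L0 @ [a0]) \<in> insert a0 (set L0)" "hd (L1 @ [a1]) \<in> insert a1 (set L1)"
    using hd_snoc by fast+
  ultimately show ?thesis by (metis disjoint_iff)
qed

lemma R_h: "R h v \<longleftrightarrow> (h,v) \<in> arcs e0 L0 a0 \<or> (h,v) \<in> arcs e1 L1 a1 \<or> (h,v) \<in> arcs e2 L2 a2"
  using Ro sep(1) by blast

lemma arcs_R: "(u,v) \<in> arcs e0 L0 a0 \<Longrightarrow> R u v"
proof -
  assume a: "(u,v) \<in> arcs e0 L0 a0"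
  then have "u \<in> {h} \<union> set L0 \<union> set L1 \<union> set L2" using arcs_fst e_in by fastforce
  then have "u \<noteq> a0" "u \<noteq> a1" "u \<noteq> a2" using sep(1,5) by blast+
  then show "R u v" using Ro a by blast
qed

lemma leg_R: "successively R (e0 # L0 @ [a0])"
  using successively_arcs[of R e0 L0 a0] arcs_R by blast

lemma R_L: "u \<in> set L0 \<Longrightarrow> R u v \<longleftrightarrow> (u,v) \<in> arcs e0 L0 a0 \<or>
    u = e1 \<and> (u,v) \<in> arcs e1 L1 a1 \<or> u = e2 \<and> (u,v) \<in> arcs e2 L2 a2"
  using Ro[of u v] sep arcs_fst[of u v e1 L1 a1] arcs_fst[of u v e2 L2 a2] by blast

lemma e0_notin: "e0 = h \<or> e0 \<in> set L1 \<or> e0 \<in> set L2 \<Longrightarrow> distinct (e0 # L0)"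
  using sep by auto

lemma plain_L:
  assumes "u \<in> set L0" "u \<noteq> e1" "u \<noteq> e2" "distinct (e0 # L0)"
  shows "plain u"
proof -
  obtain v where "R u v" using out[of u] assms(1) V_eq by auto
  then show ?thesis
    using plain_I[of u v] R_L[OF assms(1)] assms arcs_unique[OF assms(4)] by blast
qed

text \<open>If \<open>L0\<close> is empty, \<open>h\<close> and \<open>a0\<close> are joined both
  ways and share at most the first vertex of the chain ending at \<open>a1\<close>. Otherwise the
  first vertex of \<open>L0\<close> can share an out-neighbour with \<open>h\<close> only if another
  chain starts at that vertex while \<open>h\<close> points to the same next vertex, which
  \<open>n\<close> forbids.\<close>

lemma top0:
  assumes h: "R h (hd (L0 @ [a0]))"
    and z: "\<And>z. R h z \<Longrightarrow> z = hd (L0 @ [a0]) \<or> z = hd (L1 @ [a1]) \<or> z = hd (L2 @ [a2])"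
    and n: "hd (L0 @ [a0]) \<noteq> e1 \<or> \<not> R h (hd (L1 @ [a1]))"
      "hd (L0 @ [a0]) \<noteq> e2 \<or> \<not> R h (hd (L2 @ [a2]))"
  shows "E h (hd (L0 @ [a0]))"
proof (cases "L0 = []")
  case True
  have "z = hd (L1 @ [a1])" if "R h z" "R a0 z" for z
    using z[OF that(1)] that(2) hd_snoc[of L1 a1] hd_snoc[of L2 a2] sep True irr unfolding R0 by auto
  then have "E h a0" by (rule E_I2[rotated 2]) (use h R0 True in auto)
  then show ?thesis using True by simp
next
  case False
  then have t: "hd (L0 @ [a0]) \<in> set L0" using hd_snoc by fast
  have "\<not> R (hd (L0 @ [a0])) z" if "R h z" for z
  proof
    assume r: "R (hd (L0 @ [a0])) z"
    have "z \<noteq> hd (L0 @ [a0])" using r irr by blast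
    then have "z \<in> set L1 \<union> {a1} \<or> z \<in> set L2 \<union> {a2}"
      using z[OF that] hd_snoc[of L1 a1] hd_snoc[of L2 a2] by auto
    then have "z \<notin> set L0 \<union> {a0}" using sep by blast
    then have nz: "(hd (L0 @ [a0]), z) \<notin> arcs e0 L0 a0" using arcs_snd by fast
    have e: "z = hd (L1 @ [a1]) \<or> z = hd (L2 @ [a2])" using z[OF that] \<open>z \<noteq> hd (L0 @ [a0])\<close> by blast
    from r nz consider "hd (L0 @ [a0]) = e1" "(hd (L0 @ [a0]), z) \<in> arcs e1 L1 a1"
      | "hd (L0 @ [a0]) = e2" "(hd (L0 @ [a0]), z) \<in> arcs e2 L2 a2"
      unfolding R_L[OF t] by blast
    then show False
    proof cases
      case 1
      then have "z \<in> set L1 \<union> {a1}" using arcs_snd by fast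
      then have "z = hd (L1 @ [a1])" using e hd_snoc[of L2 a2] sep by auto
      then show ?thesis using n(1) 1(1) that by blast
    next
      case 2
      then have "z \<in> set L2 \<union> {a2}" using arcs_snd by fast
      then have "z = hd (L2 @ [a2])" using e hd_snoc[of L1 a1] sep by auto
      then show ?thesis using n(2) 2(1) that by blast
    qed
  qed
  then show ?thesis using E_I1[OF h] by blast
qed

lemma d_a0: "d a0 = - (int (length L1) + 3)"
proof -
  have "d a0 = - int (length (h # a1 # L1)) - 1"
    by (rule d_eq) (use V_eq R0 sep in auto)
  then show ?thesis by simp
qed

lemma leg_R': "successively R (L0 @ [a0])"
  using leg_R by (cases L0) auto

interpretation r1: three_chains V E d R h a1 a2 a0 L1 L2 L0 e1 e2 e0 by (rule rot)
interpretation r2: three_chains V E d R h a2 a0 a1 L2 L0 L1 e2 e0 e1 by (rule r1.rot)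

text \<open>With all chains starting at \<open>h\<close>, the hub has out-degree 3 and is the centre
  of decoration -4. The chains give the runs of -2, and each end vertex counts the members of the
  chain ending at the next one.\<close>

lemma W_type:
  assumes e: "e0 = h" "e1 = h" "e2 = h"
  shows "in_W V E d"
proof -
  have ds: "distinct (e0 # L0)" "distinct (e1 # L1)" "distinct (e2 # L2)"
    using e0_notin r1.e0_notin r2.e0_notin e by blast+
  have ne: "\<forall>u\<in>set L0 \<union> set L1 \<union> set L2. u \<noteq> e0 \<and> u \<noteq> e1 \<and> u \<noteq> e2" using e sep(1) by blast
  have pl: "\<forall>u\<in>set L0. plain u" "\<forall>u\<in>set L1. plain u" "\<forall>u\<in>set L2. plain u"
    using ds ne by (blast intro: plain_L r1.plain_L r2.plain_L)+
  have Rh: "R h z \<longleftrightarrow> z = hd (L0 @ [a0]) \<or> z = hd (L1 @ [a1]) \<or> z = hd (L2 @ [a2])" for z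
    unfolding R_h using arcs_hd[OF ds(1)] arcs_hd[OF ds(2)] arcs_hd[OF ds(3)] e by auto
  have "z \<noteq> h" if "R h z" for z using that irr by blast
  then have tn: "hd (L0 @ [a0]) \<noteq> h" "hd (L1 @ [a1]) \<noteq> h" "hd (L2 @ [a2]) \<noteq> h" using Rh by blast+
  have dtop: "hd (L0 @ [a0]) \<noteq> hd (L1 @ [a1])" "hd (L0 @ [a0]) \<noteq> hd (L2 @ [a2])" "hd (L1 @ [a1]) \<noteq> hd (L2 @ [a2])"
    using tops_neq r1.tops_neq r2.tops_neq by metis+
  have top: "E h (hd (L0 @ [a0]))" "E h (hd (L1 @ [a1]))" "E h (hd (L2 @ [a2]))"
    by (rule top0 r1.top0 r2.top0; use Rh e tn in blast)+
  have dh: "d h = -4"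
    using d_eq[of h "[hd (L0 @ [a0]), hd (L1 @ [a1]), hd (L2 @ [a2])]"] Rh dtop hV by simp
  have m: "map d L0 = twos (length L0)" "map d L1 = twos (length L1)" "map d L2 = twos (length L2)"
    by (rule plain_map; use pl V_eq in auto)+
  \<comment> \<open>The legs are listed in the order of \<open>Gamma_legs\<close>, with
    \<open>q\<close>, \<open>r\<close>, \<open>p\<close> the lengths of \<open>L0\<close>,
    \<open>L2\<close>, \<open>L1\<close>.\<close>
  have "iso_star V E d (d h) [map d (L0 @ [a0]), map d (L2 @ [a2]), map d (L1 @ [a1])]"
    by (rule iso_star_of_legs[OF tree])
       (use dist V_eq top pl leg_R' r1.leg_R' r2.leg_R' in \<open>auto intro!: cons_leg plain_leg\<close>)
  then have "iso_star V E d (-4) (Gamma_legs (length L1) (length L0) (length L2))"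
    by (simp add: dh m Gamma_legs_def d_a0 r1.d_a0 r2.d_a0)
  then show ?thesis unfolding in_W_def by blast
qed

text \<open>Two chains start at \<open>h\<close>, the third at the last vertex \<open>b\<close> of
  \<open>L1\<close>. The edges run from \<open>b\<close> on into \<open>L2\<close> instead of to
  \<open>a1\<close>, which is a leg of its own at \<open>h\<close>. Since \<open>b\<close> points
  both to \<open>a1\<close> and to the start of \<open>L2\<close>, it is the -3 inside the long
  leg.\<close>

lemma N_type:
  assumes e: "e0 = h" "e1 = h" "e2 = last L1" and ne: "L1 \<noteq> []"
  shows "in_N V E d"
proof -
  obtain xs b where L1: "L1 = xs @ [b]" using ne by (metis append_butlast_last_id)
  have e2: "e2 = b" using e(3) L1 by simp
  have b: "b \<in> set L1" "b \<notin> set xs" "b \<notin> set L0" "b \<notin> set L2" "b \<noteq> h" "b \<notin> {a0,a1,a2}"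
    using L1 sep by auto
  have ds: "distinct (e0 # L0)" "distinct (e1 # L1)" "distinct (e2 # L2)"
    using e0_notin r1.e0_notin r2.e0_notin e b(1) e2 by blast+
  have pl: "\<forall>u\<in>set L0. plain u" "\<forall>u\<in>set L2. plain u"
  proof -
    have "\<forall>u\<in>set L0. u \<noteq> e1 \<and> u \<noteq> e2" "\<forall>u\<in>set L2. u \<noteq> e0 \<and> u \<noteq> e1" using sep(1) b e e2 by auto
    then show "\<forall>u\<in>set L0. plain u" "\<forall>u\<in>set L2. plain u"
      using plain_L[OF _ _ _ ds(1)] r2.plain_L[OF _ _ _ ds(3)] by blast+
  qed
  have plx: "\<forall>u\<in>set xs. plain u"
    using ds e sep(1) b(2) e2 L1 by (auto intro!: r1.plain_L)
  have Rh: "R h z \<longleftrightarrow> z = hd (L0 @ [a0]) \<or> z = hd (L1 @ [a1])" for z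
  proof -
    have "(h,z) \<notin> arcs e2 L2 a2" using arcs_fst[of h z e2 L2 a2] e2 b sep(1) by auto
    then show ?thesis unfolding R_h using arcs_hd[OF ds(1), of z a0] arcs_hd[OF ds(2), of z a1] e by simp
  qed
  have Rb: "R b z \<longleftrightarrow> z = a1 \<or> z = hd (L2 @ [a2])" for z
    unfolding r1.R_L[OF b(1)] using arcs_last[OF ds(2), of z a1] arcs_hd[OF ds(3), of z a2] e e2 b L1 by auto
  have t0: "hd (L0 @ [a0]) \<in> set L0 \<union> {a0}" and t2: "hd (L2 @ [a2]) \<in> set L2 \<union> {a2}"
    and t1: "hd (L1 @ [a1]) \<in> set L1"
    using hd_snoc[of L0 a0] hd_snoc[of L2 a2] hd_snoc[of L1 a1] ne by auto
  have tops: "hd (L0 @ [a0]) \<noteq> hd (L1 @ [a1])" "hd (L0 @ [a0]) \<noteq> hd (L2 @ [a2])" "hd (L1 @ [a1]) \<noteq> hd (L2 @ [a2])"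
    using tops_neq r1.tops_neq r2.tops_neq by metis+
  have "hd (L0 @ [a0]) \<noteq> b" using t0 b by auto
  moreover have "hd (L0 @ [a0]) \<noteq> h" "hd (L1 @ [a1]) \<noteq> h" using Rh irr by metis+
  ultimately have tops': "hd (L0 @ [a0]) \<noteq> h" "hd (L1 @ [a1]) \<noteq> h" "hd (L0 @ [a0]) \<noteq> b" by blast+
  have top: "E h (hd (L0 @ [a0]))" "E h (hd (L1 @ [a1]))"
    proof -
    have nh2: "\<not> R h (hd (L2 @ [a2]))" using Rh tops by metis
    show "E h (hd (L0 @ [a0]))"
      by (rule top0) (use Rh nh2 e tops' in auto)
    show "E h (hd (L1 @ [a1]))"
      by (rule r1.top0) (use Rh nh2 e tops' in auto)
  qed
  have Ea1: "E h a1"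
  proof (rule E_sym, rule E_I1)
    show "R a1 h" by (simp add: R1)
    fix z assume "R a1 z" "R h z"
    then show False unfolding R1 Rh using t0 t1 sep by auto
  qed
  have Eb: "E b (hd (L2 @ [a2]))"
  proof (rule E_I1)
    show "R b (hd (L2 @ [a2]))" by (simp add: Rb)
    fix z assume z: "R b z" "R (hd (L2 @ [a2])) z"
    then have z1: "z = a1" using irr unfolding Rb by metis
    show False
    proof (cases "L2 = []")
      case True then show ?thesis using z z1 R2[of a1] sep by auto
    next
      case False
      then have m: "hd (L2 @ [a2]) \<in> set L2" using hd_snoc by fast
      then have "hd (L2 @ [a2]) \<noteq> e0" "hd (L2 @ [a2]) \<noteq> e1" using sep(1) e by auto
      moreover have "(hd (L2 @ [a2]), a1) \<notin> arcs e2 L2 a2" using arcs_snd sep(4,5) by fast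
      ultimately show ?thesis using z z1 r2.R_L[OF m, of a1] by blast
    qed
  qed
  have dh: "d h = -3"
    using d_eq[of h "[hd (L0 @ [a0]), hd (L1 @ [a1])]"] Rh tops hV by simp
  have db: "d b = -3"
    using d_eq[of b "[a1, hd (L2 @ [a2])]"] Rb t2 sep b(1) V_eq by auto
  have m: "map d L0 = twos (length L0)" "map d xs = twos (length xs)" "map d L2 = twos (length L2)"
    by (rule plain_map; use pl plx V_eq L1 in auto)+
  have "successively R (xs @ [b])" using r1.leg_R' L1 by (simp add: successively_append_iff)
  then have "successively E (xs @ [b])" using plx by (rule plain_leg)
  moreover have "successively E (L2 @ [a2])" using r2.leg_R' pl(2) by (rule plain_leg)
  ultimately have "successively E ((xs @ [b]) @ L2 @ [a2])"
    by (subst successively_append_iff) (simp add: Eb)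
  then have "successively E (L1 @ L2 @ [a2])" by (simp add: L1)
  then have leg: "successively E (h # L1 @ L2 @ [a2])"
    using cons_leg[of h "L1 @ L2" a2] top(2) ne by simp
  have "iso_star V E d (d h) [map d [a1], map d (L0 @ [a0]), map d (L1 @ L2 @ [a2])]"
    by (rule iso_star_of_legs[OF tree])
       (use dist V_eq top Ea1 pl leg leg_R' in \<open>auto intro!: cons_leg plain_leg\<close>)
  then have "iso_star V E d (-3) (Delta_legs (Suc (length L2)) (length xs) (length L0))"
    by (simp add: dh db m Delta_legs_def d_a0 r1.d_a0 r2.d_a0 L1 algebra_simps)
  then show ?thesis unfolding in_N_def by blast
qed

text \<open>Only one chain starts at \<open>h\<close>, which thus has decoration -2; the three
  chains are strung together into one leg, while \<open>a0\<close> and \<open>a1\<close> hang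
  directly on \<open>h\<close>. The end \<open>b\<close> of \<open>L0\<close> and the end of
  \<open>L1\<close> have extra arcs and give the two entries -3; if \<open>L1\<close> is empty they
  coincide in a single -4.\<close>

lemma M_type:
  assumes e: "e0 = h" "e1 = last L0" "e2 = last (e1 # L1)" and ne: "L0 \<noteq> []"
  shows "in_M V E d"
proof -
  obtain xs b where L0: "L0 = xs @ [b]" using ne by (metis append_butlast_last_id)
  have e1: "e1 = b" using e(2) L0 by simp
  have b: "b \<in> set L0" "b \<notin> set xs" "b \<notin> set L1" "b \<notin> set L2" "b \<noteq> h" "b \<notin> {a0,a1,a2}"
    using L0 sep by auto
  have e2: "e2 = b \<or> e2 \<in> set L1" using e(3) e1 by (auto split: if_splits)
  have ds: "distinct (e0 # L0)" "distinct (e1 # L1)" "distinct (e2 # L2)"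
    using e0_notin r1.e0_notin r2.e0_notin e(1) b(1) e1 e2 by blast+
  have "\<forall>u\<in>set L2. u \<noteq> e0 \<and> u \<noteq> e1" using sep(1) b e(1) e1 by auto
  then have plL2: "\<forall>u\<in>set L2. plain u" using r2.plain_L[OF _ _ _ ds(3)] by blast
  have plx: "\<forall>u\<in>set xs. plain u"
  proof
    fix u assume "u \<in> set xs"
    then have "u \<in> set L0" "u \<noteq> b" using L0 b(2) by auto
    moreover have "u \<noteq> e2" using e2 calculation sep(6) by auto
    ultimately show "plain u" using plain_L[OF _ _ _ ds(1)] e1 by blast
  qed
  have t2: "hd (L2 @ [a2]) \<in> set L2 \<union> {a2}" and t0: "hd (L0 @ [a0]) \<in> set L0"
    using hd_snoc[of L0 a0] hd_snoc[of L2 a2] ne by auto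
  have Rh: "R h z \<longleftrightarrow> z = hd (L0 @ [a0])" for z
  proof -
    have "(h,z) \<notin> arcs e1 L1 a1" "(h,z) \<notin> arcs e2 L2 a2"
      using arcs_fst[of h z e1 L1 a1] arcs_fst[of h z e2 L2 a2] e1 e2 b sep(1) by auto
    then show ?thesis unfolding R_h using arcs_hd[OF ds(1), of z a0] e(1) by simp
  qed
  have plh: "plain h" using plain_I[of h] Rh by blast
  have top: "E h (hd (L0 @ [a0]))" using plain_E[OF plh] Rh by blast
  have Ea0: "E h a0"
  proof (rule E_sym, rule E_I1)
    show "R a0 h" by (simp add: R0)
    fix z assume "R a0 z" "R h z"
    then show False unfolding R0 Rh using t0 sep by auto
  qed
  have Ea1: "E h a1"
  proof (rule E_sym, rule E_I1)
    show "R a1 h" by (simp add: R1)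
    fix z assume "R a1 z" "R h z"
    then show False unfolding R1 Rh using t0 sep by auto
  qed
  have dh: "d h = -2" by (rule plain_d[OF plh hV])
  have m: "map d xs = twos (length xs)" "map d L2 = twos (length L2)"
    by (rule plain_map; use plL2 plx V_eq L0 in auto)+
  have "successively R (xs @ [b])" using leg_R' L0 by (simp add: successively_append_iff)
  then have legb: "successively E (xs @ [b])" using plx by (rule plain_leg)
  have leg2: "successively E (L2 @ [a2])" using r2.leg_R' plL2 by (rule plain_leg)
  have no_in2: "\<not> R (hd (L2 @ [a2])) a1"
  proof (cases "L2 = []")
    case True then show ?thesis using R2[of a1] sep by auto
  next
    case False
    then have m: "hd (L2 @ [a2]) \<in> set L2" using hd_snoc by fast
    then have "hd (L2 @ [a2]) \<noteq> e0" "hd (L2 @ [a2]) \<noteq> e1" using sep(1) b(4) e(1) e1 by auto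
    moreover have "(hd (L2 @ [a2]), a1) \<notin> arcs e2 L2 a2" using arcs_snd sep(4,5) by fast
    ultimately show ?thesis using r2.R_L[OF m, of a1] by blast
  qed
  \<comment> \<open>Besides ending the chain to \<open>a0\<close>, \<open>b\<close> starts the chain
    to \<open>a1\<close>, and for empty \<open>L1\<close> also the one to \<open>a2\<close>.\<close>
  have Rb: "R b z \<longleftrightarrow> z = a0 \<or> z = hd (L1 @ [a1]) \<or> (L1 = [] \<and> z = hd (L2 @ [a2]))" for z
  proof -
    have "(b,z) \<in> arcs e0 L0 a0 \<longleftrightarrow> z = a0" using arcs_last[OF ds(1), of z a0] L0 by simp
    moreover have "(b,z) \<in> arcs e1 L1 a1 \<longleftrightarrow> z = hd (L1 @ [a1])" using arcs_hd[OF ds(2)] e1 by simp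
    moreover have "b = e2 \<longleftrightarrow> L1 = []" using e(3) e1 b(3) last_in_set[of L1] by (cases "L1 = []") auto
    moreover have "(e2,z) \<in> arcs e2 L2 a2 \<longleftrightarrow> z = hd (L2 @ [a2])" using arcs_hd[OF ds(3)] by simp
    ultimately show ?thesis unfolding R_L[OF b(1)] using e1 by blast
  qed
  show ?thesis
  proof (cases "L1 = []")
    case True
    have top2: "E b (hd (L2 @ [a2]))"
    proof (cases "L2 = []")
      case L2: True
      \<comment> \<open>Here \<open>a2\<close> points back to \<open>b\<close>, a member of
        \<open>L0\<close>, so the shared out-neighbour \<open>a0\<close> does not destroy the
        edge.\<close>
      have "E b a2"
      proof (rule E_I2)
        show "R b a2" using Rb True L2 by simp
        show "R a2 b" using R2 b(1) by simp
        fix z assume "R b z" "R a2 z"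
        then show "z = a0" using Rb[of z] True L2 no_in2 irr by auto
      qed
      then show ?thesis using L2 by simp
    next
      case False
      then have m2: "hd (L2 @ [a2]) \<in> set L2" using hd_snoc by fast
      then have "hd (L2 @ [a2]) \<noteq> e0" "hd (L2 @ [a2]) \<noteq> e1" using sep(1) b(4) e(1) e1 by auto
      moreover have "(hd (L2 @ [a2]), a0) \<notin> arcs e2 L2 a2" using arcs_snd sep(3,5) by fast
      ultimately have n0: "\<not> R (hd (L2 @ [a2])) a0" using r2.R_L[OF m2, of a0] by blast
      show ?thesis
      proof (rule E_I1)
        show "R b (hd (L2 @ [a2]))" using Rb True by simp
        fix z assume z: "R b z" "R (hd (L2 @ [a2])) z"
        then have "z = a0 \<or> z = a1 \<or> z = hd (L2 @ [a2])" using Rb True by simp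
        then show False using z(2) n0 no_in2 irr by blast
      qed
    qed
    have db: "d b = -4"
      using d_eq[of b "[a0, a1, hd (L2 @ [a2])]"] Rb True t2 sep b(1) V_eq by auto
    have "successively E ((xs @ [b]) @ L2 @ [a2])"
      using legb leg2 top2 by (subst successively_append_iff) simp
    then have "successively E (L0 @ L2 @ [a2])" by (simp add: L0)
    then have "successively E (h # L0 @ L2 @ [a2])"
      using cons_leg[of h "L0 @ L2" a2] top ne by simp
    then have "iso_star V E d (d h) [map d [a1], map d [a0], map d (L0 @ L2 @ [a2])]"
      by (intro iso_star_of_legs[OF tree]) (use dist V_eq Ea1 Ea0 True in auto)
    then have "iso_star V E d (-2) (Lambda_legs (Suc (length L2)) (length xs) 0)"
      by (simp add: dh db m Lambda_legs_def d_a0 r1.d_a0 r2.d_a0 L0 True algebra_simps)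
    then show ?thesis unfolding in_M_def by blast
  next
    case False
    then obtain ys c where L1: "L1 = ys @ [c]" by (metis append_butlast_last_id)
    have e2c: "e2 = c" using e(3) e1 L1 by simp
    have c: "c \<in> set L1" "c \<notin> set ys" using L1 sep by auto
    have cb: "c \<noteq> b" "c \<noteq> h" using c(1) b(3) sep(1) by auto
    have ply: "\<forall>u\<in>set ys. plain u"
    proof
      fix u assume "u \<in> set ys"
      then have "u \<in> set L1" "u \<noteq> c" using L1 c(2) by auto
      moreover have "u \<noteq> e0" using e(1) calculation sep(1) by auto
      ultimately show "plain u" using r1.plain_L[OF _ _ _ ds(2)] e2c by blast
    qed
    have Rc: "R c z \<longleftrightarrow> z = a1 \<or> z = hd (L2 @ [a2])" for z
      unfolding r1.R_L[OF c(1)] using arcs_last[OF ds(2), of z a1] arcs_hd[OF ds(3), of z a2] e(1) e2c cb L1 by auto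
    have t1': "hd (L1 @ [a1]) \<in> set L1" using hd_snoc False by fast
    have Eb: "E b (hd (L1 @ [a1]))"
    proof (rule E_I1)
      show "R b (hd (L1 @ [a1]))" using Rb by simp
      fix z assume z: "R b z" "R (hd (L1 @ [a1])) z"
      then have "z = a0" using Rb False irr by metis
      moreover have "hd (L1 @ [a1]) \<noteq> e0" using t1' sep(1) e(1) by auto
      moreover have "(hd (L1 @ [a1]), a0) \<notin> arcs e2 L2 a2" "(hd (L1 @ [a1]), a0) \<notin> arcs e1 L1 a1"
        using arcs_snd sep(2,3,5) by fast+
      ultimately show False using z(2) r1.R_L[OF t1', of a0] by blast
    qed
    have Ec: "E c (hd (L2 @ [a2]))"
    proof (rule E_I1)
      show "R c (hd (L2 @ [a2]))" using Rc by simp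
      fix z assume z: "R c z" "R (hd (L2 @ [a2])) z"
      then show False using Rc no_in2 irr by metis
    qed
    have "hd (L1 @ [a1]) \<noteq> a0" using t1' sep(5) by auto
    then have db: "d b = -3"
      using d_eq[of b "[a0, hd (L1 @ [a1])]"] Rb False b(1) V_eq by auto
    have dc: "d c = -3"
      using d_eq[of c "[a1, hd (L2 @ [a2])]"] Rc t2 sep c(1) V_eq by auto
    have my: "map d ys = twos (length ys)"
      by (rule plain_map; use ply V_eq L1 in auto)
    have "successively R (ys @ [c])" using r1.leg_R' L1 by (simp add: successively_append_iff)
    then have legc: "successively E (ys @ [c])" using ply by (rule plain_leg)
    have "successively E ((ys @ [c]) @ L2 @ [a2])"
      using legc leg2 Ec by (subst successively_append_iff) simp
    then have "successively E (L1 @ L2 @ [a2])" by (simp add: L1)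
    moreover have "hd (L1 @ L2 @ [a2]) = hd (L1 @ [a1])" using False by (simp add: hd_append)
    ultimately have "successively E ((xs @ [b]) @ L1 @ L2 @ [a2])"
      using legb Eb by (subst successively_append_iff) simp
    then have "successively E (L0 @ L1 @ L2 @ [a2])" by (simp add: L0)
    then have "successively E (h # L0 @ L1 @ L2 @ [a2])"
      using cons_leg[of h "L0 @ L1 @ L2" a2] top ne by simp
    then have "iso_star V E d (d h) [map d [a1], map d [a0], map d (L0 @ L1 @ L2 @ [a2])]"
      by (intro iso_star_of_legs[OF tree]) (use dist V_eq Ea1 Ea0 in auto)
    then have "iso_star V E d (-2) (Lambda_legs (Suc (length L2)) (length xs) (length L1))"
      by (simp add: dh db dc m my Lambda_legs_def d_a0 r1.d_a0 r2.d_a0 L0 L1 algebra_simps)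
    then show ?thesis unfolding in_M_def by blast
  qed
qed

end

section \<open>Reading off the stars in the pattern with a two-way arc\<close>

section \<open>Two chains\<close>

context two_chains
begin

lemma swap: "two_chains V E d R h a1 a0 a2 L1 L0 e1 e0"
proof
  show "distinct (h # a1 # a0 # a2 # L1 @ L0)" using dist by auto
  show "V = set (h # a1 # a0 # a2 # L1 @ L0)" unfolding V_eq by auto
  show "{e1,e0} \<subseteq> {h} \<union> set L1 \<union> set L0" using e_in by auto
qed (use R0 R1 R2 Ro in blast)+

lemma sep:
  "h \<notin> {a0,a1,a2} \<union> set L0 \<union> set L1" "a0 \<noteq> a1" "a0 \<noteq> a2" "a1 \<noteq> a2"
  "{a0,a1,a2} \<inter> (set L0 \<union> set L1) = {}" "set L0 \<inter> set L1 = {}"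
  "distinct L0" "distinct L1"
  using dist by auto

lemma tops_neq: "hd (L0 @ [a0]) \<noteq> hd (L1 @ [a1])"
proof -
  have "insert a0 (set L0) \<inter> insert a1 (set L1) = {}" using sep by auto
  moreover have "hd (L0 @ [a0]) \<in> insert a0 (set L0)" "hd (L1 @ [a1]) \<in> insert a1 (set L1)"
    using hd_snoc by fast+
  ultimately show ?thesis by (metis disjoint_iff)
qed

lemma R_h: "R h v \<longleftrightarrow> (h,v) \<in> arcs e0 L0 a0 \<or> (h,v) \<in> arcs e1 L1 a1"
  using Ro sep(1) by blast

lemma leg_R: "successively R (L0 @ [a0])"
proof -
  have "R u v" if a: "(u,v) \<in> arcs e0 L0 a0" for u v
  proof -
    have "u \<in> {h} \<union> set L0 \<union> set L1" using arcs_fst[OF a] e_in by auto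
    then have "u \<noteq> a0" "u \<noteq> a1" "u \<noteq> a2" using sep(1,5) by blast+
    then show ?thesis using Ro a by blast
  qed
  then have "successively R (e0 # L0 @ [a0])" using successively_arcs[of R e0 L0 a0] by blast
  then show ?thesis by (cases L0) auto
qed

lemma R_L: "u \<in> set L0 \<Longrightarrow> R u v \<longleftrightarrow> (u,v) \<in> arcs e0 L0 a0 \<or> u = e1 \<and> (u,v) \<in> arcs e1 L1 a1"
  using Ro[of u v] sep arcs_fst[of u v e1 L1 a1] by blast

lemma e0_notin: "e0 = h \<or> e0 \<in> set L1 \<Longrightarrow> distinct (e0 # L0)"
  using sep by auto

lemma plain_L:
  assumes "u \<in> set L0" "u \<noteq> e1" "distinct (e0 # L0)"
  shows "plain u"
proof -
  obtain v where "R u v" using out[of u] assms(1) V_eq by auto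
  then show ?thesis
    using plain_I[of u v] R_L[OF assms(1)] assms arcs_unique[OF assms(3)] by blast
qed

lemma top0:
  assumes e1: "e1 = h"
    and h: "R h (hd (L0 @ [a0]))"
    and z: "\<And>z. R h z \<Longrightarrow> z = hd (L0 @ [a0]) \<or> z = hd (L1 @ [a1])"
  shows "E h (hd (L0 @ [a0]))"
proof (cases "L0 = []")
  case True
  have "z = hd (L1 @ [a1])" if "R h z" "R a0 z" for z
    using z[OF that(1)] that(2) True irr by auto
  then have "E h a0" by (rule E_I2[rotated 2]) (use h R0 True in auto)
  then show ?thesis using True by simp
next
  case False
  then have t: "hd (L0 @ [a0]) \<in> set L0" using hd_snoc by fast
  then have te: "hd (L0 @ [a0]) \<noteq> e1" using sep(1) e1 by auto
  have "hd (L1 @ [a1]) \<in> insert a1 (set L1)" using hd_snoc by fast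
  then have "hd (L1 @ [a1]) \<notin> set L0 \<and> hd (L1 @ [a1]) \<noteq> a0" using sep by auto
  then have "(hd (L0 @ [a0]), hd (L1 @ [a1])) \<notin> arcs e0 L0 a0" using arcs_snd by fast
  then have n: "\<not> R (hd (L0 @ [a0])) (hd (L1 @ [a1]))" using R_L[OF t] te by blast
  show ?thesis
  proof (rule E_I1[OF h])
    fix w assume "R h w" "R (hd (L0 @ [a0])) w"
    then show False using z[of w] n irr by metis
  qed
qed

lemma d_a0: "d a0 = - (int (length L1) + 4)"
proof -
  have "d a0 = - int (length (h # a1 # a2 # L1)) - 1"
    by (rule d_eq) (use V_eq R0 sep in auto)
  then show ?thesis by simp
qed

lemma plain_a2: "plain a2" "E h a2" "d a2 = -2"
proof -
  show p: "plain a2" using plain_I[of a2 h] R2 by blast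
  show "E h a2" using E_sym plain_E[OF p] R2 by blast
  show "d a2 = -2" using plain_d[OF p] V_eq by simp
qed

interpretation s: two_chains V E d R h a1 a0 a2 L1 L0 e1 e0 by (rule swap)

text \<open>Both chains start at \<open>h\<close>, which has out-degree 2 and decoration -3. The
  third leg is the single vertex \<open>a2\<close>, whose only arc goes to \<open>h\<close>: the
  case \<open>p = 0\<close> of \<open>Delta_legs\<close>.\<close>

lemma N0_type:
  assumes e: "e0 = h" "e1 = h"
  shows "in_N V E d"
proof -
  have ds: "distinct (e0 # L0)" "distinct (e1 # L1)"
    using e0_notin s.e0_notin e by blast+
  have ne: "\<forall>u\<in>set L0 \<union> set L1. u \<noteq> e0 \<and> u \<noteq> e1" using e sep(1) by blast
  then have pl: "\<forall>u\<in>set L0. plain u" "\<forall>u\<in>set L1. plain u"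
    using plain_L[OF _ _ ds(1)] s.plain_L[OF _ _ ds(2)] by blast+
  have Rh: "R h z \<longleftrightarrow> z = hd (L0 @ [a0]) \<or> z = hd (L1 @ [a1])" for z
    unfolding R_h using arcs_hd[OF ds(1), of z a0] arcs_hd[OF ds(2), of z a1] e by simp
  have top: "E h (hd (L0 @ [a0]))" "E h (hd (L1 @ [a1]))"
    by (rule top0 s.top0; use Rh e in blast)+
  have dh: "d h = -3"
    using d_eq[of h "[hd (L0 @ [a0]), hd (L1 @ [a1])]"] Rh tops_neq hV by simp
  have m: "map d L0 = twos (length L0)" "map d L1 = twos (length L1)"
    by (rule plain_map; use pl V_eq in auto)+
  have "iso_star V E d (d h) [map d [a2], map d (L0 @ [a0]), map d (L1 @ [a1])]"
    by (rule iso_star_of_legs[OF tree])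
       (use dist V_eq top plain_a2(2) pl leg_R s.leg_R in \<open>auto intro!: cons_leg plain_leg\<close>)
  then have "iso_star V E d (-3) (Delta_legs 0 (length L0) (length L1))"
    by (simp add: dh m Delta_legs_def d_a0 s.d_a0 plain_a2(3) algebra_simps)
  then show ?thesis unfolding in_N_def by blast
qed

text \<open>The second chain continues the first at its last vertex \<open>b\<close>, so
  \<open>h\<close> has decoration -2 and \<open>b\<close> has -3. The parameter \<open>r\<close> is
  \<open>length L1 + 1\<close>, because \<open>a0\<close> points to \<open>a2\<close> in addition to
  \<open>h\<close>, \<open>a1\<close> and \<open>L1\<close>.\<close>

lemma M0_type:
  assumes e: "e0 = h" "e1 = last L0" and ne: "L0 \<noteq> []"
  shows "in_M V E d"
proof -
  obtain xs b where L0: "L0 = xs @ [b]" using ne by (metis append_butlast_last_id)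
  have e1: "e1 = b" using e(2) L0 by simp
  have b: "b \<in> set L0" "b \<notin> set xs" "b \<notin> set L1" "b \<noteq> h" "b \<notin> {a0,a1,a2}"
    using L0 sep by auto
  have ds: "distinct (e0 # L0)" "distinct (e1 # L1)"
    using e0_notin s.e0_notin e(1) b(1) e1 by blast+
  have "\<forall>u\<in>set L1. u \<noteq> e0" using sep(1) e(1) by auto
  then have pl: "\<forall>u\<in>set L1. plain u" using s.plain_L[OF _ _ ds(2)] by blast
  have plx: "\<forall>u\<in>set xs. plain u" using plain_L[OF _ _ ds(1)] e1 b(2) L0 by auto
  have t0: "hd (L0 @ [a0]) \<in> set L0" and t1: "hd (L1 @ [a1]) \<in> insert a1 (set L1)"
    using hd_snoc[of L0 a0] hd_snoc[of L1 a1] ne by auto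
  have Rh: "R h z \<longleftrightarrow> z = hd (L0 @ [a0])" for z
  proof -
    have "(h,z) \<notin> arcs e1 L1 a1" using arcs_fst[of h z e1 L1 a1] e1 b sep(1) by auto
    then show ?thesis unfolding R_h using arcs_hd[OF ds(1), of z a0] e(1) by simp
  qed
  have plh: "plain h" using plain_I[of h] Rh by blast
  have top: "E h (hd (L0 @ [a0]))" using plain_E[OF plh] Rh by blast
  have Ea0: "E h a0"
  proof (rule E_sym, rule E_I1)
    show "R a0 h" by (simp add: R0)
    fix z assume "R a0 z" "R h z"
    then show False unfolding R0 Rh using t0 sep by auto
  qed
  have Rb: "R b z \<longleftrightarrow> z = a0 \<or> z = hd (L1 @ [a1])" for z
  proof -
    have "(b,z) \<in> arcs e0 L0 a0 \<longleftrightarrow> z = a0" using arcs_last[OF ds(1), of z a0] L0 by simp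
    moreover have "(b,z) \<in> arcs e1 L1 a1 \<longleftrightarrow> z = hd (L1 @ [a1])" using arcs_hd[OF ds(2)] e1 by simp
    ultimately show ?thesis unfolding R_L[OF b(1)] using e1 by blast
  qed
  have Eb: "E b (hd (L1 @ [a1]))"
  proof (cases "L1 = []")
    case L1: True
    have "E b a1"
    proof (rule E_I2)
      show "R b a1" using Rb L1 by simp
      show "R a1 b" using R1 b(1) by simp
      fix z assume "R b z" "R a1 z"
      then show "z = a0" using Rb[of z] L1 irr by auto
    qed
    then show ?thesis using L1 by simp
  next
    case False
    then have m: "hd (L1 @ [a1]) \<in> set L1" using hd_snoc by fast
    then have "hd (L1 @ [a1]) \<noteq> e0" using sep(1) e(1) by auto
    moreover have "(hd (L1 @ [a1]), a0) \<notin> arcs e1 L1 a1" using arcs_snd sep(2,5) by fast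
    ultimately have n: "\<not> R (hd (L1 @ [a1])) a0" using s.R_L[OF m, of a0] by blast
    show ?thesis
    proof (rule E_I1)
      show "R b (hd (L1 @ [a1]))" using Rb by simp
      fix z assume "R b z" "R (hd (L1 @ [a1])) z"
      then show False using Rb n irr by metis
    qed
  qed
  have dh: "d h = -2" by (rule plain_d[OF plh hV])
  have "a0 \<noteq> hd (L1 @ [a1])" using t1 sep by auto
  then have db: "d b = -3" using d_eq[of b "[a0, hd (L1 @ [a1])]"] Rb b(1) V_eq by auto
  have m: "map d xs = twos (length xs)" "map d L1 = twos (length L1)"
    by (rule plain_map; use pl plx V_eq L0 in auto)+
  have "successively R (xs @ [b])" using leg_R L0 by (simp add: successively_append_iff)
  then have "successively E (xs @ [b])" using plx by (rule plain_leg)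
  moreover have "successively E (L1 @ [a1])" using s.leg_R pl by (rule plain_leg)
  ultimately have "successively E ((xs @ [b]) @ L1 @ [a1])"
    by (subst successively_append_iff) (simp add: Eb)
  then have "successively E (L0 @ L1 @ [a1])" by (simp add: L0)
  then have leg: "successively E (h # L0 @ L1 @ [a1])"
    using cons_leg[of h "L0 @ L1" a1] top ne by simp
  have "iso_star V E d (d h) [map d [a2], map d [a0], map d (L0 @ L1 @ [a1])]"
    by (rule iso_star_of_legs[OF tree]) (use dist V_eq Ea0 plain_a2(2) leg in auto)
  then have "iso_star V E d (-2) (Lambda_legs 0 (length xs) (Suc (length L1)))"
    by (simp add: dh db m Lambda_legs_def d_a0 s.d_a0 L0 plain_a2(3) algebra_simps)
  then show ?thesis unfolding in_M_def by blast
qed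

end

section \<open>Adding the vertices of an acyclic digraph one at a time is a sequence of
  blow-ups\<close>

section \<open>Blow-ups\<close>

text \<open>The rule \<open>adj\<close> solved for the edge, with common out-neighbours counted
  inside \<open>W\<close> only: adjacency before the vertices outside \<open>W\<close> have been
  added.\<close>

definition arc_edge :: "('v \<Rightarrow> 'v \<Rightarrow> bool) \<Rightarrow> 'v set \<Rightarrow> 'v \<Rightarrow> 'v \<Rightarrow> bool" where
  "arc_edge R W x y \<longleftrightarrow> x \<noteq> y \<and>
     (of_bool (R x y) + of_bool (R y x) :: nat) = Suc (card {z \<in> W. R x z \<and> R y z})"

text \<open>Up to renaming, the state is the plumbing that \<open>R\<close> defines on
  \<open>W\<close>. Since \<open>u\<close> is the tracked vertex of decoration -1, it has no
  out-neighbour in \<open>W\<close>.\<close>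

definition realizes where
  "realizes R W u S \<longleftrightarrow> (case S of (V', E', d', u') \<Rightarrow>
     \<exists>f. bij_betw f W V' \<and> f u = u' \<and>
       (\<forall>x\<in>W. \<forall>y\<in>W. E' (f x) (f y) = arc_edge R W x y) \<and>
       (\<forall>x\<in>W. d' (f x) = - 1 - int (card {z \<in> W. R x z})))"

definition bstate_ok :: "bstate \<Rightarrow> bool" where
  "bstate_ok S \<longleftrightarrow> (case S of (V, E, d, u) \<Rightarrow> u \<in> V \<and> (\<forall>a b. E a b \<longrightarrow> a \<in> V \<and> b \<in> V))"

lemma blowup_seq_ok: "blowup_seq S S' \<Longrightarrow> bstate_ok S \<Longrightarrow> bstate_ok S'"
proof (induction rule: blowup_seq.induct)
  case (vtx S V E d u w)
  then show ?case unfolding bstate_ok_def by auto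
next
  case (edge S V E d u x w)
  then show ?case unfolding bstate_ok_def by auto
qed

text \<open>Remove the unique sink \<open>u\<close> of \<open>W - A\<close>. The rest again has a
  unique sink \<open>v\<close>, and \<open>v\<close> points to \<open>u\<close>. If \<open>v\<close>
  is the only in-neighbour of \<open>u\<close> in \<open>W\<close>, adding \<open>u\<close> blows up
  the vertex \<open>v\<close>. If there is another one \<open>x\<close>, then \<open>x\<close>
  points to \<open>v\<close>; the two are adjacent before \<open>u\<close> is added, and their new
  common out-neighbour \<open>u\<close> removes that edge, so the edge is blown up.\<close>

lemma ex_blowup_seq:
  fixes R :: "'v \<Rightarrow> 'v \<Rightarrow> bool"
  assumes share: "\<And>x y z. z \<notin> A \<Longrightarrow> z \<noteq> h \<Longrightarrow> R x z \<Longrightarrow> R y z \<Longrightarrow> x \<noteq> y \<Longrightarrow> R x y \<or> R y x"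
    and two: "\<And>x y u z. z \<notin> A \<Longrightarrow> z \<noteq> h \<Longrightarrow> R x z \<Longrightarrow> R y z \<Longrightarrow> R u z \<Longrightarrow> x \<noteq> y \<Longrightarrow> u = x \<or> u = y"
    and toA: "\<And>u a. R u a \<Longrightarrow> a \<in> A \<Longrightarrow> u \<in> A" and to_h: "\<And>u. R u h \<Longrightarrow> u \<in> A"
    and irr: "\<And>u. \<not> R u u" and h: "h \<notin> A"
    and wf: "wf ({(u,v). R u v \<and> u \<notin> A \<and> v \<notin> A}\<inverse>)"
    and base_ok: "bstate_ok S"
    and base: "realizes R (insert h A) h S"
    and W: "finite W" "insert h A \<subseteq> W" "u \<in> W - A"
      "\<And>v. v \<in> W - A \<Longrightarrow> (\<forall>z\<in>W - A. \<not> R v z) \<longleftrightarrow> v = u"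
  shows "\<exists>S'. blowup_seq S S' \<and> realizes R W u S'"
  using W
proof (induction "card W" arbitrary: W u rule: less_induct)
  case less
  have max: "\<exists>t\<in>Q. \<forall>z\<in>Q. \<not> R t z" if Q: "Q \<noteq> {}" "Q \<inter> A = {}" for Q
  proof -
    obtain q where "q \<in> Q" using Q(1) by blast
    then obtain t where t: "t \<in> Q" "\<And>y. (y,t) \<in> {(u,v). R u v \<and> u \<notin> A \<and> v \<notin> A}\<inverse> \<Longrightarrow> y \<notin> Q"
      by (rule wfE_min[OF wf]) blast
    then show ?thesis using Q(2) by blast
  qed
  show ?case
  proof (cases "u = h")
    case True
    \<comment> \<open>A last vertex of \<open>W - A\<close> other than \<open>h\<close> would have
      an out-neighbour in \<open>W - A\<close>, which could only be \<open>h\<close>; but only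
      \<open>A\<close> points to \<open>h\<close>.\<close>
    have "W = insert h A"
    proof (rule ccontr)
      assume "W \<noteq> insert h A"
      then have "W - A - {h} \<noteq> {}" using less.prems(2) by blast
      then obtain t where t: "t \<in> W - A - {h}" "\<forall>z\<in>W - A - {h}. \<not> R t z"
        using max[of "W - A - {h}"] by blast
      then obtain z where "z \<in> W - A" "R t z" using less.prems(4)[of t] True by blast
      then show False using t to_h by blast
    qed
    then show ?thesis using base True blowup_seq.refl by blast
  next
    case uh: False
    define W' where "W' = W - {u}"
    have W': "W = insert u W'" "u \<notin> W'" "finite W'" "insert h A \<subseteq> W'"
      using less.prems uh unfolding W'_def by auto
    have uA: "u \<notin> A" using less.prems(3) by blast
    have sink_u: "\<not> R u z" if "z \<in> W" for z
      using less.prems(3) less.prems(4)[of u] that toA[of u z] uA by blast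
    have "W' - A \<noteq> {}" using W'(4) h by blast
    then obtain v where v: "v \<in> W' - A" "\<forall>z\<in>W' - A. \<not> R v z" using max[of "W' - A"] by blast
    have vu: "v \<noteq> u" using v W'(2) by blast
    have Rv: "R v z \<longleftrightarrow> z = u" if "z \<in> W" for z
    proof -
      have "R v u" using less.prems(4)[of v] v vu W'(1) by blast
      then show ?thesis using v toA[of v z] that W'(1) by blast
    qed
    have Rvu: "R v u" using Rv W'(1) by blast
    have uniq: "(\<forall>z\<in>W' - A. \<not> R x z) \<longleftrightarrow> x = v" if "x \<in> W' - A" for x
    \<comment> \<open>Any other sink of \<open>W' - A\<close> would also point to \<open>u\<close>,
      hence be joined to \<open>v\<close> by an arc inside \<open>W' - A\<close>.\<close>
    proof
      assume x: "\<forall>z\<in>W' - A. \<not> R x z"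
      have "x \<noteq> u" using that W'(2) by blast
      then have "R x u" using less.prems(4)[of x] that x W'(1) by blast
      then show "x = v" using share[OF uA uh _ Rvu] v x that by blast
    qed (use v in blast)
    have "card W' < card W" using W' by simp
    from less.hyps[OF this W'(3,4) v(1) uniq] obtain V' E' d' v' f where
      bs: "blowup_seq S (V', E', d', v')" and f: "bij_betw f W' V'" "f v = v'"
      and fE: "\<And>x y. x \<in> W' \<Longrightarrow> y \<in> W' \<Longrightarrow> E' (f x) (f y) = arc_edge R W' x y"
      and fd: "\<And>x. x \<in> W' \<Longrightarrow> d' (f x) = - 1 - int (card {z \<in> W'. R x z})"
      unfolding realizes_def by auto
    have "finite V'" using f(1) W'(3) bij_betw_finite by blast
    then obtain w where w: "w \<notin> V'" using ex_new_if_finite infinite_UNIV_nat by blast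
    define g where "g = f(u := w)"
    have gf: "g x = f x" if "x \<in> W'" for x using that W'(2) unfolding g_def by auto
    have gu: "g u = w" by (simp add: g_def)
    have fV: "f x \<in> V'" if "x \<in> W'" for x using f(1) that by (auto simp: bij_betw_def)
    have finj: "f x = f y \<longleftrightarrow> x = y" if "x \<in> W'" "y \<in> W'" for x y
      using f(1) that by (auto simp: bij_betw_def inj_on_def)
    have fw: "f x \<noteq> w" if "x \<in> W'" for x using fV[OF that] w by auto
    have g: "bij_betw g W (insert w V')"
    proof -
      have "bij_betw g W' V'" using f(1) gf by (simp cong: bij_betw_cong)
      then show ?thesis using W'(1,2) w gu notIn_Un_bij_betw[of u W' g V'] by auto
    qed
    have vW: "v \<in> W'" using v(1) by blast
    have "{z \<in> W. R u z} = {}" using sink_u by blast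
    then have d_u: "card {z \<in> W. R u z} = 0" by (simp only: card.empty)
    have d_x: "card {z \<in> W. R x z} = card {z \<in> W'. R x z} + of_bool (R x u)" for x
    proof -
      have "{z \<in> W. R x z} = (if R x u then insert u {z \<in> W'. R x z} else {z \<in> W'. R x z})"
        using W'(1) by auto
      then show ?thesis using W'(2,3) by auto
    qed
    have c_x: "card {z \<in> W. R x z \<and> R y z} = card {z \<in> W'. R x z \<and> R y z} + of_bool (R x u \<and> R y u)" for x y
    proof -
      have "{z \<in> W. R x z \<and> R y z} = (if R x u \<and> R y u then insert u {z \<in> W'. R x z \<and> R y z}
          else {z \<in> W'. R x z \<and> R y z})"
        using W'(1) by auto
      then show ?thesis using W'(2,3) by auto
    qed
    have e_u: "arc_edge R W x u \<longleftrightarrow> R x u" "arc_edge R W u x \<longleftrightarrow> R x u" if "x \<in> W'" for x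
    proof -
      have "{z \<in> W. R x z \<and> R u z} = {}" "{z \<in> W. R u z \<and> R x z} = {}" using sink_u by blast+
      then have "card {z \<in> W. R x z \<and> R u z} = 0" "card {z \<in> W. R u z \<and> R x z} = 0"
        by (simp_all only: card.empty)
      moreover have "\<not> R u x" "x \<noteq> u" using sink_u that W'(1,2) by auto
      ultimately show "arc_edge R W x u \<longleftrightarrow> R x u" "arc_edge R W u x \<longleftrightarrow> R x u"
        unfolding arc_edge_def by auto
    qed
    have e_x: "arc_edge R W x y \<longleftrightarrow> arc_edge R W' x y" if "\<not> (R x u \<and> R y u)" for x y
    proof -
      have "of_bool (R x u \<and> R y u) = (0::nat)" using that by (simp only: of_bool_eq)
      then show ?thesis unfolding arc_edge_def c_x by (simp only: add_0_right)
    qed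
    have e_r: "\<not> arc_edge R W x x" "\<not> arc_edge R W' x x" for x by (simp_all add: arc_edge_def)
    have nE: "\<not> E' w b" "\<not> E' b w" for b
      using blowup_seq_ok[OF bs base_ok] w by (auto simp: bstate_ok_def)
    show ?thesis
    proof (cases "\<exists>x\<in>W'. x \<noteq> v \<and> R x u")
      case False
      then have Ru: "R x u \<longleftrightarrow> x = v" if "x \<in> W'" for x using that Rvu by blast
      let ?S = "(insert w V', \<lambda>a b. E' a b \<or> (a = v' \<and> b = w) \<or> (a = w \<and> b = v'),
                   (d'(v' := d' v' - 1))(w := -1), w)"
      have "blowup_seq S ?S" by (rule blowup_seq.vtx[OF bs w])
      moreover have "realizes R W u ?S"
        unfolding realizes_def prod.case
      proof (intro exI[of _ g] conjI ballI)
        show "bij_betw g W (insert w V')" "g u = w" by (fact g gu)+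
        fix y assume "y \<in> W"
        then consider "y = u" | "y \<in> W'" using W'(1) by blast
        note y = this
        show "((d'(v' := d' v' - 1))(w := -1)) (g y) = - 1 - int (card {z \<in> W. R y z})"
          using y
        proof cases
          case 1 then show ?thesis using d_u gu by simp
        next
          case 2
          then show ?thesis
            using fd[OF 2] d_x[of y] Ru[OF 2] fw[OF 2] gf[OF 2] finj[OF 2 vW] f(2) by auto
        qed
        fix z assume "z \<in> W"
        then consider "z = u" | "z \<in> W'" using W'(1) by blast
        note z = this
        show "(E' (g y) (g z) \<or> (g y = v' \<and> g z = w) \<or> (g y = w \<and> g z = v')) = arc_edge R W y z"
          using y
        proof cases
          case y1: 1
          show ?thesis using z
          proof cases
            case 1 then show ?thesis using y1 e_r gu nE fw[OF vW] f(2) by auto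
          next
            case 2 then show ?thesis using y1 e_u[OF 2] gu gf[OF 2] fw[OF 2] finj[OF 2 vW] f(2) Ru[OF 2] nE by auto
          qed
        next
          case y2: 2
          show ?thesis using z
          proof cases
            case 1 then show ?thesis using e_u[OF y2] gu gf[OF y2] fw[OF y2] finj[OF y2 vW] f(2) Ru[OF y2] nE by auto
          next
            case 2
            have "y = z \<or> \<not> (R y u \<and> R z u)" using Ru[OF 2] Ru[OF y2] by blast
            then have "arc_edge R W y z \<longleftrightarrow> arc_edge R W' y z" using e_x e_r by metis
            then show ?thesis using fE[OF y2 2] gf[OF y2] gf[OF 2] fw[OF y2] fw[OF 2] by auto
          qed
        qed
      qed
      ultimately show ?thesis by blast
    next
      case True
      then obtain x where x: "x \<in> W'" "x \<noteq> v" "R x u" by blast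
      have Ru: "R y u \<longleftrightarrow> y = v \<or> y = x" if "y \<in> W'" for y
        using two[OF uA uh Rvu x(3), of y] x Rvu by blast
      \<comment> \<open>They share \<open>u\<close>, and \<open>v\<close> has no other out-neighbour
        in \<open>W\<close>.\<close>
      have xv: "R x v" using share[OF uA uh x(3) Rvu x(2)] Rv x W'(1,2) by blast
      have nvx: "\<not> R v x" using Rv x W'(1,2) by blast
      have "{z \<in> W'. R v z \<and> R x z} = {}" "{z \<in> W'. R x z \<and> R v z} = {}"
        using Rv W'(1,2) by blast+
      then have "card {z \<in> W'. R v z \<and> R x z} = 0" "card {z \<in> W'. R x z \<and> R v z} = 0"
        by (simp_all only: card.empty)
      then have evx: "arc_edge R W' v x" "arc_edge R W' x v"
        unfolding arc_edge_def using xv x(2) nvx by auto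
      have Evx: "E' v' (f x)" using fE[OF vW x(1)] evx f(2) by simp
      let ?S = "(insert w V', \<lambda>a b. (E' a b \<and> \<not> ((a = v' \<and> b = f x) \<or> (a = f x \<and> b = v')))
                         \<or> (a = v' \<and> b = w) \<or> (a = w \<and> b = v')
                         \<or> (a = f x \<and> b = w) \<or> (a = w \<and> b = f x),
                   (d'(v' := d' v' - 1, f x := d' (f x) - 1))(w := -1), w)"
      have "blowup_seq S ?S" by (rule blowup_seq.edge[OF bs Evx w])
      moreover have "realizes R W u ?S"
        unfolding realizes_def prod.case
      proof (intro exI[of _ g] conjI ballI)
        show "bij_betw g W (insert w V')" "g u = w" by (fact g gu)+
        fix y assume "y \<in> W"
        then consider "y = u" | "y \<in> W'" using W'(1) by blast
        note y = this
        show "((d'(v' := d' v' - 1, f x := d' (f x) - 1))(w := -1)) (g y) = - 1 - int (card {z \<in> W. R y z})"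
          using y
        proof cases
          case 1 then show ?thesis using d_u gu by simp
        next
          case 2
          then show ?thesis
            using fd[OF 2] d_x[of y] Ru[OF 2] fw[OF 2] gf[OF 2] finj[OF 2 vW] finj[OF 2 x(1)] f(2) by auto
        qed
        fix z assume "z \<in> W"
        then consider "z = u" | "z \<in> W'" using W'(1) by blast
        note z = this
        show "((E' (g y) (g z) \<and> \<not> ((g y = v' \<and> g z = f x) \<or> (g y = f x \<and> g z = v')))
                         \<or> (g y = v' \<and> g z = w) \<or> (g y = w \<and> g z = v')
                         \<or> (g y = f x \<and> g z = w) \<or> (g y = w \<and> g z = f x)) = arc_edge R W y z"
          using y
        proof cases
          case y1: 1
          show ?thesis using z
          proof cases
            case 1 then show ?thesis using y1 e_r gu nE fw[OF x(1)] fw[OF vW] f(2) by auto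
          next
            case 2 then show ?thesis
              using y1 e_u[OF 2] gu gf[OF 2] fw[OF 2] finj[OF 2 vW] finj[OF 2 x(1)] f(2) Ru[OF 2] nE by auto
          qed
        next
          case y2: 2
          show ?thesis using z
          proof cases
            case 1 then show ?thesis
              using e_u[OF y2] gu gf[OF y2] fw[OF y2] finj[OF y2 vW] finj[OF y2 x(1)] f(2) Ru[OF y2] nE by auto
          next
            case 2
            \<comment> \<open>Only \<open>v\<close> and \<open>x\<close> acquire a new common
              out-neighbour, so this is the only adjacency among old vertices that changes.\<close>
            have new: "arc_edge R W y z \<longleftrightarrow> arc_edge R W' y z \<and> \<not> ((y = v \<and> z = x) \<or> (y = x \<and> z = v))"
            proof (cases "(y = v \<and> z = x) \<or> (y = x \<and> z = v)")
              case True
              then show ?thesis using evx c_x[of v x] c_x[of x v] Rvu x(3) xv nvx by (auto simp: arc_edge_def)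
            next
              case False
              then have "y = z \<or> \<not> (R y u \<and> R z u)" using Ru[OF 2] Ru[OF y2] by blast
              then show ?thesis using e_x False e_r by metis
            qed
            show ?thesis
              unfolding new gf[OF y2] gf[OF 2] fE[OF y2 2]
              using fw[OF y2] fw[OF 2] finj[OF y2 vW] finj[OF y2 x(1)] finj[OF 2 vW] finj[OF 2 x(1)] f(2)
              by auto
          qed
        qed
      qed
      ultimately show ?thesis by blast
    qed
  qed
qed

section \<open>Cutting arcs to reach blow-ups, and the classification by hub patterns\<close>

section \<open>The classification\<close>

context hub_digraph
begin

text \<open>
The hypothesis \<open>orth\<close> says that the sum of the basis vectors of \<open>T\<close> is orthogonal to the vertices in \<open>A\<close>,
so that cutting the arcs from \<open>w\<close> to \<open>T\<close> changes no adjacency, only the decoration of \<open>w\<close>.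
\<close>

lemma blown_up:
  assumes T: "T \<subseteq> A" and w: "w \<in> V - A" and Rw: "\<And>a. a \<in> A \<Longrightarrow> R w a \<longleftrightarrow> a \<in> T"
    and only: "\<And>x a. R x a \<Longrightarrow> a \<in> A \<Longrightarrow> x \<notin> A \<Longrightarrow> x = w"
    and orth: "\<And>a. a \<in> A \<Longrightarrow> card {z \<in> T. R a z} = of_bool (a \<in> T)"
    and f0: "bij_betw f0 (insert h A) V0" "f0 h = u0"
    and E0: "\<And>x y. x \<in> insert h A \<Longrightarrow> y \<in> insert h A \<Longrightarrow>
      E0 (f0 x) (f0 y) \<longleftrightarrow> x \<noteq> y \<and> (x = h \<or> y = h)"
    and nadj: "\<And>x y. x \<in> A \<Longrightarrow> y \<in> A \<Longrightarrow> x \<noteq> y \<Longrightarrow>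
      of_bool (R x y) + of_bool (R y x) \<noteq> Suc (card {z \<in> insert h A. R x z \<and> R y z})"
    and d0: "d0 (f0 h) = -1" "\<And>a. a \<in> A \<Longrightarrow> d0 (f0 a) = - 1 - int (card {z \<in> insert h A. R a z})"
    and ok: "bstate_ok (V0, E0, d0, u0)"
  shows "\<exists>V' E' d' u. blowup_seq (V0, E0, d0, u0) (V', E', d', u) \<and>
      plumb_iso V E d V' E' (d'(u := - 1 - int (card T)))"
proof -
  \<comment> \<open>All arcs entering \<open>A\<close> from outside are cut; by \<open>only\<close>
    they start at \<open>w\<close>.\<close>
  define R' where "R' u v \<longleftrightarrow> R u v \<and> (v \<in> A \<longrightarrow> u \<in> A)" for u v
  have wA: "w \<notin> A" using w by blast
  obtain t where t: "t \<in> V - A" "\<forall>v. R t v \<longrightarrow> v \<in> A" "\<exists>a\<in>A. R t a"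
    using ex_sink[of "V - A"] hV hA R_V by blast
  \<comment> \<open>The final vertex of an outer path hits \<open>A\<close>, so it is
    \<open>w\<close>. Hence \<open>w\<close> has no out-neighbours besides \<open>T\<close> and
    becomes a sink.\<close>
  have "t = w" using only t by blast
  then have sink: "R w v \<longleftrightarrow> v \<in> T" for v using t(2) Rw T by blast
  have R'w: "\<not> R' w v" for v using sink T wA unfolding R'_def by blast
  have R'x: "R' x v \<longleftrightarrow> R x v" if "x \<noteq> w" for x v using only that unfolding R'_def by blast
  have "\<exists>S'. blowup_seq (V0, E0, d0, u0) S' \<and> realizes R' V w S'"
  proof (rule ex_blowup_seq[of A h])
    show "R' x y \<or> R' y x" if "z \<notin> A" "z \<noteq> h" "R' x z" "R' y z" "x \<noteq> y" for x y z
    proof -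
      have "x \<noteq> w" "y \<noteq> w" using R'w that by blast+
      then show ?thesis using share[of x z y] R'x that by blast
    qed
    show "u = x \<or> u = y" if "z \<notin> A" "z \<noteq> h" "R' x z" "R' y z" "R' u z" "x \<noteq> y" for x y u z
      using in_two[OF that(2)] that unfolding R'_def by blast
    show "u \<in> A" if "R' u a" "a \<in> A" for u a using that unfolding R'_def by blast
    show "u \<in> A" if "R' u h" for u using that in_h unfolding R'_def by blast
    show "\<not> R' u u" for u using irr unfolding R'_def by blast
    show "h \<notin> A" by (rule hA)
    have "{(u,v). R' u v \<and> u \<notin> A \<and> v \<notin> A} = outer" unfolding outer_def R'_def by blast
    then show "wf ({(u,v). R' u v \<and> u \<notin> A \<and> v \<notin> A}\<inverse>)" using wf_outer_conv by simp
    show "bstate_ok (V0, E0, d0, u0)" by (rule ok)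
    show "finite V" "insert h A \<subseteq> V" "w \<in> V - A" using finV hV AV w by auto
    show "(\<forall>z\<in>V - A. \<not> R' v z) \<longleftrightarrow> v = w" if v: "v \<in> V - A" for v
    proof
      assume n: "\<forall>z\<in>V - A. \<not> R' v z"
      obtain z where z: "R v z" using out v by blast
      then have "z \<in> A" using n R_V v unfolding R'_def by blast
      then show "v = w" using only z v by blast
    qed (use R'w in blast)
    show "realizes R' (insert h A) h (V0, E0, d0, u0)"
      unfolding realizes_def prod.case
    proof (intro exI[of _ f0] conjI ballI)
      have h_out: "\<not> R' h z" if "z \<in> insert h A" for z
        using that hA irr unfolding R'_def by blast
      have AA: "R' x z \<longleftrightarrow> R x z" if "x \<in> A" for x z using that unfolding R'_def by blast
      fix x assume x: "x \<in> insert h A"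
      show "d0 (f0 x) = - 1 - int (card {z \<in> insert h A. R' x z})"
      proof (cases "x = h")
        case True
        have "{z \<in> insert h A. R' h z} = {}" using h_out by blast
        then have "card {z \<in> insert h A. R' h z} = 0" by (simp only: card.empty)
        then show ?thesis using True d0(1) by simp
      next
        case False
        then have "x \<in> A" using x by blast
        then show ?thesis using d0(2) AA by simp
      qed
      fix y assume y: "y \<in> insert h A"
      have hx: "arc_edge R' (insert h A) h a" "arc_edge R' (insert h A) a h" if "a \<in> A" for a
      proof -
        have "{z \<in> insert h A. R' h z \<and> R' a z} = {}" "{z \<in> insert h A. R' a z \<and> R' h z} = {}"
          using h_out by blast+
        then have "card {z \<in> insert h A. R' h z \<and> R' a z} = 0" "card {z \<in> insert h A. R' a z \<and> R' h z} = 0"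
          by (simp_all only: card.empty)
        moreover have "R' a h" "\<not> R' h a" "a \<noteq> h" using that in_h AA h_out hA by blast+
        ultimately show "arc_edge R' (insert h A) h a" "arc_edge R' (insert h A) a h"
          unfolding arc_edge_def by auto
      qed
      show "E0 (f0 x) (f0 y) = arc_edge R' (insert h A) x y"
      proof (cases "x \<noteq> y \<and> (x = h \<or> y = h)")
        case True
        then have "arc_edge R' (insert h A) x y" using hx x y by blast
        then show ?thesis using E0[OF x y] True by blast
      next
        case False
        have "\<not> arc_edge R' (insert h A) x y"
        proof
          assume a: "arc_edge R' (insert h A) x y"
          then have "x \<in> A" "y \<in> A" "x \<noteq> y" using False x y unfolding arc_edge_def by blast+
          then show False using nadj[of x y] a unfolding arc_edge_def by (simp add: AA)
        qed
        then show ?thesis using E0[OF x y] False by blast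
      qed
    qed (use f0 in auto)
  qed
  then obtain V' E' d' u' f where bs: "blowup_seq (V0, E0, d0, u0) (V', E', d', u')"
    and f: "bij_betw f V V'" "f w = u'"
    and fE: "\<And>x y. x \<in> V \<Longrightarrow> y \<in> V \<Longrightarrow> E' (f x) (f y) = arc_edge R' V x y"
    and fd: "\<And>x. x \<in> V \<Longrightarrow> d' (f x) = - 1 - int (card {z \<in> V. R' x z})"
    unfolding realizes_def by auto
  \<comment> \<open>For \<open>y\<close> in \<open>T\<close>, cutting removes one arc between
    \<open>w\<close> and \<open>y\<close> and, by \<open>orth\<close>, exactly one common
    out-neighbour; for other \<open>y\<close> neither number changes.\<close>
  have Ew: "arc_edge R' V w y \<longleftrightarrow> E w y" if y: "y \<in> V" "y \<noteq> w" for y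
  proof -
    have "{z \<in> V. R' w z \<and> R' y z} = {}" using R'w by blast
    then have c': "card {z \<in> V. R' w z \<and> R' y z} = 0" by (simp only: card.empty)
    have "{z. R w z \<and> R y z} = {z \<in> T. R y z}" using sink by blast
    moreover have "card {z \<in> T. R y z} = of_bool (y \<in> T)"
    proof (cases "y \<in> A")
      case False
      then have "{z \<in> T. R y z} = {}" "y \<notin> T" using only[of y] T y(2) by blast+
      then show ?thesis by (simp only: card.empty of_bool_eq)
    qed (rule orth)
    ultimately have c: "card {z. R w z \<and> R y z} = of_bool (R w y)" using sink by simp
    show ?thesis
      using adj[of w y] c c' R'w[of y] R'x[OF y(2), of w] w y unfolding arc_edge_def by (cases "E w y") auto
  qed
  have E_eq: "arc_edge R' V x y \<longleftrightarrow> E x y" if x: "x \<in> V" and y: "y \<in> V" for x y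
  proof -
    consider "x = y" | "x = w" "y \<noteq> w" | "y = w" "x \<noteq> w" | "x \<noteq> y" "x \<noteq> w" "y \<noteq> w" by blast
    then show ?thesis
    proof cases
      case 1
      then show ?thesis using tree by (auto simp: arc_edge_def is_tree_def plumb_graph_def)
    next
      case 2 then show ?thesis using Ew y by blast
    next
      case 3
      have "arc_edge R' V x w \<longleftrightarrow> arc_edge R' V w x" by (auto simp: arc_edge_def conj_commute add.commute)
      then show ?thesis using 3 Ew[OF x] E_sym by blast
    next
      case 4
      have "{z \<in> V. R' x z \<and> R' y z} = {z. R x z \<and> R y z}" using R'x 4 R_V by blast
      then show ?thesis using adj[OF x y 4(1)] 4 R'x unfolding arc_edge_def by (cases "E x y") auto
    qed
  qed
  have "plumb_iso V E d V' E' (d'(u' := - 1 - int (card T)))"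
    unfolding plumb_iso_def
  proof (intro exI[of _ f] conjI ballI)
    fix x assume x: "x \<in> V"
    show "(d'(u' := - 1 - int (card T))) (f x) = d x"
    proof (cases "x = w")
      case True
      have "{z. R w z} = T" using sink by blast
      then show ?thesis using True f(2) dec[of w] w by simp
    next
      case False
      then have "f x \<noteq> u'" using f x w by (metis DiffD1 bij_betw_inv_into_left)
      moreover have "{z \<in> V. R' x z} = {z. R x z}" using R'x[OF False] R_V by blast
      ultimately show ?thesis using fd[OF x] dec[OF x] by simp
    qed
  qed (use f fE E_eq in auto)
  then show ?thesis using bs by blast
qed

text \<open>Two rounds of \<open>grow\<close>. From \<open>a0\<close> the new vertex must be hit by
  \<open>a0\<close> and a descendant, because by \<open>one_outside\<close> at most one descendant
  hits it; so it is \<open>a1\<close>. From \<open>a0\<close> and \<open>a1\<close> it is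
  \<open>a2\<close>, to which \<open>a0\<close> does not point, so again a descendant does.\<close>

lemma cyc_outside:
  assumes A: "A = {a0,a1,a2}" and dA: "distinct [a0,a1,a2]"
    and R: "R a0 a1" "R a1 a2" "R a2 a0" "\<not> R a1 a0" "\<not> R a2 a1" "\<not> R a0 a2"
    and t: "t \<in> desc" "R t a0"
  shows "\<exists>b1\<in>desc. \<exists>b2\<in>desc. R b1 a1 \<and> R b2 a2"
proof -
  have neq: "a0 \<noteq> a1" "a1 \<noteq> a2" "a0 \<noteq> a2" using dA by auto
  have notA: "x \<notin> A" if "x \<in> desc" for x using that desc_sub by blast
  have not2: "x = y" if "x \<in> desc" "y \<in> desc" "R x a" "R y a" "a \<in> A" for x y a
    using one_outside[OF that(5,3,4)] notA that by blast
  have "\<exists>a\<in>A - {a0}. \<exists>x\<in>desc \<union> {a0}. \<exists>y\<in>desc \<union> {a0}. x \<noteq> y \<and> R x a \<and> R y a"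
    by (rule grow) (use A neq t in auto)
  then obtain a x y where 1: "a \<in> A - {a0}" "x \<in> desc \<union> {a0}" "y \<in> desc \<union> {a0}" "x \<noteq> y" "R x a" "R y a"
    by blast
  then have "R a0 a" "\<exists>b\<in>desc. R b a" using not2 by blast+
  moreover have "a = a1" using 1(1) \<open>R a0 a\<close> R A by blast
  ultimately obtain b1 where b1: "b1 \<in> desc" "R b1 a1" by blast
  have "\<exists>a\<in>A - {a0,a1}. \<exists>x\<in>desc \<union> {a0,a1}. \<exists>y\<in>desc \<union> {a0,a1}. x \<noteq> y \<and> R x a \<and> R y a"
    by (rule grow) (use A neq t b1 in auto)
  then obtain a x y where 2: "a \<in> A - {a0,a1}" "x \<in> desc \<union> {a0,a1}" "y \<in> desc \<union> {a0,a1}" "x \<noteq> y" "R x a" "R y a"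
    by blast
  then have a: "a = a2" using A by blast
  then have "x \<noteq> a0" "y \<noteq> a0" using 2 R by blast+
  then have "\<exists>b\<in>desc. R b a2" using 2 not2[of x y a2] a A by blast
  then show ?thesis using b1 by blast
qed

text \<open>The number of chains starting at \<open>h\<close> decides: three give \<open>W\<close>,
  two give \<open>N\<close> after a rotation, one gives \<open>M\<close>. The cyclic order of the
  chains is fixed, since a chain not starting at \<open>h\<close> starts at the last vertex of the
  preceding one.\<close>

lemma cyc_chains:
  assumes A: "A = {a0,a1,a2}" and dA: "distinct [a0,a1,a2]"
    and R: "\<not> R a1 a0" "\<not> R a2 a1" "\<not> R a0 a2"
    and c: "chain a2 a0 L0 e0" "chain a0 a1 L1 e1" "chain a1 a2 L2 e2"
    and e: "e0 = h" "e1 = h \<or> e1 = last (e0 # L0)" "e2 = h \<or> e2 = last (e1 # L1)"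
  shows "in_W V E d \<or> in_N V E d \<or> in_M V E d"
proof -
  have "last (e0 # L0) \<in> {h} \<union> set L0" using e(1) last_in_set[of L0] by auto
  then have e1: "e1 \<in> {h} \<union> set L0" using e(2) by blast
  have last1: "last (e1 # L1) = e1 \<or> last (e1 # L1) \<in> set L1" using last_in_set[of L1] by auto
  have e2: "e2 \<in> {h} \<union> set L0 \<union> set L1"
  proof (cases "e2 = h")
    case False
    then have "e2 = e1 \<or> e2 \<in> set L1" using e(3) last1 by metis
    then show ?thesis using e1 by blast
  qed simp
  have tc: "three_chains V E d R h a0 a1 a2 L0 L1 L2 e0 e1 e2"
    by (rule three_chainsI[OF A dA R c]) (use e(1) e1 e2 in blast)
  show ?thesis
  proof (cases "e1 = h")
    case e1h: True
    show ?thesis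
    proof (cases "e2 = h")
      case True then show ?thesis using three_chains.W_type[OF tc e(1) e1h True] by simp
    next
      case False
      then have "L1 \<noteq> []" "e2 = last L1" using e(3) e1h by auto
      then show ?thesis using three_chains.N_type[OF tc e(1) e1h] by simp
    qed
  next
    case False
    then have L0: "L0 \<noteq> []" "e1 = last L0" using e(1,2) by auto
    show ?thesis
    proof (cases "e2 = h")
      case True
      have "three_chains V E d R h a2 a0 a1 L2 L0 L1 e2 e0 e1"
        by (rule three_chains.rot[OF three_chains.rot[OF tc]])
      then show ?thesis using three_chains.N_type[OF _ True e(1) L0(2,1)] by simp
    next
      case False
      then have "e2 = last (e1 # L1)" using e(3) by blast
      then show ?thesis using three_chains.M_type[OF tc e(1) L0(2) _ L0(1)] by simp
    qed
  qed
qed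

lemma cyc_type:
  assumes A: "A = {a0,a1,a2}" and dA: "distinct [a0,a1,a2]"
    and R: "R a0 a1" "R a1 a2" "R a2 a0" "\<not> R a1 a0" "\<not> R a2 a1" "\<not> R a0 a2"
  shows "in_W V E d \<or> in_N V E d \<or> in_M V E d \<or> in_A V E d"
proof -
  have neq: "a0 \<noteq> a1" "a1 \<noteq> a2" "a0 \<noteq> a2" using dA by auto
  have ah: "a0 \<noteq> h" "a1 \<noteq> h" "a2 \<noteq> h" using A hA by auto
  have A': "A = {a1,a2,a0}" "A = {a2,a0,a1}" "distinct [a1,a2,a0]" "distinct [a2,a0,a1]"
    using A neq by auto
  obtain t a where t: "t \<in> desc" "a \<in> A" "R t a"
    using ex_sink[of desc] h_desc desc_sub desc_step by blast
  \<comment> \<open>Some descendant hits some member of \<open>A\<close>; by the rotational symmetry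
    it may be taken as the first.\<close>
  have "\<exists>b0\<in>desc. \<exists>b1\<in>desc. \<exists>b2\<in>desc. R b0 a0 \<and> R b1 a1 \<and> R b2 a2"
    using cyc_outside[OF A dA R] cyc_outside[OF A'(1,3) R(2,3,1,5,6,4)]
      cyc_outside[OF A'(2,4) R(3,1,2,6,4,5)] t unfolding A by blast
  then obtain b0 b1 b2 where b: "b0 \<in> desc" "b1 \<in> desc" "b2 \<in> desc" "R b0 a0" "R b1 a1" "R b2 a2"
    by blast
  have bA: "b0 \<notin> A" "b1 \<notin> A" "b2 \<notin> A" using b desc_sub by blast+
  have u0: "x = b0" if "R x a0" "x \<notin> A" for x by (rule one_outside[of a0]) (use that b bA A in auto)
  have u1: "x = b1" if "R x a1" "x \<notin> A" for x by (rule one_outside[of a1]) (use that b bA A in auto)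
  have u2: "x = b2" if "R x a2" "x \<notin> A" for x by (rule one_outside[of a2]) (use that b bA A in auto)
  have D: "desc = V - A"
  proof (rule desc_eq)
    show "x \<in> desc" if "a \<in> A" "R x a" "x \<notin> A" for a x
      using that(1) u0[OF _ that(3)] u1[OF _ that(3)] u2[OF _ that(3)] that(2) b(1-3) A by auto
  qed
  obtain L0 e0 where c0: "chain a2 a0 L0 e0" "last (e0 # L0) = b0"
    using ex_chain[of a2, OF D _ R(3) ah(1) b(4)] b(1) D A by blast
  obtain L1 e1 where c1: "chain a0 a1 L1 e1" "last (e1 # L1) = b1"
    using ex_chain[of a0, OF D _ R(1) ah(2) b(5)] b(2) D A by blast
  obtain L2 e2 where c2: "chain a1 a2 L2 e2" "last (e2 # L2) = b2"
    using ex_chain[of a1, OF D _ R(2) ah(3) b(6)] b(3) D A by blast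
  \<comment> \<open>A chain that does not start at \<open>h\<close> starts at the outside
    in-neighbour of its vertex \<open>a\<close>, which is unique.\<close>
  have e0: "e0 = h \<or> e0 = b2" and e1: "e1 = h \<or> e1 = b0" and e2: "e2 = h \<or> e2 = b1"
    using c0(1) c1(1) c2(1) u0 u1 u2 unfolding chain_def by blast+
  consider "e0 = h" | "e1 = h" | "e2 = h" | "e0 = b2" "e1 = b0" "e2 = b1" using e0 e1 e2 by blast
  then show ?thesis
  proof cases
    case 1
    then show ?thesis using cyc_chains[OF A dA R(4-6) c0(1) c1(1) c2(1)] c0 c1 c2 e1 e2 by blast
  next
    case 2
    then show ?thesis using cyc_chains[OF A'(1,3) R(5,6,4) c1(1) c2(1) c0(1)] c0 c1 c2 e0 e2 by blast
  next
    case 3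
    then show ?thesis using cyc_chains[OF A'(2,4) R(6,4,5) c2(1) c0(1) c1(1)] c0 c1 c2 e0 e1 by blast
  next
    case 4
    \<comment> \<open>If no chain starts at \<open>h\<close>, the chains lead from \<open>b2\<close>
      to \<open>b0\<close> to \<open>b1\<close> to \<open>b2\<close>; acyclicity makes the three
      equal, and this vertex alone hits \<open>A\<close>, in all three members.\<close>
    have r: "(b2,b0) \<in> outer\<^sup>*" "(b0,b1) \<in> outer\<^sup>*" "(b1,b2) \<in> outer\<^sup>*"
      using chain_outer[OF c0(1), of b0] chain_outer[OF c1(1), of b1] chain_outer[OF c2(1), of b2]
        last_in_set[of "e0 # L0"] last_in_set[of "e1 # L1"] last_in_set[of "e2 # L2"] c0 c1 c2 4
      by (metis list.distinct(1))+
    have anti: "antisym (outer\<^sup>*)" by (rule acyclic_impl_antisym_rtrancl[OF acyclic_outer])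
    have eq: "b1 = b0" "b2 = b0"
      using r anti by (meson antisymD rtrancl_trans)+
    define f0 where "f0 x = (if x = h then 0 else if x = a0 then 1 else if x = a1 then 2 else 3 :: nat)" for x
    have f0: "f0 h = 0" "f0 a0 = 1" "f0 a1 = 2" "f0 a2 = 3" using ah neq by (auto simp: f0_def)
    have hs: "R a0 h" "R a1 h" "R a2 h" using in_h A by auto
    note irr' = irr[of a0] irr[of a1] irr[of a2] irr[of h]
    have "\<exists>V' E' d' u. blowup_seq ({0,1,2,3}, T3_E, (\<lambda>v. if v = 0 then -1 else -3), 0) (V', E', d', u) \<and>
      plumb_iso V E d V' E' (d'(u := - 1 - int (card A)))"
    proof (rule blown_up)
      show "A \<subseteq> A" ..
      show "b0 \<in> V - A" using b(1) D by simp
      show "R b0 a \<longleftrightarrow> a \<in> A" if "a \<in> A" for a using that b eq unfolding A by auto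
      show "x = b0" if "R x a" "a \<in> A" "x \<notin> A" for x a using that u0 u1 u2 eq A by auto
      show "card {z \<in> A. R a z} = of_bool (a \<in> A)" if "a \<in> A" for a
      proof -
        have "{z \<in> A. R a0 z} = {a1}" "{z \<in> A. R a1 z} = {a2}" "{z \<in> A. R a2 z} = {a0}"
          using R irr' unfolding A by auto
        moreover have "a = a0 \<or> a = a1 \<or> a = a2" using that unfolding A by blast
        ultimately show ?thesis using that by (elim disjE) simp_all
      qed
      show "bij_betw f0 (insert h A) {0,1,2,3}"
        unfolding bij_betw_def inj_on_def using f0 A by auto
      show "T3_E (f0 x) (f0 y) \<longleftrightarrow> x \<noteq> y \<and> (x = h \<or> y = h)"
        if "x \<in> insert h A" "y \<in> insert h A" for x y
        using that f0 ah neq unfolding A T3_E_def by auto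
      show "of_bool (R x y) + of_bool (R y x) \<noteq> Suc (card {z \<in> insert h A. R x z \<and> R y z})"
        if "x \<in> A" "y \<in> A" "x \<noteq> y" for x y
      proof -
        have "{z \<in> insert h A. R x z \<and> R y z} = {h}"
          using that R irr' hs unfolding A by auto
        then have "card {z \<in> insert h A. R x z \<and> R y z} = 1" by simp
        then show ?thesis using that R unfolding A by auto
      qed
      show "(if f0 a = 0 then - 1 else - 3) = - 1 - int (card {z \<in> insert h A. R a z})" if "a \<in> A" for a
      proof -
        have "{z \<in> insert h A. R a0 z} = {h,a1}" "{z \<in> insert h A. R a1 z} = {h,a2}"
          "{z \<in> insert h A. R a2 z} = {h,a0}"
          using R irr' hs unfolding A by auto
        moreover have "a = a0 \<or> a = a1 \<or> a = a2" using that unfolding A by blast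
        ultimately show ?thesis using f0 ah by (elim disjE) simp_all
      qed
    qed (use f0 in \<open>auto simp: bstate_ok_def T3_E_def\<close>)
    moreover have "- 1 - int (card A) = -4" by (simp add: cardA)
    ultimately have "in_A V E d" unfolding in_A_def T_a_def by (simp only:)
    then show ?thesis by blast
  qed
qed

end

section \<open>The pattern with a two-way arc inside \<open>A\<close>\<close>

context hub_digraph
begin

text \<open>One round of \<open>grow\<close> from \<open>a0\<close> finds a member of
  \<open>A\<close> hit by a descendant. It cannot be \<open>a2\<close>, whose two in-neighbours are
  \<open>a0\<close> and \<open>a1\<close>.\<close>

lemma dbl_outside:
  assumes A: "A = {a0,a1,a2}" and dA: "distinct [a0,a1,a2]"
    and R: "R a0 a2" "R a1 a2"
    and t: "t \<in> desc" "R t a0"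
  shows "\<exists>b1\<in>desc. R b1 a1"
proof -
  have neq: "a0 \<noteq> a1" "a1 \<noteq> a2" "a0 \<noteq> a2" using dA by auto
  have a2h: "a2 \<noteq> h" using A hA by auto
  have notA: "x \<notin> A" if "x \<in> desc" for x using that desc_sub by blast
  have "\<exists>a\<in>A - {a0}. \<exists>x\<in>desc \<union> {a0}. \<exists>y\<in>desc \<union> {a0}. x \<noteq> y \<and> R x a \<and> R y a"
    by (rule grow) (use A neq t in auto)
  then obtain a x y where 1: "a \<in> A - {a0}" "x \<in> desc \<union> {a0}" "y \<in> desc \<union> {a0}" "x \<noteq> y" "R x a" "R y a"
    by blast
  then obtain b where b: "b \<in> desc" "R b a" by blast
  have "a \<noteq> a2"
  proof
    assume "a = a2"
    then have "b = a0 \<or> b = a1" using in_two[OF a2h R neq(1)] b(2) by blast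
    then show False using notA[OF b(1)] A by blast
  qed
  then have "a = a1" using 1(1) A by blast
  then show ?thesis using b by blast
qed

lemma dbl_type:
  assumes A: "A = {a0,a1,a2}" and dA: "distinct [a0,a1,a2]"
    and R: "R a0 a1" "R a1 a0" "R a0 a2" "R a1 a2" "\<not> R a2 a0" "\<not> R a2 a1"
  shows "in_N V E d \<or> in_M V E d \<or> in_B V E d"
proof -
  have neq: "a0 \<noteq> a1" "a1 \<noteq> a2" "a0 \<noteq> a2" using dA by auto
  have ah: "a0 \<noteq> h" "a1 \<noteq> h" "a2 \<noteq> h" using A hA by auto
  have A': "A = {a1,a0,a2}" "distinct [a1,a0,a2]" using A neq by auto
  have in2: "x = a0 \<or> x = a1" if "R x a2" for x using in_two[OF ah(3) R(3,4) neq(1) that] .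
  obtain t a where t: "t \<in> desc" "a \<in> A" "R t a"
    using ex_sink[of desc] h_desc desc_sub desc_step by blast
  have "t \<notin> A" using t(1) desc_sub by blast
  then have "\<not> R t a2" using in2 A by blast
  then have "R t a0 \<or> R t a1" using t(2,3) A by blast
  then have "\<exists>b0\<in>desc. \<exists>b1\<in>desc. R b0 a0 \<and> R b1 a1"
    using dbl_outside[OF A dA R(3,4) t(1)] dbl_outside[OF A' R(4,3) t(1)] t(1) by blast
  then obtain b0 b1 where b: "b0 \<in> desc" "b1 \<in> desc" "R b0 a0" "R b1 a1" by blast
  have bA: "b0 \<notin> A" "b1 \<notin> A" using b desc_sub by blast+
  have u0: "x = b0" if "R x a0" "x \<notin> A" for x by (rule one_outside[of a0]) (use that b bA A in auto)
  have u1: "x = b1" if "R x a1" "x \<notin> A" for x by (rule one_outside[of a1]) (use that b bA A in auto)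
  have u2: "\<not> R x a2" if "x \<notin> A" for x using in2[of x] that A by blast
  have D: "desc = V - A"
  proof (rule desc_eq)
    show "x \<in> desc" if "a \<in> A" "R x a" "x \<notin> A" for a x
      using that(1) u0[OF _ that(3)] u1[OF _ that(3)] u2[OF that(3)] that(2) b(1,2) A by auto
  qed
  obtain L0 e0 where c0: "chain a1 a0 L0 e0" "last (e0 # L0) = b0"
    using ex_chain[of a1, OF D _ R(2) ah(1) b(3)] b(1) D A by blast
  obtain L1 e1 where c1: "chain a0 a1 L1 e1" "last (e1 # L1) = b1"
    using ex_chain[of a0, OF D _ R(1) ah(2) b(4)] b(2) D A by blast
  have e0: "e0 = h \<or> e0 = b1" and e1: "e1 = h \<or> e1 = b0"
    using c0(1) c1(1) u0 u1 unfolding chain_def by blast+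
  have b0: "b0 = e0 \<or> b0 \<in> set L0" using c0(2) last_in_set[of L0] by (auto split: if_splits)
  have b1: "b1 = e1 \<or> b1 \<in> set L1" using c1(2) last_in_set[of L1] by (auto split: if_splits)
  have tc: "two_chains V E d R h a0 a1 a2 L0 L1 e0 e1" if "e0 = h \<or> e1 = h"
    by (rule two_chainsI[OF A dA R(3-6) c0(1) c1(1)]) (use that e0 e1 b0 b1 in auto)
  consider "e0 = h" "e1 = h" | "e0 = h" "e1 \<noteq> h" | "e0 \<noteq> h" "e1 = h" | "e0 \<noteq> h" "e1 \<noteq> h" by blast
  then show ?thesis
  proof cases
    case 1
    then show ?thesis using two_chains.N0_type[OF tc 1] by simp
  next
    case 2
    then have "e1 = b0" using e1 by blast
    then have "L0 \<noteq> []" "e1 = last L0" using c0(2) 2 by auto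
    then show ?thesis using two_chains.M0_type[OF tc 2(1)] 2(1) by simp
  next
    case 3
    then have "e0 = b1" using e0 by blast
    then have "L1 \<noteq> []" "e0 = last L1" using c1(2) 3 by auto
    then show ?thesis using two_chains.M0_type[OF two_chains.swap[OF tc] 3(2)] 3(2) by simp
  next
    case 4
    then have e: "e0 = b1" "e1 = b0" using e0 e1 by auto
    \<comment> \<open>Again no chain starts at \<open>h\<close>, so the two outside in-neighbours
      reach each other and coincide. The set to cut is \<open>{a0,a1}\<close>, as \<open>a2\<close>
      is not hit from outside; this gives the final decoration -3.\<close>
    have r: "(b1,b0) \<in> outer\<^sup>*" "(b0,b1) \<in> outer\<^sup>*"
      using chain_outer[OF c0(1), of b0] chain_outer[OF c1(1), of b1]
        last_in_set[of "e0 # L0"] last_in_set[of "e1 # L1"] c0 c1 e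
      by (metis list.distinct(1))+
    have anti: "antisym (outer\<^sup>*)" by (rule acyclic_impl_antisym_rtrancl[OF acyclic_outer])
    have eq: "b1 = b0" using r anti by (meson antisymD)
    define f0 where "f0 x = (if x = h then 0 else if x = a0 then 1 else if x = a1 then 2 else 3 :: nat)" for x
    have f0: "f0 h = 0" "f0 a0 = 1" "f0 a1 = 2" "f0 a2 = 3" using ah neq by (auto simp: f0_def)
    have hs: "R a0 h" "R a1 h" "R a2 h" using in_h A by auto
    note irr' = irr[of a0] irr[of a1] irr[of a2] irr[of h]
    have outs: "{z \<in> insert h A. R a0 z} = {h,a1,a2}" "{z \<in> insert h A. R a1 z} = {h,a0,a2}"
          "{z \<in> insert h A. R a2 z} = {h}"
      using R irr' hs unfolding A by auto
    have "\<exists>V' E' d' u. blowup_seq ({0,1,2,3}, T3_E, (\<lambda>v. if v = 0 then -1 else if v = 3 then -2 else -4), 0)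
        (V', E', d', u) \<and> plumb_iso V E d V' E' (d'(u := - 1 - int (card {a0,a1})))"
    proof (rule blown_up)
      show "{a0,a1} \<subseteq> A" using A by blast
      show "b0 \<in> V - A" using b(1) D by simp
      show "R b0 a \<longleftrightarrow> a \<in> {a0,a1}" if "a \<in> A" for a
        using that b eq u2[OF bA(1)] neq unfolding A by auto
      show "x = b0" if "R x a" "a \<in> A" "x \<notin> A" for x a using that u0 u1 u2 eq A by auto
      show "card {z \<in> {a0,a1}. R a z} = of_bool (a \<in> {a0,a1})" if "a \<in> A" for a
      proof -
        have "{z \<in> {a0,a1}. R a0 z} = {a1}" "{z \<in> {a0,a1}. R a1 z} = {a0}"
          using R irr' by auto
        moreover have "{z \<in> {a0,a1}. R a2 z} = {}" using R by auto
        then have "card {z \<in> {a0,a1}. R a2 z} = 0" by (simp only: card.empty)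
        moreover have "a = a0 \<or> a = a1 \<or> a = a2" using that unfolding A by blast
        ultimately show ?thesis using neq by (elim disjE) simp_all
      qed
      show "bij_betw f0 (insert h A) {0,1,2,3}"
        unfolding bij_betw_def inj_on_def using f0 A by auto
      show "T3_E (f0 x) (f0 y) \<longleftrightarrow> x \<noteq> y \<and> (x = h \<or> y = h)"
        if "x \<in> insert h A" "y \<in> insert h A" for x y
        using that f0 ah neq unfolding A T3_E_def by auto
      show "of_bool (R x y) + of_bool (R y x) \<noteq> Suc (card {z \<in> insert h A. R x z \<and> R y z})"
        if "x \<in> A" "y \<in> A" "x \<noteq> y" for x y
      proof (cases "x = a2 \<or> y = a2")
        case True
        then have "{z \<in> insert h A. R x z \<and> R y z} = {h}" using outs hs that unfolding A by auto
        then have "card {z \<in> insert h A. R x z \<and> R y z} = 1" by simp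
        then show ?thesis using that R True unfolding A by auto
      next
        case False
        then have "{z \<in> insert h A. R x z \<and> R y z} = {h,a2}"
          using R irr' hs that unfolding A by auto
        then have "card {z \<in> insert h A. R x z \<and> R y z} = 2" using ah by simp
        then show ?thesis by (cases "R x y"; cases "R y x") auto
      qed
      show "(if f0 a = 0 then - 1 else if f0 a = 3 then - 2 else - 4)
          = - 1 - int (card {z \<in> insert h A. R a z})" if "a \<in> A" for a
      proof -
        have "a = a0 \<or> a = a1 \<or> a = a2" using that unfolding A by blast
        then show ?thesis using f0 ah neq outs by (elim disjE) simp_all
      qed
    qed (use f0 in \<open>auto simp: bstate_ok_def T3_E_def\<close>)
    moreover have "- 1 - int (card {a0,a1}) = -3" using neq by simp
    ultimately have "in_B V E d" unfolding in_B_def T_b_def by (simp only:)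
    then show ?thesis by blast
  qed
qed

end

section \<open>The three hub patterns put together\<close>

theorem theorem3p14:
  fixes V :: "'v set" and E :: "'v \<Rightarrow> 'v \<Rightarrow> bool" and d :: "'v \<Rightarrow> int"
    and \<phi> :: "'v \<Rightarrow> nat \<Rightarrow> int"
  assumes S: "in_S V E d"
    and emb: "symplectic_embedding V E d \<phi>"
    and nine: "\<exists>!i. i < card V \<and> index_type9 V \<phi> i"
    and others: "\<forall>i < card V. \<not> index_type9 V \<phi> i \<longrightarrow>
                   index_type4 V \<phi> i \<or> index_type7 V \<phi> i"
  shows "in_W V E d \<or> in_N V E d \<or> in_M V E d \<or> in_A V E d \<or> in_B V E d"
proof -
  obtain R h where "arc_digraph V E d R h" using ex_arc_digraph[OF S emb nine others] by blast
  then interpret arc_digraph V E d R h .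
  show ?thesis
  proof (cases rule: hub_cases)
    case (cyc a0 a1 a2)
    have hs: "R a0 h" "R a1 h" "R a2 h" using cyc(2) by auto
    have ah: "a0 \<noteq> h" "a1 \<noteq> h" "a2 \<noteq> h" using hs irr by blast+
    interpret hub_digraph V E d R h "{a0,a1,a2}"
    proof
      \<comment> \<open>Each member of \<open>A\<close> has an in-neighbour in \<open>A\<close> and
        at most two in all.\<close>
      show "x = y" if "a \<in> {a0,a1,a2}" "R x a" "R y a" "x \<notin> {a0,a1,a2}" "y \<notin> {a0,a1,a2}" for a x y
        using that in_two[OF ah(1) cyc(5), of x y] in_two[OF ah(2) cyc(3), of x y]
          in_two[OF ah(3) cyc(4), of x y] by blast
      show "z = h \<or> z \<in> {a0,a1,a2}" if "a \<in> {a0,a1,a2}" "b \<in> {a0,a1,a2}" "a \<noteq> b" "R a z" "R b z" for a b z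
      proof -
        have "R a h" "R b h" using that(1,2) hs by auto
        \<comment> \<open>A second common out-neighbour would need arcs both ways, which the
          directed triangle lacks.\<close>
        then have "z = h \<or> R a b \<and> R b a" using share2[of a h b z] that(3-5) by blast
        then show ?thesis using that(1-3) cyc(6-8) by blast
      qed
    qed (use cyc(2) in simp)
    show ?thesis using cyc_type[OF HOL.refl cyc(1) cyc(3-8)] by blast
  next
    case (dbl a0 a1 a2)
    have hs: "R a0 h" "R a1 h" "R a2 h" using dbl(2) by auto
    have ah: "a0 \<noteq> h" "a1 \<noteq> h" "a2 \<noteq> h" using hs irr by blast+
    interpret hub_digraph V E d R h "{a0,a1,a2}"
    proof
      show "x = y" if "a \<in> {a0,a1,a2}" "R x a" "R y a" "x \<notin> {a0,a1,a2}" "y \<notin> {a0,a1,a2}" for a x y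
        using that in_two[OF ah(1) dbl(4), of x y] in_two[OF ah(2) dbl(3), of x y]
          in_two[OF ah(3) dbl(5), of x y] by blast
      show "z = h \<or> z \<in> {a0,a1,a2}" if "a \<in> {a0,a1,a2}" "b \<in> {a0,a1,a2}" "a \<noteq> b" "R a z" "R b z" for a b z
      proof -
        have ab: "R a h" "R b h" using that(1,2) hs by auto
        then have *: "z = h \<or> R a b \<and> R b a" using share2[of a h b z] that(3-5) by blast
        show ?thesis
        proof (cases "a = a2 \<or> b = a2")
          case True
          then show ?thesis using * that(1-3) dbl(7,8) by blast
        next
          case False
          then have "R a a2" "R b a2" using that(1,2) dbl(5,6) by auto
          \<comment> \<open>Here \<open>a\<close> and \<open>b\<close> are \<open>a0\<close> and
            \<open>a1\<close>, whose two admissible common out-neighbours are \<open>h\<close> and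
            \<open>a2\<close>.\<close>
          then show ?thesis using share3[OF ab, of a2 z] that(3-5) ah(3) by blast
        qed
      qed
    qed (use dbl(2) in simp)
    show ?thesis using dbl_type[OF HOL.refl dbl(1) dbl(3-8)] by blast
  next
    case (full a0 a1 a2)
    have neq: "a0 \<noteq> a1" "a1 \<noteq> a2" "a0 \<noteq> a2" using full(1) by auto
    have hs: "R a0 h" "R a1 h" "R a2 h" using full(2) by auto
    have ah: "a0 \<noteq> h" "a1 \<noteq> h" "a2 \<noteq> h" using hs irr by blast+
    \<comment> \<open>With all arcs present, each member of \<open>A\<close> has its two
      in-neighbours inside \<open>A\<close>, so nothing outside hits \<open>A\<close>; but
      \<open>ex_sink\<close> produces a descendant of \<open>h\<close> that does.\<close>
    have out_full: "x \<in> {a0,a1,a2}" if "R x a" "a \<in> {a0,a1,a2}" for x a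
      using that in_two[OF ah(1) full(4) full(6) neq(2), of x] in_two[OF ah(2) full(3) full(8) neq(3), of x]
        in_two[OF ah(3) full(5) full(7) neq(1), of x] by blast
    interpret hub_digraph V E d R h "{a0,a1,a2}"
    proof
      show "x = y" if "a \<in> {a0,a1,a2}" "R x a" "R y a" "x \<notin> {a0,a1,a2}" "y \<notin> {a0,a1,a2}" for a x y
        using that out_full by blast
      show "z = h \<or> z \<in> {a0,a1,a2}" if ab: "a \<in> {a0,a1,a2}" "b \<in> {a0,a1,a2}" "a \<noteq> b" "R a z" "R b z" for a b z
      proof -
        obtain c where c: "c \<in> {a0,a1,a2}" "c \<noteq> a" "c \<noteq> b" using ab(1-3) neq by blast
        then have "R a h" "R b h" "R a c" "R b c" "c \<noteq> h" using ab(1-3) hs ah full(3-8) by auto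
        then show ?thesis using share3[of a h b c z] ab(3-5) c(1) by blast
      qed
    qed (use full(2) in simp)
    obtain t a where "t \<in> desc" "a \<in> {a0,a1,a2}" "R t a"
      using ex_sink[of desc] h_desc desc_sub desc_step by blast
    then show ?thesis using out_full desc_sub by blast
  qed
qed

end
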